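(* Let $q\in\mathbf C^*$ and let $\kappa_1,\kappa_2,\theta_1,\theta_2,c_1,c_2,c_3,c_4$ be generic nonzero complex parameters with $\kappa_1\kappa_2c_1c_2c_3c_4=\theta_1\theta_2$. Let $\sigma_1=c_1+c_2+c_3+c_4$ and $\sigma_3=\sum_{i<j<k}c_ic_jc_k$. In the coordinates $(y,\xi)$ on $X_{\kappa_1,\kappa_2,\theta_1,\theta_2}$ and $(\tilde y,\tilde\xi)$ on $X_{q\kappa_1,\kappa_2,q\theta_1,\theta_2}$, the map $\phi:X_{\kappa_1,\kappa_2,\theta_1,\theta_2}\to X_{q\kappa_1,\kappa_2,q\theta_1,\theta_2}$ is the birational transformation $(y,\xi)\mapsto(\tilde y,\tilde\xi)$ given by $$\tilde y=\frac{S}{yT},$$ where $$S=-q\kappa_1\kappa_2\theta_1\xi^2(y-c_3)(y-c_4)+\xi\big((q^2\kappa_1\theta_1+\kappa_2\theta_2)y^2-q\kappa_1\kappa_2\sigma_3y+2q\theta_1\theta_2\big)-q\theta_2(y-c_1)(y-c_2),$$ $$T=-\kappa_1\kappa_2^2\xi^2(y-c_3)(y-c_4)+\xi\big(2q\kappa_1\kappa_2y^2-q\kappa_1\kappa_2\sigma_1y+(q^2\kappa_1\theta_1+\kappa_2\theta_2)\big)-q^2\kappa_1(y-c_1)(y-c_2),$$ and $$\tilde\xi=\frac{c_1c_2}{q\kappa_1\theta_1\xi}\;\frac{\Big(\xi\big(y-\frac{q\theta_1}{c_1\kappa_2}\big)-\frac{q}{\kappa_2}(y-c_2)\Big)\B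ig(\xi\big(y-\frac{q\theta_1}{c_2\kappa_2}\big)-\frac{q}{\kappa_2}(y-c_1)\Big)}{\Big(\xi(y-c_4)-\frac{q}{\kappa_2}\big(y-\frac{\theta_2}{qc_3\kappa_1}\big)\Big)\Big(\xi(y-c_3)-\frac{q}{\kappa_2}\big(y-\frac{\theta_2}{qc_4\kappa_1}\big)\Big)}.$$
   Context: The spaces. Let $H$ be a two-dimensional complex vector space. $\bar X_{\kappa_1,\kappa_2,\theta_1,\theta_2}$ (the $c_i$ being fixed and omitted from the notation) is the space of $A(z)=A_0+A_1z+A_2z^2$ with $A_i\in\mathrm{End}(H)$, such that $A_2$ has spectrum $\{\kappa_1,\kappa_2\}$, $A_0$ has spectrum $\{\theta_1,\theta_2\}$, and $\det A(z)=\kappa_1\kappa_2(z-c_1)(z-c_2)(z-c_3)(z-c_4)$. $X_{\kappa_1,\kappa_2,\theta_1,\theta_2}$ is the quotient of $\bar X_{\kappa_1,\kappa_2,\theta_1,\theta_2}$ by conjugation by $GL(H)$. Parameters are generic; in particular $\kappa_1\ne\kappa_2$, $\theta_1\ne\theta_2$, $q\kappa_1\neq\kappa_2$, $q\theta_1\neq\theta_2$. $E_1,E_2$ denote the eigenspaces of $A_2$ (for $\kappa_1,\kappa_2$) and $F_1,F_2$ those of $A_0$ (for $\theta_1,\theta_2$). The map $\phi$. On the dense open set where $E_2\neq F_1$, choose a basis $(u,v)$ of $H$ with $u\in F_1$, $v\in E_2$; in this basis $A_2=\begin{pmatrix}\kappa_1&0\\ *&\kappa_2\end{pmatrix}$,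 $A_0=\begin{pmatrix}\theta_1&*\\0&\theta_2\end{pmatrix}$. Then $$\hat A(z)=\begin{pmatrix}qz&0\\0&1\end{pmatrix}A(z)\begin{pmatrix}z^{-1}&0\\0&1\end{pmatrix}$$ is a polynomial matrix belonging to $\bar X_{q\kappa_1,\kappa_2,q\theta_1,\theta_2}$ (with the same $c_i$), and $\phi$ is the map $X_{\kappa_1,\kappa_2,\theta_1,\theta_2}\to X_{q\kappa_1,\kappa_2,q\theta_1,\theta_2}$, defined on a dense open set, sending the class of $A$ to the class of $\hat A$. Coordinates. In a basis $(u,v)$ of $H$ with $u\in F_1$, $v\in E_2$, suitably scaled, a generic $A$ has the form $$A(z)=\begin{pmatrix}\kappa_1z^2+az+\theta_1& z-y\\ z(\gamma z+\beta)&\kappa_2z^2+bz+\theta_2\end{pmatrix}.$$ So $y$ is the root of the $12$ entry. The coordinate $\xi$ is defined by $$\xi=\frac{(y-c_1)(y-c_2)}{\kappa_1y^2+ay+\theta_1}.$$ The pair $(y,\xi)$ parametrizes a dense open subset of $X_{\kappa_1,\kappa_2,\theta_1,\theta_2}$. The coordinates $(\tilde y,\tilde\xi)$ on $X_{q\kappa_1,\kappa_2,q\theta_1,\theta_2}$ are defined in the same way, with $\kappa_1,\theta_1$ replaced by $q\kappa_1,q\theta_1$. *)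

theory Defs
  imports "HOL-Analysis.Analysis" "HOL-Computational_Algebra.Polynomial"
begin

section \<open>The spaces\<close>

text \<open>We take \<open>H = complex^2\<close>. A triple \<open>(A0, A1, A2)\<close> stands for \<open>A(z) = A0 + A1 z + A2 z^2\<close>.\<close>

type_synonym mat2 = "complex^2^2"
type_synonym quad = "mat2 \<times> mat2 \<times> mat2"

definition mk_mat2 :: "complex \<Rightarrow> complex \<Rightarrow> complex \<Rightarrow> complex \<Rightarrow> mat2" where
  "mk_mat2 m11 m12 m21 m22 = vector [vector [m11, m12], vector [m21, m22]]"

fun ev :: "quad \<Rightarrow> complex \<Rightarrow> mat2" where
  "ev (A0, A1, A2) z = (\<chi> i j. A0 $ i $ j + A1 $ i $ j * z + A2 $ i $ j * z^2)"

definition spectrum :: "mat2 \<Rightarrow> complex set" where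
  "spectrum M = {k. \<exists>v. v \<noteq> 0 \<and> M *v v = k *s v}"

definition eigenspace :: "mat2 \<Rightarrow> complex \<Rightarrow> (complex^2) set" where
  "eigenspace M k = {v. M *v v = k *s v}"

definition Xbar :: "complex \<Rightarrow> complex \<Rightarrow> complex \<Rightarrow> complex \<Rightarrow> complex \<Rightarrow> complex \<Rightarrow> complex \<Rightarrow> complex
    \<Rightarrow> quad set" where
  "Xbar \<kappa>1 \<kappa>2 \<theta>1 \<theta>2 c1 c2 c3 c4 =
     {(A0, A1, A2). spectrum A2 = {\<kappa>1, \<kappa>2} \<and> spectrum A0 = {\<theta>1, \<theta>2} \<and>
        (\<forall>z. det (ev (A0, A1, A2) z) = \<kappa>1 * \<kappa>2 * (z - c1) * (z - c2) * (z - c3) * (z - c4))}"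

fun conj_by :: "mat2 \<Rightarrow> quad \<Rightarrow> quad" where
  "conj_by P (A0, A1, A2) =
     (matrix_inv P ** A0 ** P, matrix_inv P ** A1 ** P, matrix_inv P ** A2 ** P)"

definition conj_rel :: "quad set \<Rightarrow> (quad \<times> quad) set" where
  "conj_rel S = {(A, B). A \<in> S \<and> B \<in> S \<and> (\<exists>P. invertible P \<and> B = conj_by P A)}"

lemma equiv_conj_rel: "equiv S (conj_rel S)"
proof (rule equivI)
  have inv: "P ** matrix_inv P = mat 1" "matrix_inv P ** P = mat 1" if "invertible P" for P :: mat2
    using that unfolding invertible_def matrix_inv_def by (metis (mono_tags, lifting) someI_ex)+
  have uniq: "matrix_inv P = Q" if "P ** Q = mat 1" "Q ** P = mat 1" for P Q :: mat2
  proof -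
    have "invertible P" using that by (auto simp: invertible_def)
    then have "(Q ** P) ** matrix_inv P = Q"
      by (simp add: inv flip: matrix_mul_assoc)
    then show ?thesis using that by simp
  qed
  have one: "conj_by (mat 1) A = A" for A
    by (cases A) (simp add: uniq[of "mat 1" "mat 1"])
  have comp: "conj_by Q (conj_by P A) = conj_by (P ** Q) A"
    if "invertible P" "invertible Q" for P Q A
  proof -
    have "(P ** Q) ** (matrix_inv Q ** matrix_inv P) = P ** (Q ** matrix_inv Q) ** matrix_inv P"
      by (simp add: matrix_mul_assoc)
    moreover have "(matrix_inv Q ** matrix_inv P) ** (P ** Q) = matrix_inv Q ** (matrix_inv P ** P) ** Q"
      by (simp add: matrix_mul_assoc)
    ultimately have "matrix_inv (P ** Q) = matrix_inv Q ** matrix_inv P"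
      using that by (intro uniq) (simp_all add: inv)
    then show ?thesis by (cases A) (simp add: matrix_mul_assoc)
  qed
  show "conj_rel S \<subseteq> S \<times> S" by (auto simp: conj_rel_def)
  have "invertible (mat 1 :: mat2)" by (auto simp: invertible_def intro!: exI[of _ "mat 1"])
  then show "refl_on S (conj_rel S)"
    by (auto simp: refl_on_def conj_rel_def one simp del: conj_by.simps intro!: exI[of _ "mat 1"])
  show "sym (conj_rel S)"
  proof (rule symI)
    fix A B assume "(A, B) \<in> conj_rel S"
    then obtain P where P: "A \<in> S" "B \<in> S" "invertible P" "B = conj_by P A"
      by (auto simp: conj_rel_def)
    have i: "invertible (matrix_inv P)"
      using inv[OF P(3)] by (auto simp: invertible_def)
    have "conj_by (matrix_inv P) B = A"
      using comp[OF P(3) i, of A] P(4) by (simp add: inv[OF P(3)] one)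
    then show "(B, A) \<in> conj_rel S"
      using P(1,2) i by (auto simp: conj_rel_def)
  qed
  show "trans (conj_rel S)"
  proof (rule transI)
    fix A B C assume "(A, B) \<in> conj_rel S" "(B, C) \<in> conj_rel S"
    then obtain P Q where "A \<in> S" "C \<in> S" "invertible P" "invertible Q"
        "B = conj_by P A" "C = conj_by Q B"
      by (auto simp: conj_rel_def)
    then show "(A, C) \<in> conj_rel S"
      using comp[of P Q A] invertible_mult[of P Q] by (auto simp: conj_rel_def)
  qed
qed

definition X :: "complex \<Rightarrow> complex \<Rightarrow> complex \<Rightarrow> complex \<Rightarrow> complex \<Rightarrow> complex \<Rightarrow> complex \<Rightarrow> complex
    \<Rightarrow> quad set set" where
  "X \<kappa>1 \<kappa>2 \<theta>1 \<theta>2 c1 c2 c3 c4 =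
     Xbar \<kappa>1 \<kappa>2 \<theta>1 \<theta>2 c1 c2 c3 c4 // conj_rel (Xbar \<kappa>1 \<kappa>2 \<theta>1 \<theta>2 c1 c2 c3 c4)"

text \<open>The quotient topology on a quotient \<open>S // r\<close> of a subspace \<open>S\<close>; for \<open>X\<close> the space of
  triples of matrices carries its classical topology.\<close>

definition quot_topology :: "'a::topological_space set \<Rightarrow> ('a \<times> 'a) set \<Rightarrow> 'a set topology" where
  "quot_topology S r = topology (\<lambda>W. W \<subseteq> S // r \<and> openin (top_of_set S) (\<Union>W))"

lemma openin_quot_topology:
  assumes "equiv S r"
  shows "openin (quot_topology S r) W \<longleftrightarrow> W \<subseteq> S // r \<and> openin (top_of_set S) (\<Union>W)"
proof -
  have "istopology (\<lambda>W. W \<subseteq> S // r \<and> openin (top_of_set S) (\<Union>W))"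
    unfolding istopology_def
  proof (intro conjI allI impI; (elim conjE)?)
    fix V W
    assume V: "V \<subseteq> S // r" "openin (top_of_set S) (\<Union>V)"
      and W: "W \<subseteq> S // r" "openin (top_of_set S) (\<Union>W)"
    show "V \<inter> W \<subseteq> S // r" using V by blast
    have "\<Union>(V \<inter> W) = \<Union>V \<inter> \<Union>W"
      using V(1) W(1) quotient_disj[OF assms] by blast
    then show "openin (top_of_set S) (\<Union>(V \<inter> W))"
      using V(2) W(2) by auto
  next
    fix K :: "'a set set set"
    assume K: "\<forall>W\<in>K. W \<subseteq> S // r \<and> openin (top_of_set S) (\<Union>W)"
    then show "\<Union>K \<subseteq> S // r" by blast
    have "\<Union>(\<Union>K) = \<Union>(Union ` K)" by blast
    then show "openin (top_of_set S) (\<Union>(\<Union>K))"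
      using K by (metis (mono_tags, lifting) imageE openin_Union)
  qed
  then show ?thesis by (simp add: quot_topology_def)
qed

definition dense_open_in_X :: "complex \<Rightarrow> complex \<Rightarrow> complex \<Rightarrow> complex \<Rightarrow>
    complex \<Rightarrow> complex \<Rightarrow> complex \<Rightarrow> complex \<Rightarrow> quad set set \<Rightarrow> bool" where
  "dense_open_in_X \<kappa>1 \<kappa>2 \<theta>1 \<theta>2 c1 c2 c3 c4 W \<longleftrightarrow>
     (let S = Xbar \<kappa>1 \<kappa>2 \<theta>1 \<theta>2 c1 c2 c3 c4; \<tau> = quot_topology S (conj_rel S)
      in openin \<tau> W \<and> \<tau> closure_of W = X \<kappa>1 \<kappa>2 \<theta>1 \<theta>2 c1 c2 c3 c4)"

text \<open>Genericity of the parameters. Besides the conditions on \<open>\<kappa>\<close> and \<open>\<theta>\<close>, the last two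
  conditions exclude reducible \<open>A(z)\<close>, in the source and in the target of the map: the
  restriction of \<open>A(z)\<close> to an invariant line would be \<open>\<kappa>\<^sub>k (z - c\<^sub>i) (z - c\<^sub>j)\<close>, with value
  \<open>\<theta>1\<close> or \<open>\<theta>2\<close> at \<open>z = 0\<close>. Since \<open>\<kappa>1 \<kappa>2 c1 c2 c3 c4 = \<theta>1 \<theta>2\<close>, the conditions involving
  \<open>\<theta>2\<close>, and those on \<open>(q \<kappa>1, q \<theta>1)\<close>, follow from the ones listed.\<close>

definition generic_params :: "complex \<Rightarrow> complex \<Rightarrow> complex \<Rightarrow> complex \<Rightarrow> complex \<Rightarrow>
    complex \<Rightarrow> complex \<Rightarrow> complex \<Rightarrow> complex \<Rightarrow> bool" where
  "generic_params q \<kappa>1 \<kappa>2 \<theta>1 \<theta>2 c1 c2 c3 c4 \<longleftrightarrow>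
     \<kappa>1 \<noteq> \<kappa>2 \<and> \<theta>1 \<noteq> \<theta>2 \<and> q * \<kappa>1 \<noteq> \<kappa>2 \<and> q * \<theta>1 \<noteq> \<theta>2 \<and>
     (\<forall>m \<in> {c1*c2, c1*c3, c1*c4, c2*c3, c2*c4, c3*c4}.
        \<theta>1 \<noteq> \<kappa>1 * m \<and> \<theta>1 \<noteq> \<kappa>2 * m \<and> q * \<theta>1 \<noteq> \<kappa>2 * m)"


section \<open>The map\<close>

text \<open>The matrix with columns \<open>u\<close> and \<open>v\<close>; then \<open>conj_by (cols u v) A\<close> is \<open>A\<close> written in the
  basis \<open>(u, v)\<close>.\<close>

definition cols :: "complex^2 \<Rightarrow> complex^2 \<Rightarrow> mat2" where
  "cols u v = mk_mat2 (u $ 1) (v $ 1) (u $ 2) (v $ 2)"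

text \<open>\<open>(u, v)\<close> is a basis of \<open>H\<close> with \<open>u \<in> F\<^sub>1\<close>, \<open>v \<in> E\<^sub>2\<close>.\<close>

fun adapted_basis :: "complex \<Rightarrow> complex \<Rightarrow> quad \<Rightarrow> complex^2 \<Rightarrow> complex^2 \<Rightarrow> bool" where
  "adapted_basis \<kappa>2 \<theta>1 (A0, A1, A2) u v \<longleftrightarrow>
     u \<in> eigenspace A0 \<theta>1 \<and> v \<in> eigenspace A2 \<kappa>2 \<and> invertible (cols u v)"

definition is_hat :: "complex \<Rightarrow> quad \<Rightarrow> quad \<Rightarrow> bool" where
  "is_hat q A B \<longleftrightarrow>
     (\<forall>z. z \<noteq> 0 \<longrightarrow> ev B z = mk_mat2 (q * z) 0 0 1 ** ev A z ** mk_mat2 (inverse z) 0 0 1)"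

text \<open>The set of all elements of \<open>Xbar (q \<kappa>1) \<kappa>2 (q \<theta>1) \<theta>2\<close> conjugate to some
  \<open>diag(q z, 1) A(z) diag(1/z, 1)\<close>, with \<open>A\<close> a representative of \<open>x\<close> written in an adapted basis.
  It is empty if \<open>E\<^sub>2 = F\<^sub>1\<close>; that it is a single class otherwise amounts to \<open>\<phi>\<close> being
  well defined.\<close>

definition phi :: "complex \<Rightarrow> complex \<Rightarrow> complex \<Rightarrow> complex \<Rightarrow> complex \<Rightarrow> complex \<Rightarrow> complex \<Rightarrow>
    complex \<Rightarrow> complex \<Rightarrow> quad set \<Rightarrow> quad set" where
  "phi q \<kappa>1 \<kappa>2 \<theta>1 \<theta>2 c1 c2 c3 c4 x =
     conj_rel (Xbar (q * \<kappa>1) \<kappa>2 (q * \<theta>1) \<theta>2 c1 c2 c3 c4) ``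
       {B. \<exists>A\<in>x. \<exists>u v. adapted_basis \<kappa>2 \<theta>1 A u v \<and> is_hat q (conj_by (cols u v) A) B}"


section \<open>Coordinates\<close>

definition has_coords :: "complex \<Rightarrow> complex \<Rightarrow> complex \<Rightarrow> complex \<Rightarrow> complex \<Rightarrow> complex \<Rightarrow>
    quad set \<Rightarrow> complex \<times> complex \<Rightarrow> bool" where
  "has_coords \<kappa>1 \<kappa>2 \<theta>1 \<theta>2 c1 c2 x p \<longleftrightarrow>
     (\<exists>A\<in>x. \<exists>u v a b \<gamma> \<beta> y. adapted_basis \<kappa>2 \<theta>1 A u v \<and>
        (\<forall>z. ev (conj_by (cols u v) A) z =
           mk_mat2 (\<kappa>1 * z^2 + a * z + \<theta>1) (z - y)
                   (z * (\<gamma> * z + \<beta>))       (\<kappa>2 * z^2 + b * z + \<theta>2)) \<and>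
        \<kappa>1 * y^2 + a * y + \<theta>1 \<noteq> 0 \<and>
        p = (y, (y - c1) * (y - c2) / (\<kappa>1 * y^2 + a * y + \<theta>1)))"

definition coord_dom :: "complex \<Rightarrow> complex \<Rightarrow> complex \<Rightarrow> complex \<Rightarrow> complex \<Rightarrow> complex \<Rightarrow>
    complex \<Rightarrow> complex \<Rightarrow> quad set set" where
  "coord_dom \<kappa>1 \<kappa>2 \<theta>1 \<theta>2 c1 c2 c3 c4 =
     {x \<in> X \<kappa>1 \<kappa>2 \<theta>1 \<theta>2 c1 c2 c3 c4. \<exists>!p. has_coords \<kappa>1 \<kappa>2 \<theta>1 \<theta>2 c1 c2 x p}"

definition coords :: "complex \<Rightarrow> complex \<Rightarrow> complex \<Rightarrow> complex \<Rightarrow> complex \<Rightarrow> complex \<Rightarrow>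
    quad set \<Rightarrow> complex \<times> complex" where
  "coords \<kappa>1 \<kappa>2 \<theta>1 \<theta>2 c1 c2 x = (THE p. has_coords \<kappa>1 \<kappa>2 \<theta>1 \<theta>2 c1 c2 x p)"


section \<open>Birational transformations of the plane\<close>

text \<open>Polynomials in \<open>(y, \<xi>)\<close> are elements of \<open>complex[y][\<xi>]\<close>.\<close>

definition eval2 :: "complex poly poly \<Rightarrow> complex \<times> complex \<Rightarrow> complex" where
  "eval2 f p = poly (poly f [:snd p:]) (fst p)"

definition zariski_open :: "(complex \<times> complex) set \<Rightarrow> bool" where
  "zariski_open U \<longleftrightarrow> (\<exists>I. U = {p. \<exists>f\<in>I. eval2 f p \<noteq> 0})"

definition regular_map_on :: "(complex \<times> complex) set \<Rightarrow> (complex \<times> complex \<Rightarrow> complex \<times> complex)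
    \<Rightarrow> bool" where
  "regular_map_on U F \<longleftrightarrow> (\<exists>f1 g1 f2 g2. \<forall>p\<in>U. eval2 g1 p \<noteq> 0 \<and> eval2 g2 p \<noteq> 0 \<and>
     F p = (eval2 f1 p / eval2 g1 p, eval2 f2 p / eval2 g2 p))"

definition birational_between :: "(complex \<times> complex) set \<Rightarrow> (complex \<times> complex) set \<Rightarrow>
    (complex \<times> complex \<Rightarrow> complex \<times> complex) \<Rightarrow> bool" where
  "birational_between U V F \<longleftrightarrow>
     zariski_open U \<and> U \<noteq> {} \<and> zariski_open V \<and> V \<noteq> {} \<and> bij_betw F U V \<and>
     regular_map_on U F \<and> regular_map_on V (the_inv_into U F)"


section \<open>The formulas\<close>

definition S_poly :: "complex \<Rightarrow> complex \<Rightarrow> complex \<Rightarrow> complex \<Rightarrow> complex \<Rightarrow> complex \<Rightarrow> complex \<Rightarrow>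
    complex \<Rightarrow> complex \<Rightarrow> complex \<Rightarrow> complex \<Rightarrow> complex" where
  "S_poly q \<kappa>1 \<kappa>2 \<theta>1 \<theta>2 c1 c2 c3 c4 y \<xi> =
     (let \<sigma>3 = c1*c2*c3 + c1*c2*c4 + c1*c3*c4 + c2*c3*c4 in
      - q * \<kappa>1 * \<kappa>2 * \<theta>1 * \<xi>^2 * (y - c3) * (y - c4)
      + \<xi> * ((q^2 * \<kappa>1 * \<theta>1 + \<kappa>2 * \<theta>2) * y^2 - q * \<kappa>1 * \<kappa>2 * \<sigma>3 * y + 2 * q * \<theta>1 * \<theta>2)
      - q * \<theta>2 * (y - c1) * (y - c2))"

definition T_poly :: "complex \<Rightarrow> complex \<Rightarrow> complex \<Rightarrow> complex \<Rightarrow> complex \<Rightarrow> complex \<Rightarrow> complex \<Rightarrow>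
    complex \<Rightarrow> complex \<Rightarrow> complex \<Rightarrow> complex \<Rightarrow> complex" where
  "T_poly q \<kappa>1 \<kappa>2 \<theta>1 \<theta>2 c1 c2 c3 c4 y \<xi> =
     (let \<sigma>1 = c1 + c2 + c3 + c4 in
      - \<kappa>1 * \<kappa>2^2 * \<xi>^2 * (y - c3) * (y - c4)
      + \<xi> * (2 * q * \<kappa>1 * \<kappa>2 * y^2 - q * \<kappa>1 * \<kappa>2 * \<sigma>1 * y + (q^2 * \<kappa>1 * \<theta>1 + \<kappa>2 * \<theta>2))
      - q^2 * \<kappa>1 * (y - c1) * (y - c2))"

definition xi_num :: "complex \<Rightarrow> complex \<Rightarrow> complex \<Rightarrow> complex \<Rightarrow> complex \<Rightarrow> complex \<Rightarrow> complex
    \<Rightarrow> complex" where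
  "xi_num q \<kappa>2 \<theta>1 c1 c2 y \<xi> =
     (\<xi> * (y - q * \<theta>1 / (c1 * \<kappa>2)) - q / \<kappa>2 * (y - c2)) *
     (\<xi> * (y - q * \<theta>1 / (c2 * \<kappa>2)) - q / \<kappa>2 * (y - c1))"

definition xi_den :: "complex \<Rightarrow> complex \<Rightarrow> complex \<Rightarrow> complex \<Rightarrow> complex \<Rightarrow> complex \<Rightarrow> complex
    \<Rightarrow> complex \<Rightarrow> complex" where
  "xi_den q \<kappa>1 \<kappa>2 \<theta>2 c3 c4 y \<xi> =
     (\<xi> * (y - c4) - q / \<kappa>2 * (y - \<theta>2 / (q * c3 * \<kappa>1))) *
     (\<xi> * (y - c3) - q / \<kappa>2 * (y - \<theta>2 / (q * c4 * \<kappa>1)))"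

definition phi_formula :: "complex \<Rightarrow> complex \<Rightarrow> complex \<Rightarrow> complex \<Rightarrow> complex \<Rightarrow> complex \<Rightarrow>
    complex \<Rightarrow> complex \<Rightarrow> complex \<Rightarrow> complex \<times> complex \<Rightarrow> complex \<times> complex" where
  "phi_formula q \<kappa>1 \<kappa>2 \<theta>1 \<theta>2 c1 c2 c3 c4 = (\<lambda>(y, \<xi>).
     (S_poly q \<kappa>1 \<kappa>2 \<theta>1 \<theta>2 c1 c2 c3 c4 y \<xi> / (y * T_poly q \<kappa>1 \<kappa>2 \<theta>1 \<theta>2 c1 c2 c3 c4 y \<xi>),
      c1 * c2 / (q * \<kappa>1 * \<theta>1 * \<xi>) *
        (xi_num q \<kappa>2 \<theta>1 c1 c2 y \<xi> / xi_den q \<kappa>1 \<kappa>2 \<theta>2 c3 c4 y \<xi>)))"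

end

(* Write w for the 11 entry of A at its root y, and n = q w. In a basis adapted to both the new and
   the old eigenlines, A^(z) becomes
     [[N(z), z (y - z)], [l (z - y~), Y(z)]],   N = k2 z^2 + d z + q t1,   Y = q k1 z^2 + e z + t2,
   and N Y + l z (z - y) (z - y~) = det A^(z) is symmetric in y and y~. Here y is the old coordinate,
   with n = N(y), and y~ is the new one, where N(y~) is the new 22 entry at y~. Hence
   (y, N(y)) |-> (y~, N(y~)) is an involution, and the map of the theorem is this involution read
   through (y, xi) |-> (y, n) on both sides. The product formula for xi~ is the resultant of N and the
   determinant, evaluated at the two roots of N.
   Density: near a point where the 11 entry does not vanish, the determinant equation can be solved
   for b, so that the remaining chart parameters move freely; the other points are limits of such
   points. When E2 = F1 one uses the chart in which t1 and t2 are exchanged. *)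

theory Submission
  imports Defs
begin

section \<open>Entrywise algebra of 2 x 2 matrices, conjugation and spectra\<close>

section \<open>Two-by-two matrices\<close>

text \<open>Why (y, n) carries all the information: the outer coefficients of N and Y are
  prescribed, so n = N(y) fixes the middle coefficient of N and K(y) / n = Y(y) that of Y, where K
  is the determinant of the target. Then l and y~ are read off from the outer coefficients of K - N
  Y, one root y being known.

  The second coordinate is read differently on the two sides: n is q times the 11 entry at the root
  in the source, but the 22 entry at the root in the target. The product of the diagonal entries is
  the determinant there, so either one determines the other.

  Genericity enters twice. Distinct eigenvalues make the normal form unique up to rescaling the
  basis. Excluding reducible A makes the 12 entry a nonzero polynomial; the 21 entry is then a
  quotient by it, and a chart is governed by a single equation \<open>Phi = 0\<close>.

  The delicate points for density are those where both diagonal entries vanish at the root of the 12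
  entry: the equation can then be solved neither for a nor for b, and an explicit curve with
  prescribed diagonal values is used.\<close>

lemma mk_mat2_nth [simp]:
  "mk_mat2 a b c d $ 1 $ 1 = a" "mk_mat2 a b c d $ 1 $ 2 = b"
  "mk_mat2 a b c d $ 2 $ 1 = c" "mk_mat2 a b c d $ 2 $ 2 = d"
  by (simp_all add: mk_mat2_def)

lemma mat2_eq_iff:
  "M = N \<longleftrightarrow> M $ 1 $ 1 = N $ 1 $ 1 \<and> M $ 1 $ 2 = N $ 1 $ 2 \<and>
     M $ 2 $ 1 = N $ 2 $ 1 \<and> M $ 2 $ 2 = N $ 2 $ 2" for M N :: mat2
  by (auto simp: vec_eq_iff forall_2)

lemma mat2_mult_nth: "(M ** N) $ i $ j = M $ i $ 1 * N $ 1 $ j + M $ i $ 2 * N $ 2 $ j" for M N :: mat2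
  by (simp add: matrix_matrix_mult_def sum_2)

lemma mat2_vec_nth: "(M *v v) $ i = M $ i $ 1 * v $ 1 + M $ i $ 2 * v $ 2" for M :: mat2
  by (simp add: matrix_vector_mult_def sum_2)

definition det2 :: "complex^2 \<Rightarrow> complex^2 \<Rightarrow> complex" where
  "det2 u v = u $ 1 * v $ 2 - u $ 2 * v $ 1"

definition vec2 :: "complex \<Rightarrow> complex \<Rightarrow> complex^2" where
  "vec2 x y = vector [x, y]"

lemma vec2_nth [simp]: "vec2 x y $ 1 = x" "vec2 x y $ 2 = y"
  by (simp_all add: vec2_def)

lemma cols_nth [simp]:
  "cols u v $ 1 $ 1 = u $ 1" "cols u v $ 1 $ 2 = v $ 1"
  "cols u v $ 2 $ 1 = u $ 2" "cols u v $ 2 $ 2 = v $ 2"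
  by (simp_all add: cols_def)

lemma invertible_mat2_iff: "invertible M \<longleftrightarrow> M $ 1 $ 1 * M $ 2 $ 2 - M $ 1 $ 2 * M $ 2 $ 1 \<noteq> 0"
  for M :: mat2
  by (simp add: invertible_det_nz det_2)

lemma invertible_cols_iff: "invertible (cols u v) \<longleftrightarrow> det2 u v \<noteq> 0"
  by (simp add: invertible_mat2_iff det2_def mult.commute)

lemma matrix_inv_cancel:
  fixes P :: mat2
  assumes "invertible P"
  shows "P ** matrix_inv P = mat 1" "matrix_inv P ** P = mat 1"
  using assms unfolding invertible_def matrix_inv_def by (metis (mono_tags, lifting) someI_ex)+

lemma invertible_matrix_inv: "invertible P \<Longrightarrow> invertible (matrix_inv P)" for P :: mat2
  using matrix_inv_cancel[of P] by (auto simp: invertible_def)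

text \<open>Clearing the inverse turns conjugation into an intertwining relation, which is
  polynomial in the entries and so within reach of \<open>algebra\<close>.\<close>

lemma matrix_inv_conj_iff:
  fixes M N P :: mat2
  assumes "invertible P"
  shows "matrix_inv P ** M ** P = N \<longleftrightarrow> M ** P = P ** N"
proof
  assume "matrix_inv P ** M ** P = N"
  then have "P ** N = (P ** matrix_inv P) ** M ** P"
    by (auto simp: matrix_mul_assoc)
  then show "M ** P = P ** N" by (simp add: matrix_inv_cancel[OF assms])
next
  assume "M ** P = P ** N"
  then have "matrix_inv P ** M ** P = (matrix_inv P ** P) ** N"
    by (simp flip: matrix_mul_assoc)
  then show "matrix_inv P ** M ** P = N" by (simp add: matrix_inv_cancel[OF assms])
qed

lemma conj_by_eq_iff:
  assumes "invertible P"
  shows "conj_by P (A0, A1, A2) = (B0, B1, B2) \<longleftrightarrow>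
    A0 ** P = P ** B0 \<and> A1 ** P = P ** B1 \<and> A2 ** P = P ** B2"
  using assms by (simp add: matrix_inv_conj_iff)

lemma conj_by_mult:
  assumes "invertible P" "invertible Q"
  shows "conj_by Q (conj_by P A) = conj_by (P ** Q) A"
proof -
  obtain A0 A1 A2 where A: "A = (A0, A1, A2)" by (cases A)
  obtain B0 B1 B2 where B: "conj_by P A = (B0, B1, B2)" by (cases "conj_by P A")
  obtain C0 C1 C2 where C: "conj_by Q (conj_by P A) = (C0, C1, C2)"
    by (cases "conj_by Q (conj_by P A)")
  have "A0 ** P = P ** B0" "A1 ** P = P ** B1" "A2 ** P = P ** B2"
    using B assms unfolding A conj_by_eq_iff[OF assms(1)] by auto
  moreover have "B0 ** Q = Q ** C0" "B1 ** Q = Q ** C1" "B2 ** Q = Q ** C2"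
    using C assms unfolding B conj_by_eq_iff[OF assms(2)] by auto
  ultimately have "A0 ** (P ** Q) = (P ** Q) ** C0" "A1 ** (P ** Q) = (P ** Q) ** C1"
    "A2 ** (P ** Q) = (P ** Q) ** C2"
    by (metis matrix_mul_assoc)+
  then have "conj_by (P ** Q) A = (C0, C1, C2)"
    unfolding A using conj_by_eq_iff[OF invertible_mult[OF assms]] by blast
  then show ?thesis using C by simp
qed

lemma invertible_mat_1: "invertible (mat 1 :: mat2)"
  by (simp add: invertible_mat2_iff mat_def)

lemma conj_by_mat_1 [simp]: "conj_by (mat 1) A = A"
proof (cases A)
  case (fields A0 A1 A2)
  then show ?thesis using conj_by_eq_iff[OF invertible_mat_1, of A0 A1 A2 A0 A1 A2] by simp
qed

lemma conj_by_inverse: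
  assumes "invertible P"
  shows "conj_by (matrix_inv P) (conj_by P A) = A" "conj_by P (conj_by (matrix_inv P) A) = A"
  using assms invertible_matrix_inv[OF assms] by (simp_all add: conj_by_mult matrix_inv_cancel)

lemma mem_spectrum_iff:
  "k \<in> spectrum M \<longleftrightarrow> (M $ 1 $ 1 - k) * (M $ 2 $ 2 - k) - M $ 1 $ 2 * M $ 2 $ 1 = 0"
proof
  assume "k \<in> spectrum M"
  then obtain v where v: "v \<noteq> 0" "M *v v = k *s v" by (auto simp: spectrum_def)
  then have e: "M $ 1 $ 1 * v $ 1 + M $ 1 $ 2 * v $ 2 = k * v $ 1"
    "M $ 2 $ 1 * v $ 1 + M $ 2 $ 2 * v $ 2 = k * v $ 2"
    by (simp_all add: vec_eq_iff forall_2 mat2_vec_nth)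
  let ?D = "(M $ 1 $ 1 - k) * (M $ 2 $ 2 - k) - M $ 1 $ 2 * M $ 2 $ 1"
  \<comment> \<open>The adjugate of \<open>M - k\<close> times \<open>M - k\<close> is this
    determinant times the identity, so the determinant annihilates \<open>v\<close>.\<close>
  have "?D * v $ 1 = 0" "?D * v $ 2 = 0" using e by algebra+
  moreover have "v $ 1 \<noteq> 0 \<or> v $ 2 \<noteq> 0" using v(1) by (simp add: vec_eq_iff forall_2)
  ultimately show "?D = 0" by auto
next
  assume D: "(M $ 1 $ 1 - k) * (M $ 2 $ 2 - k) - M $ 1 $ 2 * M $ 2 $ 1 = 0"
  show "k \<in> spectrum M"
  proof (cases "M $ 1 $ 2 = 0 \<and> M $ 1 $ 1 = k")
    case False
    \<comment> \<open>This vector is killed by the first row of \<open>M - k\<close>. If it is zero,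
      the second row is used, and if both rows vanish any vector will do.\<close>
    have "M *v vec2 (- M $ 1 $ 2) (M $ 1 $ 1 - k) = k *s vec2 (- M $ 1 $ 2) (M $ 1 $ 1 - k)"
      using D by (simp add: vec_eq_iff forall_2 mat2_vec_nth algebra_simps)
    moreover have "vec2 (- M $ 1 $ 2) (M $ 1 $ 1 - k) \<noteq> 0"
      using False by (auto simp: vec_eq_iff forall_2)
    ultimately show ?thesis by (auto simp: spectrum_def)
  next
    case True
    show ?thesis
    proof (cases "M $ 2 $ 1 = 0 \<and> M $ 2 $ 2 = k")
      case False
      have "M *v vec2 (M $ 2 $ 2 - k) (- M $ 2 $ 1) = k *s vec2 (M $ 2 $ 2 - k) (- M $ 2 $ 1)"
        using D True by (simp add: vec_eq_iff forall_2 mat2_vec_nth algebra_simps)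
      moreover have "vec2 (M $ 2 $ 2 - k) (- M $ 2 $ 1) \<noteq> 0"
        using False by (auto simp: vec_eq_iff forall_2)
      ultimately show ?thesis by (auto simp: spectrum_def)
    next
      case False': True
      have "M *v vec2 1 0 = k *s vec2 1 0" "vec2 1 0 \<noteq> 0"
        using True False' by (simp_all add: vec_eq_iff forall_2 mat2_vec_nth)
      then show ?thesis by (auto simp: spectrum_def)
    qed
  qed
qed

text \<open>Distinctness is what lets trace and determinant encode the set of eigenvalues;
  membership in \<open>Xbar\<close> thereby becomes a system of polynomial equations.\<close>

lemma spectrum_eq_iff:
  assumes "k \<noteq> l"
  shows "spectrum M = {k, l} \<longleftrightarrow>
    M $ 1 $ 1 + M $ 2 $ 2 = k + l \<and> M $ 1 $ 1 * M $ 2 $ 2 - M $ 1 $ 2 * M $ 2 $ 1 = k * l"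
proof
  assume "spectrum M = {k, l}"
  then have "k \<in> spectrum M" "l \<in> spectrum M" by auto
  then have e: "(M $ 1 $ 1 - k) * (M $ 2 $ 2 - k) - M $ 1 $ 2 * M $ 2 $ 1 = 0"
    "(M $ 1 $ 1 - l) * (M $ 2 $ 2 - l) - M $ 1 $ 2 * M $ 2 $ 1 = 0"
    by (simp_all add: mem_spectrum_iff)
  then have "(k - l) * (k + l - (M $ 1 $ 1 + M $ 2 $ 2)) = 0" by algebra
  then have "M $ 1 $ 1 + M $ 2 $ 2 = k + l" using assms by simp
  with e show "M $ 1 $ 1 + M $ 2 $ 2 = k + l \<and>
      M $ 1 $ 1 * M $ 2 $ 2 - M $ 1 $ 2 * M $ 2 $ 1 = k * l"
    by algebra
next
  assume e: "M $ 1 $ 1 + M $ 2 $ 2 = k + l \<and>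
    M $ 1 $ 1 * M $ 2 $ 2 - M $ 1 $ 2 * M $ 2 $ 1 = k * l"
  have "(M $ 1 $ 1 - x) * (M $ 2 $ 2 - x) - M $ 1 $ 2 * M $ 2 $ 1 = (x - k) * (x - l)" for x
    using e by algebra
  then show "spectrum M = {k, l}" by (auto simp: mem_spectrum_iff)
qed

lemma ev_mat2: "ev (A0, A1, A2) z = mk_mat2
    (A0 $ 1 $ 1 + A1 $ 1 $ 1 * z + A2 $ 1 $ 1 * z^2) (A0 $ 1 $ 2 + A1 $ 1 $ 2 * z + A2 $ 1 $ 2 * z^2)
    (A0 $ 2 $ 1 + A1 $ 2 $ 1 * z + A2 $ 2 $ 1 * z^2) (A0 $ 2 $ 2 + A1 $ 2 $ 2 * z + A2 $ 2 $ 2 * z^2)"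
  by (simp add: mat2_eq_iff)

text \<open>Only nonzero points are compared, because \<open>is_hat\<close> is silent at 0 and
  because determinant identities are used after division by z. The points 1, -1 and 2
  suffice.\<close>

lemma quadratic_coeffs_eq:
  fixes a b c a' b' c' :: complex
  assumes "\<And>z. z \<noteq> 0 \<Longrightarrow> a + b * z + c * z^2 = a' + b' * z + c' * z^2"
  shows "a = a' \<and> b = b' \<and> c = c'"
proof -
  have e: "a + b + c = a' + b' + c'" "a - b + c = a' - b' + c'"
    "a + b * 2 + c * 4 = a' + b' * 2 + c' * 4"
    using assms[of 1] assms[of "-1"] assms[of 2] by simp_all
  have b: "b = b'" using e(1,2) by algebra
  have "3 * (c - c') = 0" using e(1,3) b by algebra
  then have "c = c'" by simp
  then show ?thesis using e(1) b by simp
qed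

lemma ev_inject:
  assumes "\<And>z. z \<noteq> 0 \<Longrightarrow> ev A z = ev B z"
  shows "A = B"
proof -
  obtain A0 A1 A2 B0 B1 B2 where AB: "A = (A0, A1, A2)" "B = (B0, B1, B2)"
    by (cases A, cases B) auto
  have "A0 $ i $ j = B0 $ i $ j \<and> A1 $ i $ j = B1 $ i $ j \<and> A2 $ i $ j = B2 $ i $ j" for i j
    by (rule quadratic_coeffs_eq) (use assms in \<open>simp add: AB vec_eq_iff\<close>)
  then show ?thesis by (simp add: AB vec_eq_iff)
qed

lemma ev_conj_by:
  assumes "invertible P"
  shows "ev A z ** P = P ** ev (conj_by P A) z"
proof -
  obtain A0 A1 A2 B0 B1 B2 where AB: "A = (A0, A1, A2)" "conj_by P A = (B0, B1, B2)"
    by (cases A, cases "conj_by P A") auto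
  then have "A0 ** P = P ** B0 \<and> A1 ** P = P ** B1 \<and> A2 ** P = P ** B2"
    using conj_by_eq_iff[OF assms] by blast
  then show ?thesis unfolding AB(2) unfolding AB(1)
    by (simp add: ev_mat2 mat2_eq_iff mat2_mult_nth del: ev.simps) algebra
qed

lemma mat2_similar:
  fixes M N P :: mat2
  assumes "invertible P" "M ** P = P ** N"
  shows "det N = det M" "N $ 1 $ 1 + N $ 2 $ 2 = M $ 1 $ 1 + M $ 2 $ 2"
proof -
  have d: "det P \<noteq> 0" using assms(1) by (simp add: invertible_det_nz)
  have "det M * det P = det P * det N" using assms(2) by (metis det_mul)
  then show "det N = det M" using d by simp
  have "(N $ 1 $ 1 + N $ 2 $ 2) * det P = (M $ 1 $ 1 + M $ 2 $ 2) * det P"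
    using assms(2) by (simp add: mat2_eq_iff mat2_mult_nth det_2) algebra
  then show "N $ 1 $ 1 + N $ 2 $ 2 = M $ 1 $ 1 + M $ 2 $ 2" using d by simp
qed


declare conj_by.simps [simp del]


section \<open>Normal forms in an adapted basis and the determinant equation\<close>

section \<open>Charts of the space\<close>

lemma split_quadratic:
  fixes k a t :: complex
  assumes "k \<noteq> 0"
  obtains r s where "\<And>z. k * z^2 + a * z + t = k * (z - r) * (z - s)"
proof -
  obtain d where d: "d^2 = a^2 - 4 * k * t" by (metis power2_csqrt)
  have "k * z^2 + a * z + t = k * (z - (d - a) / (2 * k)) * (z - (- d - a) / (2 * k))" for z
  proof -
    have "4 * k * (k * z^2 + a * z + t) = (2 * k * z - (d - a)) * (2 * k * z - (- d - a))"
      using d by algebra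
    also have "\<dots> = 4 * k * (k * (z - (d - a) / (2 * k)) * (z - (- d - a) / (2 * k)))"
      using assms by (simp add: field_simps)
    finally show ?thesis using assms by simp
  qed
  then show thesis by (rule that)
qed

text \<open>The c's may coincide, so comparing sets of roots would lose multiplicities: the factor
  of \<open>r\<close> is cancelled as a polynomial before \<open>s\<close> is located among the
  remaining three.\<close>

lemma product_of_two_roots:
  fixes r s r' s' c1 c2 c3 c4 :: complex
  assumes "\<And>z. (z - r) * (z - s) * (z - r') * (z - s') = (z - c1) * (z - c2) * (z - c3) * (z - c4)"
  shows "r * s \<in> {c1*c2, c1*c3, c1*c4, c2*c3, c2*c4, c3*c4}"
proof -
  have "poly ([:-r, 1:] * ([:-s, 1:] * ([:-r', 1:] * [:-s', 1:]))) z
      = poly ([:-c1, 1:] * ([:-c2, 1:] * ([:-c3, 1:] * [:-c4, 1:]))) z" for z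
    using assms[of z] by (simp add: algebra_simps)
  then have E: "[:-r, 1:] * ([:-s, 1:] * ([:-r', 1:] * [:-s', 1:]))
      = [:-c1, 1:] * ([:-c2, 1:] * ([:-c3, 1:] * [:-c4, 1:]))"
    by (simp only: poly_eq_poly_eq_iff[symmetric] fun_eq_iff) blast
  have cancel: "s \<in> {x, y, z}"
    if "[:-r, 1:] * ([:-s, 1:] * Q) = [:-r, 1:] * ([:-x, 1:] * ([:-y, 1:] * [:-z, 1:]))"
    for x y z Q
  proof -
    have "[:-r, 1:] \<noteq> 0" by simp
    then have "[:-s, 1:] * Q = [:-x, 1:] * ([:-y, 1:] * [:-z, 1:])"
      using that mult_left_cancel by blast
    then have "poly ([:-s, 1:] * Q) s = poly ([:-x, 1:] * ([:-y, 1:] * [:-z, 1:])) s" by simp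
    then have "(s - x) * ((s - y) * (s - z)) = 0" by (simp add: algebra_simps)
    then show ?thesis by auto
  qed
  have "r \<in> {c1, c2, c3, c4}" using assms[of r] by auto
  then consider "r = c1" | "r = c2" | "r = c3" | "r = c4" by auto
  then show ?thesis
  proof cases
    case 1
    then have "s \<in> {c2, c3, c4}" using E by (intro cancel[of "[:-r', 1:] * [:-s', 1:]"]) (simp only: ac_simps)
    then show ?thesis using 1 by auto
  next
    case 2
    then have "s \<in> {c1, c3, c4}" using E by (intro cancel[of "[:-r', 1:] * [:-s', 1:]"]) (simp only: ac_simps)
    then show ?thesis using 2 by auto
  next
    case 3
    then have "s \<in> {c1, c2, c4}" using E by (intro cancel[of "[:-r', 1:] * [:-s', 1:]"]) (simp only: ac_simps)
    then show ?thesis using 3 by auto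
  next
    case 4
    then have "s \<in> {c1, c2, c3}" using E by (intro cancel[of "[:-r', 1:] * [:-s', 1:]"]) (simp only: ac_simps)
    then show ?thesis using 4 by auto
  qed
qed

text \<open>Instantiated for the source, for the target, and with \<theta>1 and \<theta>2 exchanged;
  \<open>irreducible\<close> treats the two \<theta>'s alike so that it survives the
  exchange.\<close>

locale space_params =
  fixes \<kappa>1 \<kappa>2 \<theta>1 \<theta>2 c1 c2 c3 c4 :: complex
  assumes nz: "\<kappa>1 \<noteq> 0" "\<kappa>2 \<noteq> 0" "\<theta>1 \<noteq> 0" "\<theta>2 \<noteq> 0"
    and rel: "\<kappa>1 * \<kappa>2 * c1 * c2 * c3 * c4 = \<theta>1 * \<theta>2"
    and distinct: "\<kappa>1 \<noteq> \<kappa>2" "\<theta>1 \<noteq> \<theta>2"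
    and irreducible: "\<And>m. m \<in> {c1*c2, c1*c3, c1*c4, c2*c3, c2*c4, c3*c4} \<Longrightarrow>
      \<theta>1 \<noteq> \<kappa>1 * m \<and> \<theta>2 \<noteq> \<kappa>1 * m"
begin

abbreviation "XB \<equiv> Xbar \<kappa>1 \<kappa>2 \<theta>1 \<theta>2 c1 c2 c3 c4"

definition K :: "complex \<Rightarrow> complex" where
  "K z = \<kappa>1 * \<kappa>2 * (z - c1) * (z - c2) * (z - c3) * (z - c4)"

text \<open>The 12 entry is \<open>\<alpha> * z - \<delta>\<close>: homogeneous coordinates for its
  root y = \<delta> / \<alpha>, so that a root at infinity is covered as well.\<close>

definition nf :: "complex \<Rightarrow> complex \<Rightarrow> complex \<Rightarrow> complex \<Rightarrow> complex \<Rightarrow> complex \<Rightarrow> quad" where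
  "nf a b \<alpha> \<delta> \<gamma> \<beta> = (mk_mat2 \<theta>1 (- \<delta>) 0 \<theta>2, mk_mat2 a \<alpha> \<beta> b, mk_mat2 \<kappa>1 0 \<gamma> \<kappa>2)"

text \<open>With \<open>A11\<close> and \<open>A22\<close> the diagonal entries of \<open>nf a b \<alpha> \<delta> \<gamma> \<beta>\<close>, one has
  \<open>A11 A22 - K = z (g2 z^2 + g1 z + g0)\<close>.\<close>

definition g0 :: "complex \<Rightarrow> complex \<Rightarrow> complex" where
  "g0 a b = a * \<theta>2 + b * \<theta>1 + \<kappa>1 * \<kappa>2 * (c1*c2*c3 + c1*c2*c4 + c1*c3*c4 + c2*c3*c4)"

definition g1 :: "complex \<Rightarrow> complex \<Rightarrow> complex" where
  "g1 a b = \<kappa>1 * \<theta>2 + \<kappa>2 * \<theta>1 + a * b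
     - \<kappa>1 * \<kappa>2 * (c1*c2 + c1*c3 + c1*c4 + c2*c3 + c2*c4 + c3*c4)"

definition g2 :: "complex \<Rightarrow> complex \<Rightarrow> complex" where
  "g2 a b = \<kappa>1 * b + \<kappa>2 * a + \<kappa>1 * \<kappa>2 * (c1 + c2 + c3 + c4)"

text \<open>Coefficientwise form of g2 z^2 + g1 z + g0 = (\<alpha> z - \<delta>) (\<gamma> z +
  \<beta>).\<close>

definition nf_eqs :: "complex \<Rightarrow> complex \<Rightarrow> complex \<Rightarrow> complex \<Rightarrow> complex \<Rightarrow> complex \<Rightarrow> bool" where
  "nf_eqs a b \<alpha> \<delta> \<gamma> \<beta> \<longleftrightarrow> \<alpha> * \<gamma> = g2 a b \<and> \<alpha> * \<beta> - \<delta> * \<gamma> = g1 a b \<and> - (\<delta> * \<beta>) = g0 a b"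

text \<open>The remainder condition for that factorization: the quadratic g2 z^2 + g1 z + g0 at the
  root of \<open>\<alpha> * z - \<delta>\<close>, homogenized. This eliminates \<gamma> and
  \<beta>.\<close>

definition Phi :: "complex \<Rightarrow> complex \<Rightarrow> complex \<Rightarrow> complex \<Rightarrow> complex" where
  "Phi a b \<alpha> \<delta> = g2 a b * \<delta>^2 + g1 a b * \<alpha> * \<delta> + g0 a b * \<alpha>^2"

lemma diagonal_product:
  "(\<kappa>1 * z^2 + a * z + \<theta>1) * (\<kappa>2 * z^2 + b * z + \<theta>2) - K z
    = z * (g2 a b * z^2 + g1 a b * z + g0 a b)"
  using rel unfolding K_def g0_def g1_def g2_def by algebra

lemma mem_XB_iff:
  "(A0, A1, A2) \<in> XB \<longleftrightarrow>
     A2 $ 1 $ 1 + A2 $ 2 $ 2 = \<kappa>1 + \<kappa>2 \<and> det A2 = \<kappa>1 * \<kappa>2 \<and>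
     A0 $ 1 $ 1 + A0 $ 2 $ 2 = \<theta>1 + \<theta>2 \<and> det A0 = \<theta>1 * \<theta>2 \<and>
     (\<forall>z. det (ev (A0, A1, A2) z) = K z)"
  using distinct unfolding Xbar_def K_def by (simp add: spectrum_eq_iff det_2 del: ev.simps)

lemma conj_by_mem_XB:
  assumes "invertible P" "A \<in> XB"
  shows "conj_by P A \<in> XB"
proof -
  obtain A0 A1 A2 B0 B1 B2 where AB: "A = (A0, A1, A2)" "conj_by P A = (B0, B1, B2)"
    by (cases A, cases "conj_by P A") auto
  then have e: "A0 ** P = P ** B0" "A1 ** P = P ** B1" "A2 ** P = P ** B2"
    using conj_by_eq_iff[OF assms(1)] by blast+
  have "det (ev (B0, B1, B2) z) = det (ev (A0, A1, A2) z)" for z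
    using mat2_similar(1)[OF assms(1) ev_conj_by[OF assms(1), of A z]] AB by simp
  then show ?thesis
    using assms(2) mat2_similar[OF assms(1) e(1)] mat2_similar[OF assms(1) e(3)]
    unfolding AB(2) unfolding AB(1) mem_XB_iff by simp
qed

text \<open>The triangular shape of the outer matrices builds in the spectra, and \<open>rel\<close>
  makes det A(z) - K(z) divisible by z; three coefficients remain to be compared.\<close>

lemma nf_mem_iff: "nf a b \<alpha> \<delta> \<gamma> \<beta> \<in> XB \<longleftrightarrow> nf_eqs a b \<alpha> \<delta> \<gamma> \<beta>"
proof -
  have det: "det (ev (nf a b \<alpha> \<delta> \<gamma> \<beta>) z) - K z
      = z * ((g2 a b - \<alpha> * \<gamma>) * z^2 + (g1 a b - (\<alpha> * \<beta> - \<delta> * \<gamma>)) * z + (g0 a b + \<delta> * \<beta>))" for z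
  proof -
    have "det (ev (nf a b \<alpha> \<delta> \<gamma> \<beta>) z) = (\<kappa>1 * z^2 + a * z + \<theta>1) * (\<kappa>2 * z^2 + b * z + \<theta>2)
        - (\<alpha> * z - \<delta>) * (z * (\<gamma> * z + \<beta>))"
      unfolding nf_def by (simp add: det_2) algebra
    then show ?thesis using diagonal_product[of z a b] by algebra
  qed
  have "nf a b \<alpha> \<delta> \<gamma> \<beta> \<in> XB \<longleftrightarrow> (\<forall>z. det (ev (nf a b \<alpha> \<delta> \<gamma> \<beta>) z) = K z)"
    unfolding nf_def mem_XB_iff by (simp add: det_2 del: ev.simps)
  also have "\<dots> \<longleftrightarrow> nf_eqs a b \<alpha> \<delta> \<gamma> \<beta>"
  proof
    assume *: "\<forall>z. det (ev (nf a b \<alpha> \<delta> \<gamma> \<beta>) z) = K z"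
    have "g0 a b + \<delta> * \<beta> = 0 \<and> g1 a b - (\<alpha> * \<beta> - \<delta> * \<gamma>) = 0 \<and> g2 a b - \<alpha> * \<gamma> = 0"
    proof (rule quadratic_coeffs_eq)
      fix z :: complex assume "z \<noteq> 0"
      then show "(g0 a b + \<delta> * \<beta>) + (g1 a b - (\<alpha> * \<beta> - \<delta> * \<gamma>)) * z + (g2 a b - \<alpha> * \<gamma>) * z\<^sup>2
          = 0 + 0 * z + 0 * z\<^sup>2"
        using * det[of z] \<open>z \<noteq> 0\<close> by (simp add: add.commute add.left_commute)
    qed
    then show "nf_eqs a b \<alpha> \<delta> \<gamma> \<beta>" unfolding nf_eqs_def neg_eq_iff_add_eq_0 by (simp add: add.commute)
  next
    assume "nf_eqs a b \<alpha> \<delta> \<gamma> \<beta>"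
    then have "g2 a b = \<alpha> * \<gamma>" "g1 a b = \<alpha> * \<beta> - \<delta> * \<gamma>" "g0 a b = - (\<delta> * \<beta>)"
      by (simp_all add: nf_eqs_def)
    with det show "\<forall>z. det (ev (nf a b \<alpha> \<delta> \<gamma> \<beta>) z) = K z" by simp
  qed
  finally show ?thesis .
qed

text \<open>The eigenvectors fix the first column of the constant term and the second column of the
  leading term; the traces then supply the other diagonal entries.\<close>

lemma conj_by_adapted:
  assumes "A \<in> XB" "adapted_basis \<kappa>2 \<theta>1 A u v"
  obtains a b \<alpha> \<delta> \<gamma> \<beta> where
    "conj_by (cols u v) A = nf a b \<alpha> \<delta> \<gamma> \<beta>" "nf_eqs a b \<alpha> \<delta> \<gamma> \<beta>"
proof -
  let ?P = "cols u v"
  obtain A0 A1 A2 B0 B1 B2 where AB: "A = (A0, A1, A2)" "conj_by ?P A = (B0, B1, B2)"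
    by (cases A, cases "conj_by ?P A") auto
  have uv: "A0 *v u = \<theta>1 *s u" "A2 *v v = \<kappa>2 *s v" and P: "invertible ?P"
    using assms(2) by (auto simp: AB(1) eigenspace_def)
  have d: "det2 u v \<noteq> 0" using P by (simp add: invertible_cols_iff)
  have e: "A0 ** ?P = ?P ** B0" "A2 ** ?P = ?P ** B2"
    using AB conj_by_eq_iff[OF P] by blast+
  have "det2 u v * (B0 $ 1 $ 1 - \<theta>1) = 0" "det2 u v * B0 $ 2 $ 1 = 0"
    "det2 u v * (B2 $ 2 $ 2 - \<kappa>2) = 0" "det2 u v * B2 $ 1 $ 2 = 0"
    using e uv
    by (simp_all add: mat2_eq_iff mat2_mult_nth mat2_vec_nth vec_eq_iff forall_2 det2_def) algebra+
  then have z: "B0 $ 1 $ 1 = \<theta>1" "B0 $ 2 $ 1 = 0" "B2 $ 2 $ 2 = \<kappa>2" "B2 $ 1 $ 2 = 0"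
    using d by simp_all
  have B: "(B0, B1, B2) \<in> XB" using conj_by_mem_XB[OF P assms(1)] AB(2) by simp
  then have "B0 $ 2 $ 2 = \<theta>2" "B2 $ 1 $ 1 = \<kappa>1" using z by (simp_all add: mem_XB_iff)
  with z have "(B0, B1, B2) = nf (B1 $ 1 $ 1) (B1 $ 2 $ 2) (B1 $ 1 $ 2) (- B0 $ 1 $ 2)
      (B2 $ 2 $ 1) (B1 $ 2 $ 1)"
    by (simp add: nf_def mat2_eq_iff)
  with B AB(2) show thesis using that nf_mem_iff by metis
qed

lemma adapted_of_conj_by:
  assumes "invertible (cols u v)" "conj_by (cols u v) A = nf a b \<alpha> \<delta> \<gamma> \<beta>"
  shows "adapted_basis \<kappa>2 \<theta>1 A u v"
proof -
  obtain A0 A1 A2 where A: "A = (A0, A1, A2)" by (cases A)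
  have "A0 ** cols u v = cols u v ** mk_mat2 \<theta>1 (- \<delta>) 0 \<theta>2"
    "A2 ** cols u v = cols u v ** mk_mat2 \<kappa>1 0 \<gamma> \<kappa>2"
    using assms(2) unfolding A nf_def conj_by_eq_iff[OF assms(1)] by auto
  then show ?thesis using assms(1)
    by (simp add: A eigenspace_def mat2_eq_iff mat2_mult_nth mat2_vec_nth vec_eq_iff forall_2
      mult.commute)
qed

text \<open>If the 12 entry vanished identically, the diagonal entries would multiply to K, so the
  two roots of the 11 entry would be two of the c's. Its constant term \<theta>1 is \<kappa>1 times
  their product, which \<open>irreducible\<close> forbids.\<close>

lemma nf_eqs_nontrivial:
  assumes "nf_eqs a b \<alpha> \<delta> \<gamma> \<beta>"
  shows "\<alpha> \<noteq> 0 \<or> \<delta> \<noteq> 0"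
proof (rule ccontr)
  assume "\<not> (\<alpha> \<noteq> 0 \<or> \<delta> \<noteq> 0)"
  then have g: "g2 a b = 0" "g1 a b = 0" "g0 a b = 0" using assms by (auto simp: nf_eqs_def)
  obtain r s where rs: "\<And>z. \<kappa>1 * z^2 + a * z + \<theta>1 = \<kappa>1 * (z - r) * (z - s)"
    using split_quadratic[OF nz(1)] by blast
  obtain r' s' where rs': "\<And>z. \<kappa>2 * z^2 + b * z + \<theta>2 = \<kappa>2 * (z - r') * (z - s')"
    using split_quadratic[OF nz(2)] by blast
  have "r * s \<in> {c1*c2, c1*c3, c1*c4, c2*c3, c2*c4, c3*c4}"
  proof (rule product_of_two_roots)
    fix z
    have "(\<kappa>1 * (z - r) * (z - s)) * (\<kappa>2 * (z - r') * (z - s')) = K z"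
      using diagonal_product[of z a b] unfolding g rs rs' by simp
    then have "(\<kappa>1 * \<kappa>2) * ((z - r) * (z - s) * (z - r') * (z - s'))
        = (\<kappa>1 * \<kappa>2) * ((z - c1) * (z - c2) * (z - c3) * (z - c4))"
      unfolding K_def by (simp only: ac_simps)
    then show "(z - r) * (z - s) * (z - r') * (z - s') = (z - c1) * (z - c2) * (z - c3) * (z - c4)"
      using nz by simp
  qed
  then have "\<theta>1 \<noteq> \<kappa>1 * (r * s)" using irreducible by blast
  moreover have "\<theta>1 = \<kappa>1 * (r * s)" using rs[of 0] by simp
  ultimately show False by simp
qed

text \<open>A nonzero polynomial \<open>\<alpha> * z - \<delta>\<close> can be cancelled from the
  factorization expressed by \<open>nf_eqs\<close>.\<close>

lemma nf_eqs_unique: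
  assumes "nf_eqs a b \<alpha> \<delta> \<gamma> \<beta>" "nf_eqs a b \<alpha> \<delta> \<gamma>' \<beta>'"
  shows "\<gamma> = \<gamma>' \<and> \<beta> = \<beta>'"
proof -
  have "\<alpha> * \<gamma> = \<alpha> * \<gamma>'" "\<alpha> * \<beta> - \<delta> * \<gamma> = \<alpha> * \<beta>' - \<delta> * \<gamma>'" "\<delta> * \<beta> = \<delta> * \<beta>'"
    using assms unfolding nf_eqs_def by (metis neg_equal_iff_equal)+
  then have e: "\<alpha> * (\<gamma> - \<gamma>') = 0" "\<alpha> * (\<beta> - \<beta>') = \<delta> * (\<gamma> - \<gamma>')" "\<delta> * (\<beta> - \<beta>') = 0"
    by (simp_all add: algebra_simps)
  show ?thesis using nf_eqs_nontrivial[OF assms(1)] e by auto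
qed

lemma nf_eqs_Phi:
  assumes "nf_eqs a b \<alpha> \<delta> \<gamma> \<beta>"
  shows "Phi a b \<alpha> \<delta> = 0"
proof -
  have "g2 a b = \<alpha> * \<gamma>" "g1 a b = \<alpha> * \<beta> - \<delta> * \<gamma>" "g0 a b = - (\<delta> * \<beta>)"
    using assms by (simp_all add: nf_eqs_def)
  then show ?thesis unfolding Phi_def by algebra
qed

text \<open>Long division by \<open>\<alpha> * z - \<delta>\<close> starting from the top
  coefficient; \<open>Phi\<close> is the obstruction to its ending without remainder.\<close>

lemma nf_eqsI_alpha:
  assumes "Phi a b \<alpha> \<delta> = 0" "\<alpha> \<noteq> 0"
  shows "nf_eqs a b \<alpha> \<delta> (g2 a b / \<alpha>) ((g1 a b + \<delta> * (g2 a b / \<alpha>)) / \<alpha>)"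
proof -
  have "\<alpha>^2 * (\<delta> * ((g1 a b + \<delta> * (g2 a b / \<alpha>)) / \<alpha>)) + \<alpha>^2 * g0 a b = Phi a b \<alpha> \<delta>"
    using assms(2) unfolding Phi_def by (simp add: field_simps power2_eq_square)
  then have "\<alpha>^2 * (\<delta> * ((g1 a b + \<delta> * (g2 a b / \<alpha>)) / \<alpha>) + g0 a b) = 0"
    using assms(1) by (simp add: distrib_left)
  then show ?thesis
    using assms(2) unfolding nf_eqs_def by (simp add: neg_eq_iff_add_eq_0)
qed

text \<open>The same division started from the constant term; this version includes \<alpha> =
  0.\<close>

lemma nf_eqsI_delta:
  assumes "Phi a b \<alpha> \<delta> = 0" "\<delta> \<noteq> 0"
  shows "nf_eqs a b \<alpha> \<delta> ((\<alpha> * (- g0 a b / \<delta>) - g1 a b) / \<delta>) (- g0 a b / \<delta>)"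
proof -
  have "\<delta>^2 * (\<alpha> * ((\<alpha> * (- g0 a b / \<delta>) - g1 a b) / \<delta>)) - \<delta>^2 * g2 a b = - Phi a b \<alpha> \<delta>"
    using assms(2) unfolding Phi_def by (simp add: field_simps power2_eq_square)
  then have "\<delta>^2 * (\<alpha> * ((\<alpha> * (- g0 a b / \<delta>) - g1 a b) / \<delta>) - g2 a b) = 0"
    using assms(1) by (simp add: right_diff_distrib)
  then show ?thesis using assms(2) unfolding nf_eqs_def by simp
qed

text \<open>Both normal forms have the same \<theta>1-eigenline and the same \<kappa>2-eigenline,
  namely the coordinate lines. Hence \<open>R\<close> is diagonal, and r is the ratio of its
  entries.\<close>

lemma nf_conj_by:
  assumes R: "invertible R" and e: "conj_by R (nf a b \<alpha> \<delta> \<gamma> \<beta>) = nf a' b' \<alpha>' \<delta>' \<gamma>' \<beta>'"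
  obtains r where "r \<noteq> 0" "\<alpha>' = r * \<alpha>" "\<delta>' = r * \<delta>" "a' = a" "b' = b"
proof -
  have E: "mk_mat2 \<theta>1 (- \<delta>) 0 \<theta>2 ** R = R ** mk_mat2 \<theta>1 (- \<delta>') 0 \<theta>2"
    "mk_mat2 a \<alpha> \<beta> b ** R = R ** mk_mat2 a' \<alpha>' \<beta>' b'"
    "mk_mat2 \<kappa>1 0 \<gamma> \<kappa>2 ** R = R ** mk_mat2 \<kappa>1 0 \<gamma>' \<kappa>2"
    using e unfolding nf_def conj_by_eq_iff[OF R] by auto
  have "R $ 2 $ 1 * (\<theta>1 - \<theta>2) = 0" "R $ 1 $ 2 * (\<kappa>1 - \<kappa>2) = 0"
    using E unfolding mat2_eq_iff mat2_mult_nth mk_mat2_nth by algebra+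
  then have z: "R $ 2 $ 1 = 0" "R $ 1 $ 2 = 0" using distinct by auto
  then have n: "R $ 1 $ 1 \<noteq> 0" "R $ 2 $ 2 \<noteq> 0" using R by (auto simp: invertible_mat2_iff)
  show thesis
  proof (rule that[of "R $ 2 $ 2 / R $ 1 $ 1"])
  qed (use E z n in \<open>simp_all add: mat2_eq_iff mat2_mult_nth field_simps\<close>)
qed

lemma nf_rescale:
  assumes "r \<noteq> 0"
  shows "conj_by (mk_mat2 1 0 0 r) (nf a b \<alpha> \<delta> \<gamma> \<beta>) = nf a b (r * \<alpha>) (r * \<delta>) (\<gamma> / r) (\<beta> / r)"
proof -
  have "invertible (mk_mat2 1 0 0 r)" using assms by (simp add: invertible_mat2_iff)
  then show ?thesis using assms unfolding nf_def
    by (subst conj_by_eq_iff) (simp_all add: mat2_eq_iff mat2_mult_nth)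
qed

end


section \<open>The chart (y, \<xi>) and the topology of its image\<close>

section \<open>Coordinates\<close>

text \<open>Cramer's rule: pairings with the basis vectors give the entries in that basis without
  inverting it, so their dependence on matrix and basis stays polynomial.\<close>

lemma det2_nth_cols:
  assumes "invertible (cols u v)" "conj_by (cols u v) (A0, A1, A2) = (B0, B1, B2)"
  shows "det2 (A0 *v v) v = B0 $ 1 $ 2 * det2 u v" "det2 (A1 *v v) v = B1 $ 1 $ 2 * det2 u v"
    "det2 (A1 *v u) v = B1 $ 1 $ 1 * det2 u v" "det2 u (A1 *v v) = B1 $ 2 $ 2 * det2 u v"
proof -
  have "A0 ** cols u v = cols u v ** B0" "A1 ** cols u v = cols u v ** B1"
    using assms(2) unfolding conj_by_eq_iff[OF assms(1)] by auto
  then have e: "(A0 *v v) $ 1 = u $ 1 * B0 $ 1 $ 2 + v $ 1 * B0 $ 2 $ 2"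
    "(A0 *v v) $ 2 = u $ 2 * B0 $ 1 $ 2 + v $ 2 * B0 $ 2 $ 2"
    "(A1 *v v) $ 1 = u $ 1 * B1 $ 1 $ 2 + v $ 1 * B1 $ 2 $ 2"
    "(A1 *v v) $ 2 = u $ 2 * B1 $ 1 $ 2 + v $ 2 * B1 $ 2 $ 2"
    "(A1 *v u) $ 1 = u $ 1 * B1 $ 1 $ 1 + v $ 1 * B1 $ 2 $ 1"
    "(A1 *v u) $ 2 = u $ 2 * B1 $ 1 $ 1 + v $ 2 * B1 $ 2 $ 1"
    by (simp_all add: mat2_eq_iff mat2_mult_nth mat2_vec_nth)
  show "det2 (A0 *v v) v = B0 $ 1 $ 2 * det2 u v" "det2 (A1 *v v) v = B1 $ 1 $ 2 * det2 u v"
    "det2 (A1 *v u) v = B1 $ 1 $ 1 * det2 u v" "det2 u (A1 *v v) = B1 $ 2 $ 2 * det2 u v"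
    unfolding det2_def e by algebra+
qed

text \<open>Cayley-Hamilton: (M - k)(M - l) = 0, so M - l sends every vector into the k-eigenspace.
  Applied to a fixed \<open>e\<close>, this yields eigenvectors depending continuously on M.\<close>

lemma mat2_eigenvector:
  fixes M :: mat2
  assumes "M $ 1 $ 1 + M $ 2 $ 2 = k + l" "M $ 1 $ 1 * M $ 2 $ 2 - M $ 1 $ 2 * M $ 2 $ 1 = k * l"
  shows "M *v (M *v e - l *s e) = k *s (M *v e - l *s e)"
proof -
  have "(M *v (M *v e - l *s e)) $ 1 = (k *s (M *v e - l *s e)) $ 1"
    unfolding mat2_vec_nth vector_minus_component vector_smult_component using assms by algebra
  moreover have "(M *v (M *v e - l *s e)) $ 2 = (k *s (M *v e - l *s e)) $ 2"
    unfolding mat2_vec_nth vector_minus_component vector_smult_component using assms by algebra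
  ultimately show ?thesis by (simp add: vec_eq_iff forall_2)
qed

text \<open>The scaling of the fixed vector for which this construction returns a given eigenvector
  \<open>u\<close> at the base point.\<close>

lemma mat2_eigenvector_fixed:
  fixes M :: mat2
  assumes "M *v u = k *s u" "k \<noteq> l"
  shows "M *v ((1 / (k - l)) *s u) - l *s ((1 / (k - l)) *s u) = u"
proof -
  have "M *v ((1 / (k - l)) *s u) = (1 / (k - l)) *s (M *v u)"
    by (simp add: vec_eq_iff mat2_vec_nth distrib_left mult.left_commute)
  also have "\<dots> - l *s ((1 / (k - l)) *s u) = u"
    using assms(2) unfolding assms(1) by (simp add: vec_eq_iff divide_simps) (simp add: algebra_simps)
  finally show ?thesis .
qed

context space_params
begin

definition a_of :: "complex \<Rightarrow> complex \<Rightarrow> complex" where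
  "a_of y \<xi> = ((y - c1) * (y - c2) / \<xi> - \<kappa>1 * y^2 - \<theta>1) / y"

text \<open>At y the 12 entry vanishes, so the 22 entry there is K(y) divided by the 11 entry (y -
  c1)(y - c2) / \<xi>.\<close>

definition b_of :: "complex \<Rightarrow> complex \<Rightarrow> complex" where
  "b_of y \<xi> = (\<kappa>1 * \<kappa>2 * \<xi> * (y - c3) * (y - c4) - \<kappa>2 * y^2 - \<theta>2) / y"

definition nfp :: "complex \<times> complex \<Rightarrow> quad" where
  "nfp = (\<lambda>(y, \<xi>). let a = a_of y \<xi>; b = b_of y \<xi> in nf a b 1 y (g2 a b) (g1 a b + y * g2 a b))"

definition cls :: "complex \<times> complex \<Rightarrow> quad set" where
  "cls p = conj_rel XB `` {nfp p}"

text \<open>With y different from c1 and c2, a nonzero \<xi> and a nonzero 11 entry at y determine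
  each other; y \<noteq> 0 allows solving for \<open>a\<close> and \<open>b\<close>.\<close>

definition regular_points :: "(complex \<times> complex) set" where
  "regular_points = {(y, \<xi>). y \<noteq> 0 \<and> \<xi> \<noteq> 0 \<and> y \<noteq> c1 \<and> y \<noteq> c2}"

lemma a_of_eq: "y \<noteq> 0 \<Longrightarrow> \<kappa>1 * y^2 + a_of y \<xi> * y + \<theta>1 = (y - c1) * (y - c2) / \<xi>"
  by (simp add: a_of_def)

lemma b_of_eq: "y \<noteq> 0 \<Longrightarrow> \<kappa>2 * y^2 + b_of y \<xi> * y + \<theta>2 = \<kappa>1 * \<kappa>2 * \<xi> * (y - c3) * (y - c4)"
  by (simp add: b_of_def)

lemma Phi_root:
  "y * Phi a b \<alpha> (\<alpha> * y)
    = \<alpha>^2 * ((\<kappa>1 * y^2 + a * y + \<theta>1) * (\<kappa>2 * y^2 + b * y + \<theta>2) - K y)"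
  unfolding diagonal_product Phi_def by algebra

lemma nf_eqs_nfp:
  assumes "y \<noteq> 0" "\<xi> \<noteq> 0"
  shows "nf_eqs (a_of y \<xi>) (b_of y \<xi>) 1 y (g2 (a_of y \<xi>) (b_of y \<xi>))
    (g1 (a_of y \<xi>) (b_of y \<xi>) + y * g2 (a_of y \<xi>) (b_of y \<xi>))"
proof -
  have "(\<kappa>1 * y^2 + a_of y \<xi> * y + \<theta>1) * (\<kappa>2 * y^2 + b_of y \<xi> * y + \<theta>2) = K y"
    unfolding a_of_eq[OF assms(1)] b_of_eq[OF assms(1)] K_def using assms(2) by simp
  then have "y * Phi (a_of y \<xi>) (b_of y \<xi>) 1 y = 0"
    using Phi_root[of y "a_of y \<xi>" "b_of y \<xi>" 1] by simp
  then have "Phi (a_of y \<xi>) (b_of y \<xi>) 1 y = 0" using assms(1) by simp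
  then show ?thesis using nf_eqsI_alpha by fastforce
qed

lemma nfp_mem:
  assumes "p \<in> regular_points"
  shows "nfp p \<in> XB"
  using assms nf_eqs_nfp by (auto simp: regular_points_def nfp_def Let_def nf_mem_iff)

lemma cls_subset: "cls p \<subseteq> XB"
  by (auto simp: cls_def conj_rel_def)

lemma cls_eq:
  assumes "A \<in> cls p"
  shows "conj_rel XB `` {A} = cls p"
  using assms equiv_class_eq[OF equiv_conj_rel, of "nfp p" A XB] by (simp add: cls_def)

lemma cls_in_X:
  assumes "p \<in> regular_points"
  shows "cls p \<in> X \<kappa>1 \<kappa>2 \<theta>1 \<theta>2 c1 c2 c3 c4"
  unfolding X_def cls_def by (rule quotientI) (rule nfp_mem[OF assms])

text \<open>A test for a class by any one normal form of \<open>A\<close>. Conversely to the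
  invariance under rescaling, \<xi> determines a, the determinant equation at y then determines b,
  and \<open>nf_eqs_unique\<close> determines the 21 entry.\<close>

lemma mem_cls_iff:
  assumes p: "(y, \<xi>) \<in> regular_points" and A: "A \<in> XB"
    and P: "invertible P" and nf: "conj_by P A = nf a b \<alpha> \<delta> \<gamma> \<beta>"
  shows "A \<in> cls (y, \<xi>) \<longleftrightarrow>
    \<alpha> \<noteq> 0 \<and> \<delta> = \<alpha> * y \<and> (\<kappa>1 * y^2 + a * y + \<theta>1) * \<xi> = (y - c1) * (y - c2)"
proof
  have n: "y \<noteq> 0" "\<xi> \<noteq> 0" "y \<noteq> c1" "y \<noteq> c2" using p by (auto simp: regular_points_def)
  assume "A \<in> cls (y, \<xi>)"
  then obtain Q where Q: "invertible Q" "A = conj_by Q (nfp (y, \<xi>))"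
    by (auto simp: cls_def conj_rel_def)
  then have "conj_by (Q ** P) (nfp (y, \<xi>)) = nf a b \<alpha> \<delta> \<gamma> \<beta>"
    using nf conj_by_mult[OF Q(1) P] by metis
  then obtain r where "r \<noteq> 0" "\<alpha> = r * 1" "\<delta> = r * y" "a = a_of y \<xi>"
    using nf_conj_by[OF invertible_mult[OF Q(1) P]] unfolding nfp_def Let_def prod.case by metis
  then show "\<alpha> \<noteq> 0 \<and> \<delta> = \<alpha> * y \<and> (\<kappa>1 * y^2 + a * y + \<theta>1) * \<xi> = (y - c1) * (y - c2)"
    using a_of_eq[OF n(1), of \<xi>] n by simp
next
  have n: "y \<noteq> 0" "\<xi> \<noteq> 0" "y \<noteq> c1" "y \<noteq> c2" using p by (auto simp: regular_points_def)
  assume h: "\<alpha> \<noteq> 0 \<and> \<delta> = \<alpha> * y \<and> (\<kappa>1 * y^2 + a * y + \<theta>1) * \<xi> = (y - c1) * (y - c2)"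
  then have w: "\<kappa>1 * y^2 + a * y + \<theta>1 = (y - c1) * (y - c2) / \<xi>"
    using n by (simp add: field_simps)
  then have a: "a = a_of y \<xi>" using n(1) by (simp add: a_of_def field_simps)
  \<comment> \<open>Rescaling the second basis vector makes the 12 entry monic.\<close>
  let ?D = "mk_mat2 1 0 0 (1 / \<alpha>)"
  have D: "invertible ?D" using h by (simp add: invertible_mat2_iff)
  have PD: "invertible (P ** ?D)" by (rule invertible_mult[OF P D])
  have e: "conj_by (P ** ?D) A = nf a b 1 y (\<gamma> * \<alpha>) (\<beta> * \<alpha>)"
    using nf_rescale[of "1 / \<alpha>" a b \<alpha> \<delta> \<gamma> \<beta>] h unfolding conj_by_mult[OF P D, symmetric] nf by simp
  then have eqs: "nf_eqs a b 1 y (\<gamma> * \<alpha>) (\<beta> * \<alpha>)"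
    using conj_by_mem_XB[OF PD A] nf_mem_iff by metis
  have "(\<kappa>1 * y^2 + a * y + \<theta>1) * (\<kappa>2 * y^2 + b * y + \<theta>2) = K y"
    (is "?L * ?M = _")
    using Phi_root[of y a b 1] nf_eqs_Phi[OF eqs] by simp
  \<comment> \<open>Multiplying the determinant equation by \<xi> replaces the 11 entry by (y -
    c1)(y - c2), a nonzero factor that K contains too.\<close>
  then have "((y - c1) * (y - c2)) * ?M = ((y - c1) * (y - c2)) * (\<kappa>1 * \<kappa>2 * \<xi> * (y - c3) * (y - c4))"
    using h unfolding K_def by algebra
  then have "?M = \<kappa>1 * \<kappa>2 * \<xi> * (y - c3) * (y - c4)"
    using n by simp
  then have b: "b = b_of y \<xi>" using n(1) by (simp add: b_of_def field_simps)
  have "conj_by (P ** ?D) A = nfp (y, \<xi>)"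
    using e nf_eqs_unique[OF eqs nf_eqs_nfp[OF n(1,2), folded a b]]
    by (simp add: nfp_def Let_def a b)
  then have "(A, nfp (y, \<xi>)) \<in> conj_rel XB"
    using A PD nfp_mem[OF p] by (auto simp: conj_rel_def intro!: exI[of _ "P ** ?D"])
  then show "A \<in> cls (y, \<xi>)"
    using equiv_conj_rel[of XB] by (auto simp: cls_def equiv_def dest: symD)
qed

lemma ev_nf: "ev (nf a b \<alpha> \<delta> \<gamma> \<beta>) z =
    mk_mat2 (\<kappa>1 * z^2 + a * z + \<theta>1) (\<alpha> * z - \<delta>) (z * (\<gamma> * z + \<beta>)) (\<kappa>2 * z^2 + b * z + \<theta>2)"
  by (simp add: nf_def mat2_eq_iff algebra_simps power2_eq_square)

lemma has_coords_cls_iff: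
  assumes "p \<in> regular_points"
  shows "has_coords \<kappa>1 \<kappa>2 \<theta>1 \<theta>2 c1 c2 (cls p) p' \<longleftrightarrow> p' = p"
proof
  obtain y \<xi> where p: "p = (y, \<xi>)" by (cases p)
  have n: "y \<noteq> 0" "\<xi> \<noteq> 0" "y \<noteq> c1" "y \<noteq> c2" using assms by (auto simp: regular_points_def p)
  assume "has_coords \<kappa>1 \<kappa>2 \<theta>1 \<theta>2 c1 c2 (cls p) p'"
  then obtain A u v a b \<gamma> \<beta> y' where h: "A \<in> cls p" "adapted_basis \<kappa>2 \<theta>1 A u v"
      "\<And>z. ev (conj_by (cols u v) A) z = mk_mat2 (\<kappa>1 * z^2 + a * z + \<theta>1) (z - y')
                   (z * (\<gamma> * z + \<beta>)) (\<kappa>2 * z^2 + b * z + \<theta>2)"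
      "\<kappa>1 * y'^2 + a * y' + \<theta>1 \<noteq> 0"
      "p' = (y', (y' - c1) * (y' - c2) / (\<kappa>1 * y'^2 + a * y' + \<theta>1))"
    unfolding has_coords_def by blast
  have "conj_by (cols u v) A = nf a b 1 y' \<gamma> \<beta>"
    by (rule ev_inject) (simp only: h(3) ev_nf mult_1)
  moreover have "invertible (cols u v)" using h(2) by (cases A) simp
  moreover have "A \<in> XB" using h(1) cls_subset by blast
  ultimately have "y' = y" "(\<kappa>1 * y^2 + a * y + \<theta>1) * \<xi> = (y - c1) * (y - c2)"
    using mem_cls_iff[of y \<xi> A "cols u v" a b 1 y' \<gamma> \<beta>] h(1) assms unfolding p by auto
  then show "p' = p" using h(4,5) n unfolding p by (simp add: field_simps)
next
  obtain y \<xi> where p: "p = (y, \<xi>)" by (cases p)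
  have n: "y \<noteq> 0" "\<xi> \<noteq> 0" "y \<noteq> c1" "y \<noteq> c2" using assms by (auto simp: regular_points_def p)
  assume p': "p' = p"
  have c: "cols (vec2 1 0) (vec2 0 1) = mat 1" by (simp add: mat2_eq_iff mat_def)
  let ?a = "a_of y \<xi>" and ?b = "b_of y \<xi>"
  have e: "conj_by (cols (vec2 1 0) (vec2 0 1)) (nfp p)
      = nf ?a ?b 1 y (g2 ?a ?b) (g1 ?a ?b + y * g2 ?a ?b)"
    by (simp add: c p nfp_def Let_def)
  have "adapted_basis \<kappa>2 \<theta>1 (nfp p) (vec2 1 0) (vec2 0 1)"
    by (rule adapted_of_conj_by[OF _ e]) (simp only: c invertible_mat_1)
  moreover have "nfp p \<in> cls p"
    using nfp_mem[OF assms] equiv_class_self[OF equiv_conj_rel] by (auto simp: cls_def)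
  moreover have "\<xi> = (y - c1) * (y - c2) / (\<kappa>1 * y^2 + ?a * y + \<theta>1)"
    "\<kappa>1 * y^2 + ?a * y + \<theta>1 \<noteq> 0"
    using n unfolding a_of_eq[OF n(1)] by simp_all
  ultimately show "has_coords \<kappa>1 \<kappa>2 \<theta>1 \<theta>2 c1 c2 (cls p) p'"
    unfolding has_coords_def p' e[symmetric]
    by (intro bexI[of _ "nfp p"] exI[of _ "vec2 1 0"] exI[of _ "vec2 0 1"] exI[of _ ?a] exI[of _ ?b]
      exI[of _ "g2 ?a ?b"] exI[of _ "g1 ?a ?b + y * g2 ?a ?b"] exI[of _ y])
      (unfold e ev_nf, simp_all add: p)
qed

lemma coords_cls: "p \<in> regular_points \<Longrightarrow> coords \<kappa>1 \<kappa>2 \<theta>1 \<theta>2 c1 c2 (cls p) = p"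
  unfolding coords_def by (rule the_equality) (simp_all only: has_coords_cls_iff)

lemma cls_coord_dom: "p \<in> regular_points \<Longrightarrow> cls p \<in> coord_dom \<kappa>1 \<kappa>2 \<theta>1 \<theta>2 c1 c2 c3 c4"
  unfolding coord_dom_def mem_Collect_eq
  by (intro conjI cls_in_X ex1I[of _ p]) (simp_all only: has_coords_cls_iff)

lemma bij_betw_coords:
  assumes "U \<subseteq> regular_points"
  shows "bij_betw (coords \<kappa>1 \<kappa>2 \<theta>1 \<theta>2 c1 c2) (cls ` U) U"
  by (rule bij_betw_byWitness[where f' = cls]) (use assms coords_cls in \<open>auto simp: subset_iff\<close>)

text \<open>An adapted basis of \<open>A\<close> extends continuously to nearby elements, hence so
  do y and \<xi>. These stay in the open set \<open>U\<close>, and \<open>mem_cls_iff\<close> puts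
  every nearby element into the class of its own pair.\<close>

lemma openin_Union_cls:
  assumes U: "U \<subseteq> regular_points" "open U"
  shows "openin (top_of_set XB) (\<Union>(cls ` U))"
proof (subst openin_subopen, safe)
  fix A y \<xi> assume yx: "(y, \<xi>) \<in> U" and A: "A \<in> cls (y, \<xi>)"
  have reg: "(y, \<xi>) \<in> regular_points" using U yx by blast
  have n: "y \<noteq> 0" "\<xi> \<noteq> 0" "y \<noteq> c1" "y \<noteq> c2" using reg by (auto simp: regular_points_def)
  have AX: "A \<in> XB" using A cls_subset by blast
  obtain Q where Q: "invertible Q" "A = conj_by Q (nfp (y, \<xi>))"
    using A by (auto simp: cls_def conj_rel_def)
  define u where "u = vec2 (matrix_inv Q $ 1 $ 1) (matrix_inv Q $ 2 $ 1)"
  define v where "v = vec2 (matrix_inv Q $ 1 $ 2) (matrix_inv Q $ 2 $ 2)"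
  have uv: "cols u v = matrix_inv Q" by (simp add: mat2_eq_iff u_def v_def)
  have inv: "invertible (cols u v)" unfolding uv by (rule invertible_matrix_inv[OF Q(1)])
  let ?a = "a_of y \<xi>" and ?b = "b_of y \<xi>"
  have nfA: "conj_by (cols u v) A = nf ?a ?b 1 y (g2 ?a ?b) (g1 ?a ?b + y * g2 ?a ?b)"
    using conj_by_inverse(1)[OF Q(1)] unfolding uv Q(2) by (simp add: nfp_def Let_def)
  have ad: "adapted_basis \<kappa>2 \<theta>1 A u v" by (rule adapted_of_conj_by[OF inv nfA])
  \<comment> \<open>The fixed vectors to which A0 - \<theta>2 and A2 - \<kappa>1 are applied; at
    \<open>A\<close> itself they give back \<open>u\<close> and \<open>v\<close>.\<close>
  define e where "e = (1 / (\<theta>1 - \<theta>2)) *s u"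
  define f where "f = (1 / (\<kappa>2 - \<kappa>1)) *s v"
  define u' where "u' B = fst B *v e - \<theta>2 *s e" for B :: quad
  define v' where "v' B = snd (snd B) *v f - \<kappa>1 *s f" for B :: quad
  define d where "d B = det2 (u' B) (v' B)" for B
  \<comment> \<open>By \<open>det2_nth_cols\<close>, \<open>al\<close>, \<open>de\<close> and
    \<open>aa\<close> are \<alpha>, \<delta> and a of the moving normal form, each multiplied by the
    determinant \<open>d\<close> of the moving basis.\<close>
  define al where "al B = det2 (fst (snd B) *v v' B) (v' B)" for B
  define de where "de B = - det2 (fst B *v v' B) (v' B)" for B
  define aa where "aa B = det2 (fst (snd B) *v u' B) (v' B)" for B
  define w where "w B = \<kappa>1 * (de B / al B)^2 + aa B / d B * (de B / al B) + \<theta>1" for B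
  define xi where "xi B = (de B / al B - c1) * (de B / al B - c2) / w B" for B
  obtain A0 A1 A2 where A3: "A = (A0, A1, A2)" by (cases A)
  have "A0 *v u = \<theta>1 *s u" "A2 *v v = \<kappa>2 *s v" using ad by (auto simp: A3 eigenspace_def)
  then have uA: "u' A = u" and vA: "v' A = v"
    unfolding u'_def v'_def e_def f_def A3 fst_conv snd_conv
    using mat2_eigenvector_fixed distinct by metis+
  note dets = det2_nth_cols[OF inv nfA[unfolded A3 nf_def], folded A3]
  have dA: "d A \<noteq> 0" using inv by (simp add: d_def uA vA invertible_cols_iff)
  have alA: "al A = d A" "de A = y * d A" "aa A = ?a * d A"
    using dets unfolding al_def de_def aa_def d_def uA vA by (simp_all add: A3)
  have wA: "w A = (y - c1) * (y - c2) / \<xi>" "de A / al A = y"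
    using dA a_of_eq[OF n(1), of \<xi>] by (simp_all add: w_def alA)
  have xA: "xi A = \<xi>" "w A \<noteq> 0" unfolding xi_def wA using n by simp_all
  have id: "((\<lambda>x. x) \<longlongrightarrow> A) (nhds A)" by (rule filterlim_ident)
  have tu: "((\<lambda>B. u' B $ i) \<longlongrightarrow> u' A $ i) (nhds A)"
   and tv: "((\<lambda>B. v' B $ i) \<longlongrightarrow> v' A $ i) (nhds A)" for i
    unfolding u'_def v'_def
    by (simp_all only: mat2_vec_nth vector_minus_component vector_smult_component)
      (intro tendsto_intros id)+
  have t: "(d \<longlongrightarrow> d A) (nhds A)" "(al \<longlongrightarrow> al A) (nhds A)" "(de \<longlongrightarrow> de A) (nhds A)"
      "(aa \<longlongrightarrow> aa A) (nhds A)"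
    unfolding d_def al_def de_def aa_def det2_def mat2_vec_nth
    by (intro tendsto_intros id tu tv)+
  have al0: "al A \<noteq> 0" using alA dA by simp
  have tw: "(w \<longlongrightarrow> w A) (nhds A)"
    unfolding w_def by (intro tendsto_intros t dA al0)
  have tx: "((\<lambda>B. (de B / al B, xi B)) \<longlongrightarrow> (de A / al A, xi A)) (nhds A)"
    unfolding xi_def by (intro tendsto_intros t tw al0 xA)
  have "eventually (\<lambda>B. d B \<noteq> 0 \<and> al B \<noteq> 0 \<and> w B \<noteq> 0 \<and> (de B / al B, xi B) \<in> U) (nhds A)"
    using tendsto_imp_eventually_ne[OF t(1) dA] tendsto_imp_eventually_ne[OF t(2) al0]
      tendsto_imp_eventually_ne[OF tw xA(2)] topological_tendstoD[OF tx U(2)] yx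
    unfolding wA xA by (auto elim: eventually_elim2 intro!: eventually_conj)
  then obtain O' where O': "open O'" "A \<in> O'"
      "\<And>B. B \<in> O' \<Longrightarrow> d B \<noteq> 0 \<and> al B \<noteq> 0 \<and> w B \<noteq> 0 \<and> (de B / al B, xi B) \<in> U"
    unfolding eventually_nhds by blast
  have "XB \<inter> O' \<subseteq> \<Union>(cls ` U)"
  proof
    fix B assume B: "B \<in> XB \<inter> O'"
    obtain B0 B1 B2 where B3: "B = (B0, B1, B2)" by (cases B)
    have o: "d B \<noteq> 0" "al B \<noteq> 0" "w B \<noteq> 0" "(de B / al B, xi B) \<in> U" using O'(3) B by auto
    have BX: "B \<in> XB" using B by blast
    have m: "B2 $ 1 $ 1 + B2 $ 2 $ 2 = \<kappa>1 + \<kappa>2" "B2 $ 1 $ 1 * B2 $ 2 $ 2 - B2 $ 1 $ 2 * B2 $ 2 $ 1 = \<kappa>1 * \<kappa>2"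
      "B0 $ 1 $ 1 + B0 $ 2 $ 2 = \<theta>1 + \<theta>2" "B0 $ 1 $ 1 * B0 $ 2 $ 2 - B0 $ 1 $ 2 * B0 $ 2 $ 1 = \<theta>1 * \<theta>2"
      using BX unfolding B3 mem_XB_iff det_2 by blast+
    have "B0 *v u' B = \<theta>1 *s u' B" "B2 *v v' B = \<kappa>2 *s v' B"
      unfolding u'_def v'_def B3 fst_conv snd_conv
      by (rule mat2_eigenvector[OF m(3,4)])
        (rule mat2_eigenvector[OF m(1)[unfolded add.commute[of \<kappa>1]] m(2)[unfolded mult.commute[of \<kappa>1]]])
    moreover have iB: "invertible (cols (u' B) (v' B))"
      using o(1) by (simp add: invertible_cols_iff d_def)
    ultimately have "adapted_basis \<kappa>2 \<theta>1 B (u' B) (v' B)" by (simp add: B3 eigenspace_def)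
    then obtain a b \<alpha> \<delta> \<gamma> \<beta> where nfB: "conj_by (cols (u' B) (v' B)) B = nf a b \<alpha> \<delta> \<gamma> \<beta>"
      using conj_by_adapted[OF BX] by metis
    note dets = det2_nth_cols[OF iB[unfolded B3] nfB[unfolded B3 nf_def], folded B3]
    have "al B = \<alpha> * d B" "de B = \<delta> * d B" "aa B = a * d B"
      using dets by (simp_all add: al_def de_def aa_def d_def B3)
    then have y: "\<alpha> \<noteq> 0" "de B / al B = \<delta> / \<alpha>" "aa B / d B = a" using o by auto
    have "B \<in> cls (de B / al B, xi B)"
      by (subst mem_cls_iff[OF _ BX iB nfB]) (use o U y in \<open>auto simp: xi_def w_def\<close>)
    then show "B \<in> \<Union>(cls ` U)" using o(4) by blast
  qed
  then show "\<exists>T. openin (top_of_set XB) T \<and> A \<in> T \<and> T \<subseteq> \<Union>(cls ` U)"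
    using AX O'(1,2) by (intro exI[of _ "XB \<inter> O'"]) (auto simp: openin_open_Int)
qed

text \<open>Density passes to the quotient because an open set of classes has a relatively open
  union: a representative found in that union brings its whole class along, classes being
  disjoint.\<close>

lemma dense_open_cls:
  assumes U: "U \<subseteq> regular_points" "open U" and dense: "XB \<subseteq> closure (\<Union>(cls ` U))"
  shows "dense_open_in_X \<kappa>1 \<kappa>2 \<theta>1 \<theta>2 c1 c2 c3 c4 (cls ` U)"
proof -
  let ?r = "conj_rel XB"
  let ?\<tau> = "quot_topology XB ?r"
  note op = openin_quot_topology[OF equiv_conj_rel[of XB]]
  have W: "cls ` U \<subseteq> XB // ?r" using U cls_in_X by (auto simp: X_def)
  then have 1: "openin ?\<tau> (cls ` U)" using openin_Union_cls[OF U] by (simp add: op)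
  have "openin ?\<tau> (XB // ?r)" by (simp add: op Union_quotient[OF equiv_conj_rel])
  moreover have "topspace ?\<tau> \<subseteq> XB // ?r" using openin_topspace[of ?\<tau>] unfolding op by blast
  ultimately have top: "topspace ?\<tau> = XB // ?r" using openin_subset by blast
  have "x \<in> ?\<tau> closure_of (cls ` U)" if x: "x \<in> XB // ?r" for x
  proof -
    have "\<exists>z\<in>cls ` U. z \<in> T" if T: "x \<in> T" "openin ?\<tau> T" for T
    proof -
      obtain G where G: "open G" "\<Union>T = XB \<inter> G"
        using T(2) unfolding op openin_open by blast
      have Tq: "T \<subseteq> XB // ?r" using T(2) unfolding op by blast
      obtain A where "A \<in> x" using x in_quotient_imp_non_empty[OF equiv_conj_rel] by blast
      then have "A \<in> XB \<inter> G" using T(1) G(2) by blast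
      then obtain B where B: "B \<in> \<Union>(cls ` U)" "B \<in> G"
        using dense G(1) open_Int_closure_eq_empty[of G "\<Union>(cls ` U)"] by blast
      then obtain z where z: "z \<in> cls ` U" "B \<in> z" by blast
      have "B \<in> XB" using B(1) cls_subset by blast
      then obtain z' where z': "z' \<in> T" "B \<in> z'" using G(2) B(2) by blast
      have "z = z'" using quotient_disj[OF equiv_conj_rel, of z XB z'] z z' W Tq by blast
      then show ?thesis using z z' by blast
    qed
    then show ?thesis using x unfolding in_closure_of top by blast
  qed
  then have 2: "?\<tau> closure_of (cls ` U) = XB // ?r"
    using closure_of_subset_topspace[of ?\<tau> "cls ` U"] top by blast
  show ?thesis using 1 2 unfolding dense_open_in_X_def Let_def X_def by blast
qed

end


section \<open>Density of the chart by perturbing normal forms along curves\<close>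

section \<open>Density of the coordinate chart\<close>

lemma closure_curve:
  fixes f :: "complex \<Rightarrow> 'a::topological_space"
  assumes "(f \<longlongrightarrow> A) (at 0)" "eventually (\<lambda>t. f t \<in> T) (at 0)"
  shows "A \<in> closure T"
  by (rule Lim_in_closed_set[OF closed_closure _ _ assms(1)])
    (use assms(2) closure_subset[of T] in \<open>auto elim: eventually_mono\<close>)

lemma eventually_notin_finite:
  fixes S :: "complex set"
  assumes "finite S"
  shows "eventually (\<lambda>t. t \<notin> S) (at x)"
  unfolding eventually_at_topological
  by (rule exI[of _ "- (S - {x})"])
    (use assms in \<open>auto simp: finite_imp_closed open_Compl simp del: Compl_Diff_eq\<close>)

lemma finite_quadratic_roots:
  fixes A B C :: complex
  assumes "A \<noteq> 0"
  shows "finite {t. A * t^2 + B * t + C = 0}"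
proof -
  obtain r s where "\<And>z. A * z^2 + B * z + C = A * (z - r) * (z - s)"
    using split_quadratic[OF assms] by blast
  then have "{t. A * t^2 + B * t + C = 0} \<subseteq> {r, s}" using assms by auto
  then show ?thesis by (rule finite_subset) simp
qed

lemma tendsto_mk_mat2:
  assumes "(a \<longlongrightarrow> a') F" "(b \<longlongrightarrow> b') F" "(c \<longlongrightarrow> c') F" "(d \<longlongrightarrow> d') F"
  shows "((\<lambda>t. mk_mat2 (a t) (b t) (c t) (d t)) \<longlongrightarrow> mk_mat2 a' b' c' d') F"
proof (intro vec_tendstoI)
  fix i j :: 2
  show "((\<lambda>t. mk_mat2 (a t) (b t) (c t) (d t) $ i $ j) \<longlongrightarrow> mk_mat2 a' b' c' d' $ i $ j) F"
    using exhaust_2[of i] exhaust_2[of j] assms by auto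
qed

lemma tendsto_conj_by:
  assumes "(f \<longlongrightarrow> A) F"
  shows "((\<lambda>t. conj_by P (f t)) \<longlongrightarrow> conj_by P A) F"
proof -
  have c: "conj_by P B = (matrix_inv P ** fst B ** P, matrix_inv P ** fst (snd B) ** P,
      matrix_inv P ** snd (snd B) ** P)" for B
    by (cases B) (simp add: conj_by.simps)
  show ?thesis unfolding c
    by (intro tendsto_Pair vec_tendstoI; unfold mat2_mult_nth; intro tendsto_intros assms)
qed

lemma det2_eq_0:
  assumes "det2 u v = 0" "v \<noteq> 0"
  obtains c where "u = c *s v"
proof (cases "v $ 1 = 0")
  case True
  then have "v $ 2 \<noteq> 0" using assms(2) by (auto simp: vec_eq_iff forall_2)
  with True assms(1) show thesis
    by (intro that[of "u $ 2 / v $ 2"]) (auto simp: vec_eq_iff forall_2 det2_def)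
next
  case False
  with assms(1) show thesis
    by (intro that[of "u $ 1 / v $ 1"]) (auto simp: vec_eq_iff forall_2 det2_def field_simps)
qed

context space_params
begin

lemma tendsto_nf:
  assumes "(a \<longlongrightarrow> a0) F" "(b \<longlongrightarrow> b0) F" "(\<alpha> \<longlongrightarrow> \<alpha>0) F" "(\<delta> \<longlongrightarrow> \<delta>0) F"
    "(\<gamma> \<longlongrightarrow> \<gamma>0) F" "(\<beta> \<longlongrightarrow> \<beta>0) F"
  shows "((\<lambda>t. nf (a t) (b t) (\<alpha> t) (\<delta> t) (\<gamma> t) (\<beta> t)) \<longlongrightarrow> nf a0 b0 \<alpha>0 \<delta>0 \<gamma>0 \<beta>0) F"
  unfolding nf_def by (intro tendsto_Pair tendsto_mk_mat2 tendsto_intros assms)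

lemma tendsto_g:
  assumes "(a \<longlongrightarrow> a0) F" "(b \<longlongrightarrow> b0) F"
  shows "((\<lambda>t. g0 (a t) (b t)) \<longlongrightarrow> g0 a0 b0) F" "((\<lambda>t. g1 (a t) (b t)) \<longlongrightarrow> g1 a0 b0) F"
    "((\<lambda>t. g2 (a t) (b t)) \<longlongrightarrow> g2 a0 b0) F"
  unfolding g0_def g1_def g2_def by (intro tendsto_intros assms)+

text \<open>One fixed \<open>P\<close> carries the whole curve of normal forms back to a curve
  through \<open>A\<close>; membership in \<open>T\<close> is asked only for parameters near 0 and
  different from it.\<close>

lemma closure_nf_curve:
  fixes a b \<alpha> \<delta> \<gamma> \<beta> :: "complex \<Rightarrow> complex"
  assumes P: "invertible P" and A: "conj_by P A = nf a0 b0 \<alpha>0 \<delta>0 \<gamma>0 \<beta>0"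
    and t: "(a \<longlongrightarrow> a0) (at 0)" "(b \<longlongrightarrow> b0) (at 0)" "(\<alpha> \<longlongrightarrow> \<alpha>0) (at 0)" "(\<delta> \<longlongrightarrow> \<delta>0) (at 0)"
      "(\<gamma> \<longlongrightarrow> \<gamma>0) (at 0)" "(\<beta> \<longlongrightarrow> \<beta>0) (at 0)"
    and ev: "eventually (\<lambda>t. nf_eqs (a t) (b t) (\<alpha> t) (\<delta> t) (\<gamma> t) (\<beta> t) \<and> Q t) (at 0)"
    and T: "\<And>B t. B \<in> XB \<Longrightarrow> conj_by P B = nf (a t) (b t) (\<alpha> t) (\<delta> t) (\<gamma> t) (\<beta> t) \<Longrightarrow> Q t \<Longrightarrow> B \<in> T"
  shows "A \<in> closure T"
proof (rule closure_curve)
  let ?f = "\<lambda>t. conj_by (matrix_inv P) (nf (a t) (b t) (\<alpha> t) (\<delta> t) (\<gamma> t) (\<beta> t))"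
  have "(?f \<longlongrightarrow> conj_by (matrix_inv P) (conj_by P A)) (at 0)"
    unfolding A by (intro tendsto_conj_by tendsto_nf t)
  then show "(?f \<longlongrightarrow> A) (at 0)" by (simp only: conj_by_inverse[OF P])
  show "eventually (\<lambda>t. ?f t \<in> T) (at 0)"
    using ev
  proof (rule eventually_mono)
    fix t assume "nf_eqs (a t) (b t) (\<alpha> t) (\<delta> t) (\<gamma> t) (\<beta> t) \<and> Q t"
    then show "?f t \<in> T"
      by (intro T[of _ t])
        (auto simp: conj_by_inverse[OF P] nf_mem_iff intro: conj_by_mem_XB invertible_matrix_inv[OF P])
  qed
qed

text \<open>\<open>Phi\<close> is affine in \<open>b\<close>, with leading coefficient \<open>\<kappa>1 * \<delta>^2 + a * \<alpha> * \<delta> + \<theta>1 * \<alpha>^2\<close>; where this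
  does not vanish, \<open>(a, \<alpha>, \<delta>)\<close> can be moved freely.\<close>

lemma closure_perturb:
  fixes a \<alpha> \<delta> :: "complex \<Rightarrow> complex"
  assumes P: "invertible P" and A: "conj_by P A = nf a0 b0 \<alpha>0 \<delta>0 \<gamma>0 \<beta>0"
    and eqs: "nf_eqs a0 b0 \<alpha>0 \<delta>0 \<gamma>0 \<beta>0"
    and w0: "\<kappa>1 * \<delta>0^2 + a0 * \<alpha>0 * \<delta>0 + \<theta>1 * \<alpha>0^2 \<noteq> 0"
    and t: "(a \<longlongrightarrow> a0) (at 0)" "(\<alpha> \<longlongrightarrow> \<alpha>0) (at 0)" "(\<delta> \<longlongrightarrow> \<delta>0) (at 0)"
    and Q: "eventually Q (at 0)"
    and T: "\<And>B t b \<gamma> \<beta>. B \<in> XB \<Longrightarrow> conj_by P B = nf (a t) b (\<alpha> t) (\<delta> t) \<gamma> \<beta> \<Longrightarrow> Q t \<Longrightarrow> B \<in> T"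
  shows "A \<in> closure T"
proof -
  define w where "w t = \<kappa>1 * (\<delta> t)^2 + a t * \<alpha> t * \<delta> t + \<theta>1 * (\<alpha> t)^2" for t
  define b where "b t = - Phi (a t) 0 (\<alpha> t) (\<delta> t) / w t" for t
  have Phi: "Phi x z p r = (\<kappa>1 * r^2 + x * p * r + \<theta>1 * p^2) * z + Phi x 0 p r" for x z p r
    unfolding Phi_def g0_def g1_def g2_def by algebra
  have tw: "(w \<longlongrightarrow> \<kappa>1 * \<delta>0^2 + a0 * \<alpha>0 * \<delta>0 + \<theta>1 * \<alpha>0^2) (at 0)"
    unfolding w_def by (intro tendsto_intros t)
  have "(b \<longlongrightarrow> - Phi a0 0 \<alpha>0 \<delta>0 / (\<kappa>1 * \<delta>0^2 + a0 * \<alpha>0 * \<delta>0 + \<theta>1 * \<alpha>0^2)) (at 0)"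
    unfolding b_def Phi_def by (intro tendsto_intros tendsto_g tw t w0)
  moreover have "- Phi a0 0 \<alpha>0 \<delta>0 / (\<kappa>1 * \<delta>0^2 + a0 * \<alpha>0 * \<delta>0 + \<theta>1 * \<alpha>0^2) = b0"
  proof -
    have "- Phi a0 0 \<alpha>0 \<delta>0 = b0 * (\<kappa>1 * \<delta>0^2 + a0 * \<alpha>0 * \<delta>0 + \<theta>1 * \<alpha>0^2)"
      using Phi[of a0 b0 \<alpha>0 \<delta>0] nf_eqs_Phi[OF eqs] by algebra
    then show ?thesis using w0 by simp
  qed
  ultimately have tb: "(b \<longlongrightarrow> b0) (at 0)" by simp
  have ew: "eventually (\<lambda>t. w t \<noteq> 0) (at 0)"
    by (rule tendsto_imp_eventually_ne[OF tw w0])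
  have Phi0: "Phi (a t) (b t) (\<alpha> t) (\<delta> t) = 0" if "w t \<noteq> 0" for t
    using that unfolding Phi[of "a t" "b t"] unfolding b_def w_def by simp
  show ?thesis
  proof (cases "\<alpha>0 = 0")
    case False
    let ?\<gamma> = "\<lambda>t. g2 (a t) (b t) / \<alpha> t"
    let ?\<beta> = "\<lambda>t. (g1 (a t) (b t) + \<delta> t * (g2 (a t) (b t) / \<alpha> t)) / \<alpha> t"
    \<comment> \<open>Along the curve \<gamma> and \<beta> are defined by division; uniqueness at
      the base point identifies their limits with \<gamma>0 and \<beta>0.\<close>
    note eq = nf_eqs_unique[OF eqs nf_eqsI_alpha[OF nf_eqs_Phi[OF eqs] False]]
    have "(?\<gamma> \<longlongrightarrow> \<gamma>0) (at 0)" "(?\<beta> \<longlongrightarrow> \<beta>0) (at 0)"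
      unfolding conjunct1[OF eq] conjunct2[OF eq] by (intro tendsto_intros tendsto_g t tb False)+
    moreover have "eventually (\<lambda>t. nf_eqs (a t) (b t) (\<alpha> t) (\<delta> t) (?\<gamma> t) (?\<beta> t) \<and> Q t) (at 0)"
      using ew tendsto_imp_eventually_ne[OF t(2) False] Q
      by eventually_elim (intro conjI nf_eqsI_alpha Phi0)
    ultimately show ?thesis using closure_nf_curve[OF P A t(1) tb t(2,3), where Q = Q and T = T] T by blast
  next
    case True
    then have d: "\<delta>0 \<noteq> 0" using nf_eqs_nontrivial[OF eqs] by blast
    let ?\<beta> = "\<lambda>t. - g0 (a t) (b t) / \<delta> t"
    let ?\<gamma> = "\<lambda>t. (\<alpha> t * (- g0 (a t) (b t) / \<delta> t) - g1 (a t) (b t)) / \<delta> t"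
    note eq = nf_eqs_unique[OF eqs nf_eqsI_delta[OF nf_eqs_Phi[OF eqs] d]]
    have "(?\<gamma> \<longlongrightarrow> \<gamma>0) (at 0)" "(?\<beta> \<longlongrightarrow> \<beta>0) (at 0)"
      unfolding conjunct1[OF eq] conjunct2[OF eq] by (intro tendsto_intros tendsto_g t tb d)+
    moreover have "eventually (\<lambda>t. nf_eqs (a t) (b t) (\<alpha> t) (\<delta> t) (?\<gamma> t) (?\<beta> t) \<and> Q t) (at 0)"
      using ew tendsto_imp_eventually_ne[OF t(3) d] Q
      by eventually_elim (intro conjI nf_eqsI_delta Phi0)
    ultimately show ?thesis using closure_nf_curve[OF P A t(1) tb t(2,3), where Q = Q and T = T] T by blast
  qed
qed

text \<open>Density is proved along a shrinking chain of such sets, each contained in the closure of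
  the next, so that every step perturbs one feature only.\<close>

definition charted :: "(complex \<Rightarrow> complex \<Rightarrow> complex \<Rightarrow> bool) \<Rightarrow> quad set" where
  "charted Q = {A \<in> XB. \<exists>P a b \<alpha> \<delta> \<gamma> \<beta>. invertible P \<and> conj_by P A = nf a b \<alpha> \<delta> \<gamma> \<beta> \<and> Q a \<alpha> \<delta>}"

lemma chartedI:
  "A \<in> XB \<Longrightarrow> invertible P \<Longrightarrow> conj_by P A = nf a b \<alpha> \<delta> \<gamma> \<beta> \<Longrightarrow> Q a \<alpha> \<delta> \<Longrightarrow> A \<in> charted Q"
  unfolding charted_def by blast

lemma chartedE:
  assumes "A \<in> charted Q"
  obtains P a b \<alpha> \<delta> \<gamma> \<beta> where "A \<in> XB" "invertible P" "conj_by P A = nf a b \<alpha> \<delta> \<gamma> \<beta>"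
    "nf_eqs a b \<alpha> \<delta> \<gamma> \<beta>" "Q a \<alpha> \<delta>"
proof -
  obtain P a b \<alpha> \<delta> \<gamma> \<beta> where A: "A \<in> XB" and P: "invertible P"
      and nf: "conj_by P A = nf a b \<alpha> \<delta> \<gamma> \<beta>" and Q: "Q a \<alpha> \<delta>"
    using assms unfolding charted_def by blast
  have "nf_eqs a b \<alpha> \<delta> \<gamma> \<beta>" using conj_by_mem_XB[OF P A] unfolding nf nf_mem_iff .
  then show thesis by (rule that[OF A P nf _ Q])
qed

lemma swap: "space_params \<kappa>1 \<kappa>2 \<theta>2 \<theta>1 c1 c2 c3 c4"
  by (rule space_params.intro[OF nz(1,2,4,3) rel[unfolded mult.commute[of \<theta>1]] distinct(1)
    distinct(2)[symmetric]]) (use irreducible in blast)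

lemma XB_swap: "Xbar \<kappa>1 \<kappa>2 \<theta>2 \<theta>1 c1 c2 c3 c4 = XB"
  by (simp add: Xbar_def insert_commute)

text \<open>When E2 = F1, the line E2 differs from F2, so the exchanged chart applies, with \<delta>
  = 0 at this point. Moving \<delta> away from 0 separates E2 from F1.\<close>

lemma XB_subset_charted: "XB \<subseteq> closure (charted (\<lambda>_ _ _. True))"
proof
  interpret sw: space_params \<kappa>1 \<kappa>2 \<theta>2 \<theta>1 c1 c2 c3 c4 by (rule swap)
  fix A assume A: "A \<in> XB"
  obtain A0 A1 A2 where A3: "A = (A0, A1, A2)" by (cases A)
  have "\<theta>1 \<in> spectrum A0" "\<theta>2 \<in> spectrum A0" "\<kappa>2 \<in> spectrum A2"
    using A unfolding Xbar_def A3 by auto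
  then obtain u u2 v where u: "u \<noteq> 0" "A0 *v u = \<theta>1 *s u" and u2: "u2 \<noteq> 0" "A0 *v u2 = \<theta>2 *s u2"
      and v: "v \<noteq> 0" "A2 *v v = \<kappa>2 *s v"
    unfolding spectrum_def by blast
  show "A \<in> closure (charted (\<lambda>_ _ _. True))"
  proof (cases "det2 u v = 0")
    case False
    then have ad: "adapted_basis \<kappa>2 \<theta>1 A u v" and P: "invertible (cols u v)"
      using u v by (simp_all add: A3 eigenspace_def invertible_cols_iff)
    obtain a b \<alpha> \<delta> \<gamma> \<beta> where "conj_by (cols u v) A = nf a b \<alpha> \<delta> \<gamma> \<beta>"
      by (rule conj_by_adapted[OF A ad])
    then have "A \<in> charted (\<lambda>_ _ _. True)" by (rule chartedI[OF A P]) simp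
    then show ?thesis using closure_subset by blast
  next
    case True
    obtain c where c: "u = c *s v" using det2_eq_0[OF True v(1)] .
    have smult: "A0 *v (x *s v) = x *s (A0 *v v)" for x
      by (simp add: vec_eq_iff mat2_vec_nth distrib_left mult.left_commute)
    have "c \<noteq> 0" using u(1) c by auto
    have cv: "c *s (A0 *v v) = \<theta>1 *s (c *s v)" using u(2) unfolding c smult .
    have "(A0 *v v) $ i = (\<theta>1 *s v) $ i" for i
    proof -
      have "c * ((A0 *v v) $ i) = \<theta>1 * (c * v $ i)"
        using arg_cong[OF cv, of "\<lambda>x. x $ i"] unfolding vector_smult_component .
      then have "c * ((A0 *v v) $ i - \<theta>1 * v $ i) = 0" by algebra
      then show ?thesis using \<open>c \<noteq> 0\<close> by simp
    qed
    then have Av: "A0 *v v = \<theta>1 *s v" unfolding vec_eq_iff by blast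
    \<comment> \<open>\<open>v\<close> is now a \<theta>1-eigenvector of A0, hence independent of
      the \<theta>2-eigenvector \<open>u2\<close>.\<close>
    have d2: "det2 u2 v \<noteq> 0"
    proof
      assume "det2 u2 v = 0"
      then obtain c' where c': "u2 = c' *s v" using det2_eq_0 v(1) by blast
      have "c' *s (\<theta>1 *s v) = \<theta>2 *s (c' *s v)" using u2(2) unfolding c' smult Av .
      then have "c' * (\<theta>1 * v $ i) = \<theta>2 * (c' * v $ i)" for i
        unfolding vec_eq_iff vector_smult_component by blast
      then have "c' * (\<theta>1 - \<theta>2) * v $ i = 0" for i
        by (metis (no_types, opaque_lifting) eq_iff_diff_eq_0 left_diff_distrib mult.assoc mult.left_commute)
      then have "c' * v $ i = 0" for i using distinct by simp
      then have "u2 = 0" unfolding c' by (simp add: vec_eq_iff)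
      then show False using u2(1) by blast
    qed
    then have ad: "adapted_basis \<kappa>2 \<theta>2 A u2 v" and P: "invertible (cols u2 v)"
      using u2 v by (simp_all add: A3 eigenspace_def invertible_cols_iff)
    obtain a b \<alpha> \<delta> \<gamma> \<beta> where nf: "conj_by (cols u2 v) A = sw.nf a b \<alpha> \<delta> \<gamma> \<beta>"
        and eqs: "sw.nf_eqs a b \<alpha> \<delta> \<gamma> \<beta>"
      by (rule sw.conj_by_adapted[OF A[folded XB_swap] ad])
    \<comment> \<open>Up to sign, \<delta> is the component along \<open>u2\<close> of A0 applied to
      \<open>v\<close>, which is zero for an eigenvector \<open>v\<close>.\<close>
    have "det2 (A0 *v v) v = - \<delta> * det2 u2 v"
      using det2_nth_cols(1)[OF P nf[unfolded A3 sw.nf_def]] by simp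
    moreover have "det2 (A0 *v v) v = 0" by (simp add: Av det2_def)
    ultimately have \<delta>: "\<delta> = 0" using d2 by simp
    then have "\<alpha> \<noteq> 0" using sw.nf_eqs_nontrivial[OF eqs] by blast
    then have w: "\<kappa>1 * \<delta>^2 + a * \<alpha> * \<delta> + \<theta>2 * \<alpha>^2 \<noteq> 0" using nz \<delta> by simp
    show ?thesis
    proof (rule sw.closure_perturb[OF P nf eqs w tendsto_const tendsto_const,
          where \<delta> = "\<lambda>t. t" and Q = "\<lambda>t. t \<noteq> 0"])
      show "((\<lambda>t. t) \<longlongrightarrow> \<delta>) (at 0)" unfolding \<delta> by (rule tendsto_ident_at)
      show "eventually (\<lambda>t::complex. t \<noteq> 0) (at 0)" by (simp add: eventually_at_filter)
    next
      fix B t b' \<gamma>' \<beta>'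
      assume B: "B \<in> Xbar \<kappa>1 \<kappa>2 \<theta>2 \<theta>1 c1 c2 c3 c4" and t: "t \<noteq> 0"
        and nfB: "conj_by (cols u2 v) B = sw.nf a b' \<alpha> t \<gamma>' \<beta>'"
      \<comment> \<open>The first column is the \<theta>1-eigenvector of the constant term in the
        exchanged normal form, the second the \<kappa>2-eigenvector of the leading term; their
        determinant is \<open>t\<close>.\<close>
      let ?R = "cols (vec2 t (\<theta>2 - \<theta>1)) (vec2 0 1)"
      have BX: "B \<in> XB" using B XB_swap by simp
      have R: "invertible ?R" using t by (simp add: invertible_cols_iff det2_def)
      have "adapted_basis \<kappa>2 \<theta>1 (conj_by (cols u2 v) B) (vec2 t (\<theta>2 - \<theta>1)) (vec2 0 1)"
        using R unfolding nfB sw.nf_def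
        by (simp add: eigenspace_def vec_eq_iff forall_2 mat2_vec_nth algebra_simps)
      then obtain a1 b1 \<alpha>1 \<delta>1 \<gamma>1 \<beta>1 where
          "conj_by ?R (conj_by (cols u2 v) B) = nf a1 b1 \<alpha>1 \<delta>1 \<gamma>1 \<beta>1"
        by (rule conj_by_adapted[OF conj_by_mem_XB[OF P BX]])
      then show "B \<in> charted (\<lambda>_ _ _. True)"
        unfolding conj_by_mult[OF P R] by (rule chartedI[OF BX invertible_mult[OF P R]]) simp
    qed
  qed
qed

text \<open>If the 11 entry vanishes at the root y0, then K(y0) = 0. The curve prescribes the root
  and the 22 entry there, takes K divided by that value as the 11 entry, and solves for a and
  b.\<close>

lemma charted_subset_nonzero:
  "charted (\<lambda>_ _ _. True) \<subseteq> closure (charted (\<lambda>a \<alpha> \<delta>. \<kappa>1 * \<delta>^2 + a * \<alpha> * \<delta> + \<theta>1 * \<alpha>^2 \<noteq> 0))"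
    (is "_ \<subseteq> closure (charted ?Q)")
proof
  fix A assume "A \<in> charted (\<lambda>_ _ _. True)"
  then obtain P a b \<alpha> \<delta> \<gamma> \<beta> where A: "A \<in> XB" and P: "invertible P"
      and nf: "conj_by P A = nf a b \<alpha> \<delta> \<gamma> \<beta>" and eqs: "nf_eqs a b \<alpha> \<delta> \<gamma> \<beta>"
    by (rule chartedE)
  show "A \<in> closure (charted ?Q)"
  proof (cases "?Q a \<alpha> \<delta>")
    case True
    then show ?thesis using chartedI[OF A P nf, of ?Q] closure_subset by blast
  next
    case False
    \<comment> \<open>The form is \<open>\<kappa>1 * \<delta>^2\<close> for \<alpha> = 0 and
      \<open>\<theta>1 * \<alpha>^2\<close> for \<delta> = 0, so its vanishing excludes both
      cases.\<close>
    have \<alpha>: "\<alpha> \<noteq> 0" using False nf_eqs_nontrivial[OF eqs] nz by auto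
    have \<delta>: "\<delta> \<noteq> 0" using False \<alpha> nz by auto
    define y0 where "y0 = \<delta> / \<alpha>"
    have y0: "y0 \<noteq> 0" "\<delta> = \<alpha> * y0" using \<alpha> \<delta> by (simp_all add: y0_def)
    have "\<alpha>^2 * (\<kappa>1 * y0^2 + a * y0 + \<theta>1) = 0"
      using False unfolding y0(2) by (simp add: algebra_simps power2_eq_square)
    then have w0: "\<kappa>1 * y0^2 + a * y0 + \<theta>1 = 0" using \<alpha> by simp
    have "\<alpha>^2 * ((\<kappa>1 * y0^2 + a * y0 + \<theta>1) * (\<kappa>2 * y0^2 + b * y0 + \<theta>2) - K y0) = 0"
      using Phi_root[of y0 a b \<alpha>] nf_eqs_Phi[OF eqs] unfolding y0(2) by simp
    then have K0: "K y0 = 0" using \<alpha> w0 by simp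
    define w' where "w' = \<kappa>2 * y0^2 + b * y0 + \<theta>2"
    \<comment> \<open>The square serves the case w' = 0: the zero of K at y0 contributes t^2, and
      after division by the 22 value \<open>t\<close> the 11 value still tends to 0.\<close>
    define y where "y t = y0 + t^2" for t :: complex
    have ty: "(y \<longlongrightarrow> y0 + 0^2) (at 0)" unfolding y_def by (intro tendsto_intros)
    then have ty: "(y \<longlongrightarrow> y0) (at 0)" by simp
    have tv: "((\<lambda>t. w' + t) \<longlongrightarrow> w' + 0) (at 0)" by (intro tendsto_intros)
    obtain H where H: "isCont H y0" "\<And>z. K z = (z - y0) * H z"
    proof -
      have "y0 = c1 \<or> y0 = c2 \<or> y0 = c3 \<or> y0 = c4" using K0 nz by (simp add: K_def)
      then show thesis
      proof (elim disjE)
        assume "y0 = c1" then show thesis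
          by (intro that[of "\<lambda>z. \<kappa>1 * \<kappa>2 * (z - c2) * (z - c3) * (z - c4)"])
            (auto simp: K_def intro!: continuous_intros)
      next
        assume "y0 = c2" then show thesis
          by (intro that[of "\<lambda>z. \<kappa>1 * \<kappa>2 * (z - c1) * (z - c3) * (z - c4)"])
            (auto simp: K_def intro!: continuous_intros)
      next
        assume "y0 = c3" then show thesis
          by (intro that[of "\<lambda>z. \<kappa>1 * \<kappa>2 * (z - c1) * (z - c2) * (z - c4)"])
            (auto simp: K_def intro!: continuous_intros)
      next
        assume "y0 = c4" then show thesis
          by (intro that[of "\<lambda>z. \<kappa>1 * \<kappa>2 * (z - c1) * (z - c2) * (z - c3)"])
            (auto simp: K_def intro!: continuous_intros)
      qed
    qed
    have tH: "((\<lambda>t. H (y t)) \<longlongrightarrow> H y0) (at 0)" by (rule isCont_tendsto_compose[OF H(1) ty])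
    have tw: "((\<lambda>t. K (y t) / (w' + t)) \<longlongrightarrow> 0) (at 0)"
    proof (cases "w' = 0")
      case True
      have "((\<lambda>t. t * H (y t)) \<longlongrightarrow> 0 * H y0) (at 0)" by (intro tendsto_intros tH)
      moreover have "eventually (\<lambda>t. t * H (y t) = K (y t) / (w' + t)) (at 0)"
        unfolding eventually_at_filter H(2) y_def True
        by (simp add: power2_eq_square)
      ultimately show ?thesis using tendsto_cong by fastforce
    next
      case False
      have "((\<lambda>t. K (y t) / (w' + t)) \<longlongrightarrow> (y0 - y0) * H y0 / (w' + 0)) (at 0)"
        unfolding H(2) by (intro tendsto_intros tH tv ty) (use False in simp)
      then show ?thesis by simp
    qed
    \<comment> \<open>Interpolation: \<open>a'\<close> and \<open>b'\<close> are the middle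
      coefficients that give the diagonal entries their prescribed values at
      \<open>y t\<close>.\<close>
    define a' where "a' t = (K (y t) / (w' + t) - \<kappa>1 * (y t)^2 - \<theta>1) / y t" for t
    define b' where "b' t = (w' + t - \<kappa>2 * (y t)^2 - \<theta>2) / y t" for t
    have "(a' \<longlongrightarrow> (0 - \<kappa>1 * y0^2 - \<theta>1) / y0) (at 0)"
      unfolding a'_def by (intro tendsto_intros tw ty y0)
    moreover have "(0 - \<kappa>1 * y0^2 - \<theta>1) / y0 = a" using w0 y0(1) by (simp add: field_simps) algebra
    ultimately have ta: "(a' \<longlongrightarrow> a) (at 0)" by simp
    have "(b' \<longlongrightarrow> (w' + 0 - \<kappa>2 * y0^2 - \<theta>2) / y0) (at 0)"
      unfolding b'_def by (intro tendsto_intros ty tv y0)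
    moreover have "(w' + 0 - \<kappa>2 * y0^2 - \<theta>2) / y0 = b" using y0(1) by (simp add: w'_def)
    ultimately have tb: "(b' \<longlongrightarrow> b) (at 0)" by simp
    have "((\<lambda>t. \<alpha> * y t) \<longlongrightarrow> \<alpha> * y0) (at 0)" by (intro tendsto_intros ty)
    then have td: "((\<lambda>t. \<alpha> * y t) \<longlongrightarrow> \<delta>) (at 0)" by (simp add: y0(2))
    let ?\<gamma> = "\<lambda>t. g2 (a' t) (b' t) / \<alpha>"
    let ?\<beta> = "\<lambda>t. (g1 (a' t) (b' t) + \<alpha> * y t * (g2 (a' t) (b' t) / \<alpha>)) / \<alpha>"
    note eq = nf_eqs_unique[OF eqs nf_eqsI_alpha[OF nf_eqs_Phi[OF eqs] \<alpha>]]
    have tg: "(?\<gamma> \<longlongrightarrow> \<gamma>) (at 0)" "(?\<beta> \<longlongrightarrow> \<beta>) (at 0)"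
      unfolding conjunct1[OF eq] conjunct2[OF eq] by (intro tendsto_intros tendsto_g ta tb td \<alpha>)+
    have "finite {t. y t = c}" for c
      by (rule finite_subset[OF _ finite_quadratic_roots[of 1 0 "y0 - c"]]) (auto simp: y_def)
    then have f: "finite ({t. y t = c1} \<union> {t. y t = c2} \<union> {t. y t = c3} \<union> {t. y t = c4} \<union> {- w'})"
      by simp
    show ?thesis
    proof (rule closure_nf_curve[OF P nf ta tb tendsto_const td tg,
          where Q = "\<lambda>t. ?Q (a' t) \<alpha> (\<alpha> * y t)"])
      show "\<forall>\<^sub>F t in at 0. nf_eqs (a' t) (b' t) \<alpha> (\<alpha> * y t) (?\<gamma> t) (?\<beta> t) \<and> ?Q (a' t) \<alpha> (\<alpha> * y t)"
        using eventually_notin_finite[OF f] tendsto_imp_eventually_ne[OF ty y0(1)]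
      proof eventually_elim
        case (elim t)
        have n: "w' + t \<noteq> 0" "K (y t) \<noteq> 0" "y t \<noteq> 0"
          using elim nz by (auto simp: K_def add_eq_0_iff)
        have e: "\<kappa>1 * (y t)^2 + a' t * y t + \<theta>1 = K (y t) / (w' + t)"
          "\<kappa>2 * (y t)^2 + b' t * y t + \<theta>2 = w' + t"
          using n(3) by (simp_all add: a'_def b'_def)
        have "y t * Phi (a' t) (b' t) \<alpha> (\<alpha> * y t) = 0"
          unfolding Phi_root e using n by simp
        then have "Phi (a' t) (b' t) \<alpha> (\<alpha> * y t) = 0" using n by simp
        moreover have "\<kappa>1 * (\<alpha> * y t)^2 + a' t * \<alpha> * (\<alpha> * y t) + \<theta>1 * \<alpha>^2 = \<alpha>^2 * (K (y t) / (w' + t))"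
          unfolding e(1)[symmetric] by algebra
        moreover have "\<alpha>^2 * (K (y t) / (w' + t)) \<noteq> 0" using n \<alpha> by simp
        ultimately show ?case using nf_eqsI_alpha[OF _ \<alpha>] by metis
      qed
    qed (rule chartedI[OF _ P])
  qed
qed

text \<open>Finitely many values of the root are avoided by moving \<delta>, or, if the root is at
  infinity, by moving \<alpha> away from 0.\<close>

lemma nonzero_subset_generic:
  assumes "finite Y"
  shows "charted (\<lambda>a \<alpha> \<delta>. \<kappa>1 * \<delta>^2 + a * \<alpha> * \<delta> + \<theta>1 * \<alpha>^2 \<noteq> 0) \<subseteq> closure (charted
    (\<lambda>a \<alpha> \<delta>. \<kappa>1 * \<delta>^2 + a * \<alpha> * \<delta> + \<theta>1 * \<alpha>^2 \<noteq> 0 \<and> \<alpha> \<noteq> 0 \<and> \<delta> \<noteq> 0 \<and> \<delta> / \<alpha> \<notin> Y))"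
    (is "charted ?Q \<subseteq> closure (charted ?Q')")
proof
  fix A assume "A \<in> charted ?Q"
  then obtain P a b \<alpha> \<delta> \<gamma> \<beta> where P: "invertible P"
      and nf: "conj_by P A = nf a b \<alpha> \<delta> \<gamma> \<beta>" and eqs: "nf_eqs a b \<alpha> \<delta> \<gamma> \<beta>" and w: "?Q a \<alpha> \<delta>"
    by (rule chartedE)
  show "A \<in> closure (charted ?Q')"
  proof (cases "\<alpha> = 0")
    case False
    have "((\<lambda>t. \<delta> + t) \<longlongrightarrow> \<delta> + 0) (at 0)" by (intro tendsto_intros)
    then have td: "((\<lambda>t. \<delta> + t) \<longlongrightarrow> \<delta>) (at 0)" by simp
    have tw: "((\<lambda>t. \<kappa>1 * (\<delta> + t)^2 + a * \<alpha> * (\<delta> + t) + \<theta>1 * \<alpha>^2) \<longlongrightarrow>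
        \<kappa>1 * \<delta>^2 + a * \<alpha> * \<delta> + \<theta>1 * \<alpha>^2) (at 0)" by (intro tendsto_intros td)
    have f: "finite ({- \<delta>} \<union> (\<lambda>y. y * \<alpha> - \<delta>) ` Y)" using assms by simp
    show ?thesis
    proof (rule closure_perturb[OF P nf eqs w tendsto_const tendsto_const td,
          where Q = "\<lambda>t. ?Q' a \<alpha> (\<delta> + t)"])
      show "\<forall>\<^sub>F t in at 0. ?Q' a \<alpha> (\<delta> + t)"
        using tendsto_imp_eventually_ne[OF tw w] eventually_notin_finite[OF f]
      proof eventually_elim
        case (elim t)
        have "(\<delta> + t) / \<alpha> \<notin> Y"
        proof
          assume "(\<delta> + t) / \<alpha> \<in> Y"
          moreover have "t = (\<delta> + t) / \<alpha> * \<alpha> - \<delta>" using False by simp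
          ultimately show False using elim by blast
        qed
        then show ?case using elim False by (auto simp: add_eq_0_iff)
      qed
    qed (rule chartedI[OF _ P])
  next
    case True
    then have d: "\<delta> \<noteq> 0" using nf_eqs_nontrivial[OF eqs] by blast
    have ta: "((\<lambda>t. t) \<longlongrightarrow> \<alpha>) (at 0)" unfolding True by (rule tendsto_ident_at)
    have tw: "((\<lambda>t. \<kappa>1 * \<delta>^2 + a * t * \<delta> + \<theta>1 * t^2) \<longlongrightarrow>
        \<kappa>1 * \<delta>^2 + a * \<alpha> * \<delta> + \<theta>1 * \<alpha>^2) (at 0)" by (intro tendsto_intros ta)
    have f: "finite ({0} \<union> (\<lambda>y. \<delta> / y) ` Y)" using assms by simp
    show ?thesis
    proof (rule closure_perturb[OF P nf eqs w tendsto_const ta tendsto_const,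
          where Q = "\<lambda>t. ?Q' a t \<delta>"])
      show "\<forall>\<^sub>F t in at 0. ?Q' a t \<delta>"
        using tendsto_imp_eventually_ne[OF tw w] eventually_notin_finite[OF f]
          eventually_neq_at_within[of 0]
      proof eventually_elim
        case (elim t)
        have "\<delta> / t \<notin> Y"
        proof
          assume "\<delta> / t \<in> Y"
          moreover have "t = \<delta> / (\<delta> / t)" using d by simp
          ultimately show False using elim by blast
        qed
        then show ?case using elim d by auto
      qed
    qed (rule chartedI[OF _ P])
  qed
qed

text \<open>The root y is kept and only a moves. Then \<xi> moves injectively, while the fibre of
  \<open>U\<close> over y omits only finitely many \<xi>.\<close>

lemma generic_subset_cls:
  assumes U: "U \<subseteq> regular_points" and fin: "\<And>y. y \<notin> Y \<Longrightarrow> finite {\<xi>. (y, \<xi>) \<notin> U}"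
    and Y: "{0, c1, c2} \<subseteq> Y"
  shows "charted (\<lambda>a \<alpha> \<delta>. \<kappa>1 * \<delta>^2 + a * \<alpha> * \<delta> + \<theta>1 * \<alpha>^2 \<noteq> 0 \<and> \<alpha> \<noteq> 0 \<and> \<delta> \<noteq> 0 \<and> \<delta> / \<alpha> \<notin> Y)
    \<subseteq> closure (\<Union>(cls ` U))" (is "charted ?Q \<subseteq> _")
proof
  fix A assume "A \<in> charted ?Q"
  then obtain P a b \<alpha> \<delta> \<gamma> \<beta> where P: "invertible P"
      and nf: "conj_by P A = nf a b \<alpha> \<delta> \<gamma> \<beta>" and eqs: "nf_eqs a b \<alpha> \<delta> \<gamma> \<beta>" and Q: "?Q a \<alpha> \<delta>"
    by (rule chartedE)
  define y where "y = \<delta> / \<alpha>"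
  have y: "\<delta> = \<alpha> * y" "y \<notin> Y" "\<alpha> \<noteq> 0" "y \<noteq> 0" "y \<noteq> c1" "y \<noteq> c2"
    using Q Y by (auto simp: y_def)
  define W where "W t = \<kappa>1 * y^2 + (a + t) * y + \<theta>1" for t
  define xi where "xi t = (y - c1) * (y - c2) / W t" for t
  \<comment> \<open>An inverse of \<open>W\<close>: it carries the finitely many bad \<xi> back to
    finitely many bad \<open>t\<close>.\<close>
  define h where "h w = (w - \<kappa>1 * y^2 - \<theta>1) / y - a" for w
  have h: "t = h (W t)" for t using y(4) by (simp add: h_def W_def)
  have f: "finite ({h 0} \<union> (\<lambda>\<xi>. h ((y - c1) * (y - c2) / \<xi>)) ` {\<xi>. (y, \<xi>) \<notin> U})"
    using fin[OF y(2)] by simp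
  have "((\<lambda>t. a + t) \<longlongrightarrow> a + 0) (at 0)" by (intro tendsto_intros)
  then have ta: "((\<lambda>t. a + t) \<longlongrightarrow> a) (at 0)" by simp
  show "A \<in> closure (\<Union>(cls ` U))"
  proof (rule closure_perturb[OF P nf eqs _ ta tendsto_const tendsto_const,
        where Q = "\<lambda>t. W t \<noteq> 0 \<and> (y, xi t) \<in> U"])
    show "\<kappa>1 * \<delta>^2 + a * \<alpha> * \<delta> + \<theta>1 * \<alpha>^2 \<noteq> 0" using Q by blast
    show "\<forall>\<^sub>F t in at 0. W t \<noteq> 0 \<and> (y, xi t) \<in> U"
      using eventually_notin_finite[OF f]
    proof eventually_elim
      case (elim t)
      have W: "W t \<noteq> 0" using elim h[of t] by auto
      have "W t = (y - c1) * (y - c2) / xi t" using W y by (simp add: xi_def)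
      then have "t = h ((y - c1) * (y - c2) / xi t)" using h[of t] by simp
      then show ?case using elim W by blast
    qed
  next
    fix B t b' \<gamma>' \<beta>'
    assume B: "B \<in> XB" "conj_by P B = nf (a + t) b' \<alpha> \<delta> \<gamma>' \<beta>'" and t: "W t \<noteq> 0 \<and> (y, xi t) \<in> U"
    have "B \<in> cls (y, xi t)"
      using t U y mem_cls_iff[OF _ B(1) P B(2), of y "xi t"] by (auto simp: xi_def W_def)
    then show "B \<in> \<Union>(cls ` U)" using t by blast
  qed
qed

lemma dense_cls:
  assumes U: "U \<subseteq> regular_points" and Y: "finite Y" "\<And>y. y \<notin> Y \<Longrightarrow> finite {\<xi>. (y, \<xi>) \<notin> U}"
  shows "XB \<subseteq> closure (\<Union>(cls ` U))"
proof -
  let ?Y = "Y \<union> {0, c1, c2}"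
  have "charted (\<lambda>a \<alpha> \<delta>. \<kappa>1 * \<delta>^2 + a * \<alpha> * \<delta> + \<theta>1 * \<alpha>^2 \<noteq> 0 \<and> \<alpha> \<noteq> 0 \<and> \<delta> \<noteq> 0 \<and> \<delta> / \<alpha> \<notin> ?Y)
      \<subseteq> closure (\<Union>(cls ` U))"
    by (rule generic_subset_cls[OF U]) (use Y in auto)
  moreover have "finite ?Y" using Y by simp
  ultimately show ?thesis
    using XB_subset_charted charted_subset_nonzero nonzero_subset_generic[of ?Y]
    by (meson closed_closure closure_minimal order_trans)
qed

end


section \<open>The involution on pairs (y, n) and its domain\<close>

section \<open>The involution\<close>

locale shift_params =
  src: space_params \<kappa>1 \<kappa>2 \<theta>1 \<theta>2 c1 c2 c3 c4 +
  tgt: space_params "q * \<kappa>1" \<kappa>2 "q * \<theta>1" \<theta>2 c1 c2 c3 c4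
  for q \<kappa>1 \<kappa>2 \<theta>1 \<theta>2 c1 c2 c3 c4 :: complex +
  assumes q: "q \<noteq> 0"
begin

text \<open>Interpolation: the middle coefficient of N forced by N(y) = n. Likewise
  \<open>lin2\<close> is the one of Y forced by Y(y) = K(y) / n.\<close>

definition lin1 :: "complex \<Rightarrow> complex \<Rightarrow> complex" where
  "lin1 y n = (n - \<kappa>2 * y^2 - q * \<theta>1) / y"

definition lin2 :: "complex \<Rightarrow> complex \<Rightarrow> complex" where
  "lin2 y n = (tgt.K y / n - q * \<kappa>1 * y^2 - \<theta>2) / y"

text \<open>\<open>L0\<close> and \<open>L1\<close> are the coefficients of z and z^3 in K - N Y,
  where \<open>d\<close> and \<open>e\<close> are the middle coefficients of N and Y.\<close>

definition L0 :: "complex \<Rightarrow> complex \<Rightarrow> complex" where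
  "L0 d e = - (q * \<kappa>1 * \<kappa>2 * (c1*c2*c3 + c1*c2*c4 + c1*c3*c4 + c2*c3*c4) + \<theta>2 * d + q * \<theta>1 * e)"

definition L1 :: "complex \<Rightarrow> complex \<Rightarrow> complex" where
  "L1 d e = - (q * \<kappa>1 * \<kappa>2 * (c1 + c2 + c3 + c4) + \<kappa>2 * e + q * \<kappa>1 * d)"

definition mid11 :: "complex \<Rightarrow> complex \<Rightarrow> complex" where
  "mid11 d z = \<kappa>2 * z^2 + d * z + q * \<theta>1"

definition mid22 :: "complex \<Rightarrow> complex \<Rightarrow> complex" where
  "mid22 e z = q * \<kappa>1 * z^2 + e * z + \<theta>2"

text \<open>Vieta: (K - N Y) / z is a quadratic with outer coefficients \<open>L1\<close> and
  \<open>L0\<close>, and y is one of its roots.\<close>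

definition other :: "complex \<Rightarrow> complex \<Rightarrow> complex" where
  "other y n = L0 (lin1 y n) (lin2 y n) / (y * L1 (lin1 y n) (lin2 y n))"

definition invol :: "complex \<times> complex \<Rightarrow> complex \<times> complex" where
  "invol = (\<lambda>(y, n). (other y n, mid11 (lin1 y n) (other y n)))"

text \<open>The conditions come in pairs exchanged by the involution: \<open>L0\<close> nonzero says
  that the other root is nonzero, and K nonzero is required at both roots, which also keeps N
  nonzero at the other one.\<close>

definition inv_dom :: "(complex \<times> complex) set" where
  "inv_dom = {(y, n). y \<noteq> 0 \<and> n \<noteq> 0 \<and> tgt.K y \<noteq> 0 \<and> L1 (lin1 y n) (lin2 y n) \<noteq> 0 \<and>
     L0 (lin1 y n) (lin2 y n) \<noteq> 0 \<and> tgt.K (other y n) \<noteq> 0}"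

lemma mid11_lin1: "y \<noteq> 0 \<Longrightarrow> mid11 (lin1 y n) y = n"
  by (simp add: mid11_def lin1_def)

lemma mid22_lin2: "y \<noteq> 0 \<Longrightarrow> mid22 (lin2 y n) y = tgt.K y / n"
  by (simp add: mid22_def lin2_def)

lemma lin1_mid11: "y \<noteq> 0 \<Longrightarrow> lin1 y (mid11 d y) = d"
  by (simp add: mid11_def lin1_def)

lemma lin2_mid22: "y \<noteq> 0 \<Longrightarrow> tgt.K y / n = mid22 e y \<Longrightarrow> lin2 y n = e"
  by (simp add: mid22_def lin2_def)

lemma c_nonzero: "c1 \<noteq> 0" "c2 \<noteq> 0" "c3 \<noteq> 0" "c4 \<noteq> 0"
  using src.rel src.nz by auto

text \<open>In the basis \<open>(v', v)\<close> with \<open>v'\<close> spanning the \<open>\<kappa>2\<close>-eigenspace of the leading coefficient of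
  \<open>A^\<close>, the matrix \<open>A^(z)\<close> has diagonal entries \<open>mid11\<close>, \<open>mid22\<close> and off-diagonal entries
  \<open>z (y - z)\<close> and a multiple of \<open>z - other y n\<close>.\<close>

lemma factorization:
  assumes "y \<noteq> 0" "n \<noteq> 0"
  defines "d \<equiv> lin1 y n" and "e \<equiv> lin2 y n"
  shows "tgt.K z - mid11 d z * mid22 e z = z * (z - y) * (L1 d e * z - L0 d e / y)"
proof -
  have "mid11 d y * mid22 e y = tgt.K y"
    unfolding d_def e_def mid11_lin1[OF assms(1)] mid22_lin2[OF assms(1)] using assms(2) by simp
  define M where "M = q * \<kappa>1 * \<kappa>2 * (c1*c2 + c1*c3 + c1*c4 + c2*c3 + c2*c4 + c3*c4)
    - \<kappa>2 * \<theta>2 - q * \<theta>1 * q * \<kappa>1 - d * e"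
  have E: "tgt.K x - mid11 d x * mid22 e x = x * (L1 d e * x^2 + M * x + L0 d e)" for x
    using src.rel unfolding tgt.K_def mid11_def mid22_def L1_def L0_def M_def by algebra
  have "y * (L1 d e * y^2 + M * y + L0 d e) = 0"
    using E[of y] \<open>mid11 d y * mid22 e y = tgt.K y\<close> by simp
  then have "L1 d e * y^2 + M * y + L0 d e = 0" using assms(1) by simp
  then have M: "M = - L1 d e * y - L0 d e / y"
    using assms(1) by (simp add: field_simps power2_eq_square) algebra
  show ?thesis unfolding E M using assms(1) by (simp add: field_simps power2_eq_square)
qed

lemma factorization':
  assumes "y \<noteq> 0" "n \<noteq> 0" "L1 (lin1 y n) (lin2 y n) \<noteq> 0"
  shows "tgt.K z - mid11 (lin1 y n) z * mid22 (lin2 y n) z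
    = L1 (lin1 y n) (lin2 y n) * z * (z - y) * (z - other y n)"
  unfolding factorization[OF assms(1,2)] other_def using assms by (simp add: field_simps)

lemma invol_invol:
  assumes "p \<in> inv_dom"
  shows "invol p \<in> inv_dom" "invol (invol p) = p"
proof -
  obtain y n where p: "p = (y, n)" by (cases p)
  define d where "d = lin1 y n"
  define e where "e = lin2 y n"
  define x where "x = other y n"
  have h: "y \<noteq> 0" "n \<noteq> 0" "tgt.K y \<noteq> 0" "L1 d e \<noteq> 0" "L0 d e \<noteq> 0" "tgt.K x \<noteq> 0"
    using assms unfolding p inv_dom_def d_def e_def x_def by auto
  have x: "x = L0 d e / (y * L1 d e)" by (simp add: x_def other_def d_def e_def)
  then have x0: "x \<noteq> 0" using h by simp
  have K: "tgt.K x = mid11 d x * mid22 e x"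
    using factorization'[OF h(1,2) h(4)[unfolded d_def e_def], of x] by (simp add: d_def e_def x_def)
  then have N0: "mid11 d x \<noteq> 0" using h by auto
  \<comment> \<open>N Y = K holds at the other root too, so interpolation there recovers the same N
    and Y.\<close>
  have de: "lin1 x (mid11 d x) = d" "lin2 x (mid11 d x) = e"
    using x0 N0 K by (simp_all add: lin1_mid11 lin2_mid22)
  have y: "other x (mid11 d x) = y" unfolding other_def de using h by (simp add: x)
  have i: "invol p = (x, mid11 d x)" by (simp add: p invol_def x_def d_def)
  show "invol p \<in> inv_dom" unfolding i inv_dom_def mem_Collect_eq prod.case de y using h x0 N0 by simp
  show "invol (invol p) = p" unfolding i unfolding invol_def prod.case de y p
    using mid11_lin1[OF h(1), of n] by (simp add: d_def)
qed

text \<open>For fixed y the product of \<xi> and n is constant, so the same map serves in both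
  directions.\<close>

definition to_inv :: "complex \<times> complex \<Rightarrow> complex \<times> complex" where
  "to_inv = (\<lambda>(y, \<xi>). (y, q * (y - c1) * (y - c2) / \<xi>))"

text \<open>In the target n is the 22 entry at the root, that is K(y) over the 11 entry. It is
  linear in \<xi>, and its inverse is \<open>of_inv'\<close>.\<close>

definition to_inv' :: "complex \<times> complex \<Rightarrow> complex \<times> complex" where
  "to_inv' = (\<lambda>(y, \<xi>). (y, q * \<kappa>1 * \<kappa>2 * \<xi> * (y - c3) * (y - c4)))"

definition of_inv' :: "complex \<times> complex \<Rightarrow> complex \<times> complex" where
  "of_inv' = (\<lambda>(y, n). (y, n / (q * \<kappa>1 * \<kappa>2 * (y - c3) * (y - c4))))"

definition src_points :: "(complex \<times> complex) set" where
  "src_points = {p. snd p \<noteq> 0 \<and> to_inv p \<in> inv_dom}"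

definition tgt_points :: "(complex \<times> complex) set" where
  "tgt_points = {p. snd p \<noteq> 0 \<and> to_inv' p \<in> inv_dom}"

lemma K_nonzero_iff: "tgt.K y \<noteq> 0 \<longleftrightarrow> y \<noteq> c1 \<and> y \<noteq> c2 \<and> y \<noteq> c3 \<and> y \<noteq> c4"
  using q src.nz by (simp add: tgt.K_def)

lemma inv_dom_nz: "p \<in> inv_dom \<Longrightarrow> fst p \<noteq> 0 \<and> snd p \<noteq> 0 \<and> fst p \<noteq> c1 \<and> fst p \<noteq> c2 \<and> fst p \<noteq> c3 \<and> fst p \<noteq> c4"
  by (auto simp: inv_dom_def K_nonzero_iff)

lemma to_inv_points: "p \<in> src_points \<Longrightarrow> to_inv p \<in> inv_dom" "p \<in> inv_dom \<Longrightarrow> to_inv p \<in> src_points"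
  "p \<in> src_points \<Longrightarrow> to_inv (to_inv p) = p" "p \<in> inv_dom \<Longrightarrow> to_inv (to_inv p) = p"
proof -
  show "p \<in> src_points \<Longrightarrow> to_inv p \<in> inv_dom" by (simp add: src_points_def)
  show 1: "to_inv (to_inv p) = p" if "p \<in> inv_dom" for p
    using inv_dom_nz[OF that] q by (cases p) (simp add: to_inv_def)
  show 2: "to_inv p \<in> src_points" if "p \<in> inv_dom" for p
    using inv_dom_nz[OF that] q that 1[OF that] unfolding src_points_def by (cases p) (simp add: to_inv_def)
  show "to_inv (to_inv p) = p" if "p \<in> src_points" for p
    using that inv_dom_nz[of "to_inv p"] q unfolding src_points_def by (cases p) (simp add: to_inv_def)
qed

lemma to_inv'_points: "p \<in> tgt_points \<Longrightarrow> to_inv' p \<in> inv_dom" "p \<in> inv_dom \<Longrightarrow> of_inv' p \<in> tgt_points"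
  "p \<in> tgt_points \<Longrightarrow> of_inv' (to_inv' p) = p" "p \<in> inv_dom \<Longrightarrow> to_inv' (of_inv' p) = p"
proof -
  show "p \<in> tgt_points \<Longrightarrow> to_inv' p \<in> inv_dom" by (simp add: tgt_points_def)
  show 1: "to_inv' (of_inv' p) = p" if "p \<in> inv_dom" for p
    using inv_dom_nz[OF that] q src.nz by (cases p) (simp add: to_inv'_def of_inv'_def)
  show 2: "of_inv' p \<in> tgt_points" if "p \<in> inv_dom" for p
    using inv_dom_nz[OF that] q src.nz that 1[OF that] unfolding tgt_points_def
    by (cases p) (simp add: of_inv'_def)
  show "of_inv' (to_inv' p) = p" if "p \<in> tgt_points" for p
    using that inv_dom_nz[of "to_inv' p"] q src.nz unfolding tgt_points_def
    by (cases p) (simp add: to_inv'_def of_inv'_def)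
qed

definition shift_map :: "complex \<times> complex \<Rightarrow> complex \<times> complex" where
  "shift_map p = of_inv' (invol (to_inv p))"

definition shift_inv :: "complex \<times> complex \<Rightarrow> complex \<times> complex" where
  "shift_inv p = to_inv (invol (to_inv' p))"

lemma shift_map_points: "p \<in> src_points \<Longrightarrow> shift_map p \<in> tgt_points"
  and shift_inv_map: "p \<in> src_points \<Longrightarrow> shift_inv (shift_map p) = p"
  by (simp_all add: shift_map_def shift_inv_def to_inv_points to_inv'_points invol_invol)

lemma shift_inv_points: "p \<in> tgt_points \<Longrightarrow> shift_inv p \<in> src_points"
  and shift_map_inv: "p \<in> tgt_points \<Longrightarrow> shift_map (shift_inv p) = p"
  by (simp_all add: shift_map_def shift_inv_def to_inv_points to_inv'_points invol_invol)

lemma src_points_regular: "src_points \<subseteq> src.regular_points"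
  using inv_dom_nz by (fastforce simp: src_points_def src.regular_points_def to_inv_def)

lemma tgt_points_regular: "tgt_points \<subseteq> tgt.regular_points"
  using inv_dom_nz by (fastforce simp: tgt_points_def tgt.regular_points_def to_inv'_def)


section \<open>Agreement of the involution with S, T and the product formula\<close>

section \<open>The formulas\<close>

abbreviation "S \<equiv> S_poly q \<kappa>1 \<kappa>2 \<theta>1 \<theta>2 c1 c2 c3 c4"
abbreviation "T \<equiv> T_poly q \<kappa>1 \<kappa>2 \<theta>1 \<theta>2 c1 c2 c3 c4"

lemma lin_to_inv:
  assumes "y \<noteq> 0" "\<xi> \<noteq> 0" "y \<noteq> c1" "y \<noteq> c2" "n = q * (y - c1) * (y - c2) / \<xi>"
  shows "y * \<xi> * lin1 y n = q * (y - c1) * (y - c2) - \<xi> * (\<kappa>2 * y^2 + q * \<theta>1)"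
    "y * lin2 y n = \<kappa>1 * \<kappa>2 * \<xi> * (y - c3) * (y - c4) - q * \<kappa>1 * y^2 - \<theta>2"
proof -
  show "y * \<xi> * lin1 y n = q * (y - c1) * (y - c2) - \<xi> * (\<kappa>2 * y^2 + q * \<theta>1)"
    using assms(1,2) unfolding assms(5) lin1_def by (simp add: field_simps)
  have "tgt.K y / n = \<kappa>1 * \<kappa>2 * \<xi> * (y - c3) * (y - c4)"
    using assms q unfolding tgt.K_def by simp
  then show "y * lin2 y n = \<kappa>1 * \<kappa>2 * \<xi> * (y - c3) * (y - c4) - q * \<kappa>1 * y^2 - \<theta>2"
    using assms(1) by (simp add: lin2_def)
qed

text \<open>S and T are \<open>L0\<close> and \<open>L1\<close> with their common denominator y
  \<xi> cleared; hence S / (y T) is the other root.\<close>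

lemma ST_eq:
  assumes "y \<noteq> 0" "\<xi> \<noteq> 0" "y \<noteq> c1" "y \<noteq> c2" "n = q * (y - c1) * (y - c2) / \<xi>"
  shows "S y \<xi> = y * \<xi> * L0 (lin1 y n) (lin2 y n)" "T y \<xi> = y * \<xi> * L1 (lin1 y n) (lin2 y n)"
  using lin_to_inv[OF assms] unfolding S_poly_def T_poly_def Let_def L0_def L1_def by algebra+

text \<open>For the roots r, s of N, compute K(r) K(s) twice. Grouped by the c's it is a product of
  the values N(c_i); by \<open>factorization'\<close> it is a product of N(0) = q \<theta>1, N(y) =
  n and N at the other root.\<close>

lemma mid11_resultant:
  assumes "y \<noteq> 0" "n \<noteq> 0" "L1 (lin1 y n) (lin2 y n) \<noteq> 0"
  defines "d \<equiv> lin1 y n" and "l \<equiv> L1 (lin1 y n) (lin2 y n)"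
  shows "l^2 * \<theta>1 * n * mid11 d (other y n) = q * \<kappa>1^2 * \<kappa>2 * (mid11 d c1 * mid11 d c2 * mid11 d c3 * mid11 d c4)"
proof -
  obtain r s where rs: "\<And>z. \<kappa>2 * z^2 + d * z + q * \<theta>1 = \<kappa>2 * (z - r) * (z - s)"
    using split_quadratic[OF src.nz(2)] by blast
  have N: "mid11 d z = \<kappa>2 * (z - r) * (z - s)" for z by (simp add: mid11_def rs)
  define x where "x = other y n"
  have z: "mid11 d r = 0" "mid11 d s = 0" by (simp_all add: N)
  note fac = factorization'[OF assms(1-3), folded d_def l_def x_def]
  have K: "tgt.K r = l * r * (r - y) * (r - x)" "tgt.K s = l * s * (s - y) * (s - x)"
    using fac[of r] fac[of s] unfolding z by (simp_all only: mult_zero_left diff_zero)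
  have "r * s * \<kappa>2 = q * \<theta>1" using rs[of 0] by simp
  moreover have "\<kappa>2 * (y - r) * (y - s) = n"
    using mid11_lin1[OF assms(1), of n] unfolding N[symmetric] d_def .
  ultimately have "l^2 * (q * \<theta>1) * n * mid11 d x
      = l^2 * (r * s * \<kappa>2) * (\<kappa>2 * (y - r) * (y - s)) * (\<kappa>2 * (x - r) * (x - s))"
    unfolding N by simp
  also have "\<dots> = \<kappa>2^3 * (tgt.K r * tgt.K s)" unfolding K by algebra
  also have "\<dots> = q * (q * \<kappa>1^2 * \<kappa>2 * (mid11 d c1 * mid11 d c2 * mid11 d c3 * mid11 d c4))"
    unfolding N tgt.K_def by algebra
  finally have "q * (l^2 * \<theta>1 * n * mid11 d x) = q * (q * \<kappa>1^2 * \<kappa>2 * (mid11 d c1 * mid11 d c2 * mid11 d c3 * mid11 d c4))"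
    by (simp only: mult.assoc mult.left_commute)
  then show ?thesis using q unfolding x_def by simp
qed

text \<open>N takes the value n at y, and n carries the factors y - c1 and y - c2. Therefore y - c1
  divides the cleared N(c1) and y - c2 the cleared N(c2), leaving the two factors of
  \<open>xi_num\<close>.\<close>

lemma mid11_factor:
  assumes "y \<noteq> 0" "\<xi> \<noteq> 0" "y \<noteq> c1" "y \<noteq> c2" "n = q * (y - c1) * (y - c2) / \<xi>"
  shows "y * \<xi> * mid11 (lin1 y n) c1 =
      - c1 * \<kappa>2 * (y - c1) * (\<xi> * (y - q * \<theta>1 / (c1 * \<kappa>2)) - q / \<kappa>2 * (y - c2))"
    "y * \<xi> * mid11 (lin1 y n) c2 =
      - c2 * \<kappa>2 * (y - c2) * (\<xi> * (y - q * \<theta>1 / (c2 * \<kappa>2)) - q / \<kappa>2 * (y - c1))"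
proof -
  have e: "c * \<kappa>2 * (\<xi> * (y - q * \<theta>1 / (c * \<kappa>2)) - q / \<kappa>2 * x)
      = c * \<kappa>2 * \<xi> * y - \<xi> * q * \<theta>1 - q * c * x" if "c \<noteq> 0" for c x
    using that src.nz by (simp add: field_simps)
  note l = lin_to_inv(1)[OF assms]
  show "y * \<xi> * mid11 (lin1 y n) c1 =
      - c1 * \<kappa>2 * (y - c1) * (\<xi> * (y - q * \<theta>1 / (c1 * \<kappa>2)) - q / \<kappa>2 * (y - c2))"
    using l e[OF c_nonzero(1), of "y - c2"] unfolding mid11_def by algebra
  show "y * \<xi> * mid11 (lin1 y n) c2 =
      - c2 * \<kappa>2 * (y - c2) * (\<xi> * (y - q * \<theta>1 / (c2 * \<kappa>2)) - q / \<kappa>2 * (y - c1))"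
    using l e[OF c_nonzero(2), of "y - c1"] unfolding mid11_def by algebra
qed

text \<open>The counterpart for Y, whose value at y carries y - c3 and y - c4; what is left are the
  two factors of \<open>xi_den\<close>.\<close>

lemma mid22_factor:
  assumes "y \<noteq> 0" "\<xi> \<noteq> 0" "y \<noteq> c1" "y \<noteq> c2" "n = q * (y - c1) * (y - c2) / \<xi>"
  shows "y * mid22 (lin2 y n) c3 =
      - c3 * \<kappa>1 * \<kappa>2 * (c3 - y) * (\<xi> * (y - c4) - q / \<kappa>2 * (y - \<theta>2 / (q * c3 * \<kappa>1)))"
    "y * mid22 (lin2 y n) c4 =
      - c4 * \<kappa>1 * \<kappa>2 * (c4 - y) * (\<xi> * (y - c3) - q / \<kappa>2 * (y - \<theta>2 / (q * c4 * \<kappa>1)))"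
proof -
  have e: "c * \<kappa>1 * \<kappa>2 * (\<xi> * x - q / \<kappa>2 * (y - \<theta>2 / (q * c * \<kappa>1)))
      = c * \<kappa>1 * \<kappa>2 * \<xi> * x - q * c * \<kappa>1 * y + \<theta>2" if "c \<noteq> 0" for c x
    using that src.nz q by (simp add: field_simps)
  note l = lin_to_inv(2)[OF assms]
  show "y * mid22 (lin2 y n) c3 =
      - c3 * \<kappa>1 * \<kappa>2 * (c3 - y) * (\<xi> * (y - c4) - q / \<kappa>2 * (y - \<theta>2 / (q * c3 * \<kappa>1)))"
    using l e[OF c_nonzero(3), of "y - c4"] unfolding mid22_def by algebra
  show "y * mid22 (lin2 y n) c4 =
      - c4 * \<kappa>1 * \<kappa>2 * (c4 - y) * (\<xi> * (y - c3) - q / \<kappa>2 * (y - \<theta>2 / (q * c4 * \<kappa>1)))"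
    using l e[OF c_nonzero(4), of "y - c3"] unfolding mid22_def by algebra
qed

text \<open>In the resultant, N(c1) and N(c2) yield the numerator. N(c3) and N(c4) are traded for
  Y(c3) and Y(c4) by the factorization of K - N Y at c3 and c4, which gives the denominator together
  with the factors x - c3 and x - c4 required by \<open>of_inv'\<close>.\<close>

lemma phi_formula_eq:
  assumes "(y, \<xi>) \<in> src_points"
  shows "phi_formula q \<kappa>1 \<kappa>2 \<theta>1 \<theta>2 c1 c2 c3 c4 (y, \<xi>) = shift_map (y, \<xi>)"
    "T y \<xi> \<noteq> 0" "xi_den q \<kappa>1 \<kappa>2 \<theta>2 c3 c4 y \<xi> \<noteq> 0"
proof -
  define n where "n = q * (y - c1) * (y - c2) / \<xi>"
  define d where "d = lin1 y n"
  define e where "e = lin2 y n"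
  define l where "l = L1 d e"
  define x where "x = other y n"
  have D: "(y, n) \<in> inv_dom" "\<xi> \<noteq> 0" using assms by (auto simp: src_points_def to_inv_def n_def)
  have h: "y \<noteq> 0" "y \<noteq> c1" "y \<noteq> c2" "y \<noteq> c3" "y \<noteq> c4" "n \<noteq> 0" using inv_dom_nz[OF D(1)] by auto
  have lx: "l \<noteq> 0" "L0 d e \<noteq> 0" "x \<noteq> c1" "x \<noteq> c2" "x \<noteq> c3" "x \<noteq> c4"
    using D(1) by (auto simp: inv_dom_def l_def d_def e_def x_def K_nonzero_iff)
  note ass = h(1) D(2) h(2,3) n_def
  note ST = ST_eq[OF ass, folded d_def e_def, folded l_def]
  show "T y \<xi> \<noteq> 0" using ST(2) lx h D by simp
  have x: "S y \<xi> / (y * T y \<xi>) = x"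
    unfolding ST x_def other_def d_def[symmetric] e_def[symmetric] l_def[symmetric]
    using h D lx by simp
  note fac = factorization'[OF h(1,6) lx(1)[unfolded l_def d_def e_def], folded d_def e_def,
      folded l_def x_def]
  define g3 where "g3 = \<xi> * (y - c4) - q / \<kappa>2 * (y - \<theta>2 / (q * c3 * \<kappa>1))"
  define g4 where "g4 = \<xi> * (y - c3) - q / \<kappa>2 * (y - \<theta>2 / (q * c4 * \<kappa>1))"
  define f1 where "f1 = \<xi> * (y - q * \<theta>1 / (c1 * \<kappa>2)) - q / \<kappa>2 * (y - c2)"
  define f2 where "f2 = \<xi> * (y - q * \<theta>1 / (c2 * \<kappa>2)) - q / \<kappa>2 * (y - c1)"
  note Y = mid22_factor[OF ass, folded g3_def g4_def e_def]
  note N = mid11_factor[OF ass, folded f1_def f2_def d_def]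
  note res = mid11_resultant[OF h(1,6) lx(1)[unfolded l_def d_def e_def], folded d_def e_def,
      folded l_def x_def]
  have K0: "tgt.K c3 = 0" "tgt.K c4 = 0" by (simp_all add: tgt.K_def)
  have NY: "- (mid11 d c3 * mid22 e c3) = l * c3 * (c3 - y) * (c3 - x)"
    "- (mid11 d c4 * mid22 e c4) = l * c4 * (c4 - y) * (c4 - x)"
    using fac[of c3] fac[of c4] unfolding K0 by (simp_all only: diff_0)
  have "l * c3 * (c3 - y) * (c3 - x) \<noteq> 0" "l * c4 * (c4 - y) * (c4 - x) \<noteq> 0"
    using c_nonzero lx h by simp_all
  then have Y34: "mid22 e c3 \<noteq> 0" "mid22 e c4 \<noteq> 0" unfolding NY[symmetric] by simp_all
  have den: "xi_den q \<kappa>1 \<kappa>2 \<theta>2 c3 c4 y \<xi> = g3 * g4"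
    by (simp add: xi_den_def g3_def g4_def)
  have num: "xi_num q \<kappa>2 \<theta>1 c1 c2 y \<xi> = f1 * f2"
    by (simp add: xi_num_def f1_def f2_def)
  have g: "g3 \<noteq> 0" "g4 \<noteq> 0"
  proof -
    have "y * mid22 e c3 \<noteq> 0" "y * mid22 e c4 \<noteq> 0" using Y34 h(1) by simp_all
    then show "g3 \<noteq> 0" "g4 \<noteq> 0" unfolding Y by simp_all
  qed
  then show "xi_den q \<kappa>1 \<kappa>2 \<theta>2 c3 c4 y \<xi> \<noteq> 0" by (simp add: den)
  \<comment> \<open>The trade at one zero c of K: the factor \<open>g\<close> is Y(c) up to known
    constants, so N(c) g is a multiple of c - x.\<close>
  have cancel: "mid11 d c * \<kappa>1 * \<kappa>2 * g = y * l * (c - x)"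
    if "- (mid11 d c * mid22 e c) = l * c * (c - y) * (c - x)"
      "y * mid22 e c = - c * \<kappa>1 * \<kappa>2 * (c - y) * g" "c \<noteq> 0" "c \<noteq> y" for c g
  proof -
    have "(- c * (c - y)) * (mid11 d c * \<kappa>1 * \<kappa>2 * g) = mid11 d c * (y * mid22 e c)"
      unfolding that(2) by algebra
    also have "\<dots> = - y * - (mid11 d c * mid22 e c)" by simp
    also have "\<dots> = (- c * (c - y)) * (y * l * (c - x))" unfolding that(1) by algebra
    finally show ?thesis using that(3,4) by simp
  qed
  have "mid11 d c3 * \<kappa>1 * \<kappa>2 * g3 = y * l * (c3 - x)" "mid11 d c4 * \<kappa>1 * \<kappa>2 * g4 = y * l * (c4 - x)"
    by (rule cancel[OF NY(1) Y(1) c_nonzero(3) h(4)[symmetric]],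
        rule cancel[OF NY(2) Y(2) c_nonzero(4) h(5)[symmetric]])
  note e = this
  have A: "(y * l)^2 * ((x - c3) * (x - c4)) = mid11 d c3 * mid11 d c4 * (\<kappa>1 * \<kappa>2)^2 * (g3 * g4)"
  proof -
    have "(y * l)^2 * ((x - c3) * (x - c4)) = (y * l * (c3 - x)) * (y * l * (c4 - x))" by algebra
    also have "\<dots> = mid11 d c3 * mid11 d c4 * (\<kappa>1 * \<kappa>2)^2 * (g3 * g4)" unfolding e[symmetric] by algebra
    finally show ?thesis .
  qed
  have "(y * \<xi>)^2 * (mid11 d c1 * mid11 d c2) = (y * \<xi> * mid11 d c1) * (y * \<xi> * mid11 d c2)" by algebra
  also have "\<dots> = c1 * c2 * \<kappa>2^2 * ((y - c1) * (y - c2)) * (f1 * f2)" unfolding N by algebra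
  finally have B: "(y * \<xi>)^2 * (mid11 d c1 * mid11 d c2) = c1 * c2 * \<kappa>2^2 * ((y - c1) * (y - c2)) * (f1 * f2)" .
  have n: "n * \<xi> = q * ((y - c1) * (y - c2))" using D(2) by (simp add: n_def)
  have "(y * l)^2 * \<xi>^2 * n * (\<theta>1 * mid11 d x) = (y * \<xi>)^2 * (l^2 * \<theta>1 * n * mid11 d x)" by algebra
  also have "\<dots> = q * \<kappa>1^2 * \<kappa>2 * ((y * \<xi>)^2 * (mid11 d c1 * mid11 d c2)) * (mid11 d c3 * mid11 d c4)"
    unfolding res by algebra
  also have "\<dots> = q * \<kappa>1^2 * \<kappa>2 * (c1 * c2 * \<kappa>2^2 * ((y - c1) * (y - c2)) * (f1 * f2)) * (mid11 d c3 * mid11 d c4)"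
    unfolding B ..
  also have "\<dots> = \<kappa>2 * (c1 * c2) * (n * \<xi>) * (f1 * f2) * (mid11 d c3 * mid11 d c4 * (\<kappa>1 * \<kappa>2)^2)"
    unfolding n by algebra
  finally have C: "(y * l)^2 * \<xi>^2 * n * (\<theta>1 * mid11 d x) =
    \<kappa>2 * (c1 * c2) * (n * \<xi>) * (f1 * f2) * (mid11 d c3 * mid11 d c4 * (\<kappa>1 * \<kappa>2)^2)" .
  \<comment> \<open>Multiplying the resultant identity by \<open>g3 * g4\<close> completes the
    product N(c3) N(c4) g3 g4, which the identity \<open>A\<close> replaces by (x - c3)(x -
    c4).\<close>
  have "((y * l)^2 * \<xi> * n) * (\<theta>1 * \<xi> * mid11 d x * (g3 * g4))
      = ((y * l)^2 * \<xi>^2 * n * (\<theta>1 * mid11 d x)) * (g3 * g4)" by algebra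
  also have "\<dots> = (\<kappa>2 * (c1 * c2) * (n * \<xi>) * (f1 * f2)) * (mid11 d c3 * mid11 d c4 * (\<kappa>1 * \<kappa>2)^2 * (g3 * g4))"
    unfolding C by algebra
  also have "\<dots> = ((y * l)^2 * \<xi> * n) * (\<kappa>2 * (c1 * c2) * (f1 * f2) * ((x - c3) * (x - c4)))"
    unfolding A[symmetric] by algebra
  finally have E: "\<theta>1 * \<xi> * mid11 d x * (g3 * g4) = \<kappa>2 * (c1 * c2) * (f1 * f2) * ((x - c3) * (x - c4))"
    using h lx D by simp
  have nz: "q * \<kappa>1 * \<kappa>2 * (x - c3) * (x - c4) \<noteq> 0" "q * \<kappa>1 * \<theta>1 * \<xi> * (g3 * g4) \<noteq> 0"
    using q src.nz lx D g by simp_all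
  have "mid11 d x * (q * \<kappa>1 * \<theta>1 * \<xi> * (g3 * g4)) = q * \<kappa>1 * (\<theta>1 * \<xi> * mid11 d x * (g3 * g4))" by algebra
  also have "\<dots> = c1 * c2 * (f1 * f2) * (q * \<kappa>1 * \<kappa>2 * (x - c3) * (x - c4))"
    unfolding E by algebra
  finally have eq: "mid11 d x * (q * \<kappa>1 * \<theta>1 * \<xi> * (g3 * g4)) =
    c1 * c2 * (f1 * f2) * (q * \<kappa>1 * \<kappa>2 * (x - c3) * (x - c4))" .
  have "mid11 d x / (q * \<kappa>1 * \<kappa>2 * (x - c3) * (x - c4)) = c1 * c2 * (f1 * f2) / (q * \<kappa>1 * \<theta>1 * \<xi> * (g3 * g4))"
    using eq unfolding frac_eq_eq[OF nz] .
  then show "phi_formula q \<kappa>1 \<kappa>2 \<theta>1 \<theta>2 c1 c2 c3 c4 (y, \<xi>) = shift_map (y, \<xi>)"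
    unfolding phi_formula_def shift_map_def to_inv_def prod.case n_def[symmetric] invol_def of_inv'_def
      d_def[symmetric] x_def[symmetric] x num den times_divide_times_eq by (rule arg_cong[OF sym])
qed

end


section \<open>Polynomial functions, principal open domains and regularity\<close>

section \<open>Polynomial functions of two variables\<close>

text \<open>Being polynomial as a property of the function: closure rules then follow the shape of
  an expression, and no coefficients have to be exhibited.\<close>

definition polyfun2 :: "(complex \<times> complex \<Rightarrow> complex) \<Rightarrow> bool" where
  "polyfun2 f \<longleftrightarrow> (\<exists>h. \<forall>p. eval2 h p = f p)"

lemma polyfun2_const: "polyfun2 (\<lambda>p. c)"
  unfolding polyfun2_def by (rule exI[of _ "[:[:c:]:]"]) (simp add: eval2_def)

lemma polyfun2_fst: "polyfun2 (\<lambda>p. fst p)"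
  unfolding polyfun2_def by (rule exI[of _ "[:[:0, 1:]:]"]) (simp add: eval2_def)

lemma polyfun2_snd: "polyfun2 (\<lambda>p. snd p)"
  unfolding polyfun2_def by (rule exI[of _ "[:0, 1:]"]) (simp add: eval2_def)

lemma polyfun2_add: "polyfun2 f \<Longrightarrow> polyfun2 g \<Longrightarrow> polyfun2 (\<lambda>p. f p + g p)"
  unfolding polyfun2_def eval2_def by (metis poly_add)

lemma polyfun2_mult: "polyfun2 f \<Longrightarrow> polyfun2 g \<Longrightarrow> polyfun2 (\<lambda>p. f p * g p)"
  unfolding polyfun2_def eval2_def by (metis poly_mult)

lemma polyfun2_diff: "polyfun2 f \<Longrightarrow> polyfun2 g \<Longrightarrow> polyfun2 (\<lambda>p. f p - g p)"
  unfolding polyfun2_def eval2_def by (metis poly_diff)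

lemma polyfun2_minus: "polyfun2 f \<Longrightarrow> polyfun2 (\<lambda>p. - f p)"
  unfolding polyfun2_def eval2_def by (metis poly_minus)

lemma polyfun2_power: "polyfun2 f \<Longrightarrow> polyfun2 (\<lambda>p. f p ^ k)"
  unfolding polyfun2_def eval2_def by (metis poly_power)

lemmas polyfun2_intros = polyfun2_const polyfun2_fst polyfun2_snd polyfun2_add polyfun2_mult
  polyfun2_diff polyfun2_minus polyfun2_power

lemma continuous_eval2: "continuous_on UNIV (eval2 h)"
proof -
  have "continuous_on UNIV (\<lambda>p :: complex \<times> complex. poly (poly h [:snd p:]) (fst p))"
    by (induction h) (auto intro!: continuous_intros continuous_on_poly)
  then show ?thesis by (simp add: eval2_def[abs_def])
qed

lemma open_polyfun2:
  assumes "polyfun2 f"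
  shows "open {p. f p \<noteq> 0}"
proof -
  obtain h where "\<And>p. eval2 h p = f p" using assms by (auto simp: polyfun2_def)
  then have "{p. f p \<noteq> 0} = eval2 h -` (- {0})" by auto
  then show ?thesis
    using open_vimage[OF _ continuous_eval2, of "- {0}" h] by (simp add: open_Compl)
qed

lemma zariski_open_polyfun2:
  assumes "polyfun2 f"
  shows "zariski_open {p. f p \<noteq> 0}"
proof -
  obtain h where "\<And>p. eval2 h p = f p" using assms by (auto simp: polyfun2_def)
  then show ?thesis unfolding zariski_open_def by (intro exI[of _ "{h}"]) simp
qed

lemma regular_map_onI:
  assumes "polyfun2 f1" "polyfun2 g1" "polyfun2 f2" "polyfun2 g2"
    and "\<And>p. p \<in> U \<Longrightarrow> g1 p \<noteq> 0 \<and> g2 p \<noteq> 0 \<and> F p = (f1 p / g1 p, f2 p / g2 p)"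
  shows "regular_map_on U F"
proof -
  obtain h1 k1 h2 k2 where "\<And>p. eval2 h1 p = f1 p" "\<And>p. eval2 k1 p = g1 p"
    "\<And>p. eval2 h2 p = f2 p" "\<And>p. eval2 k2 p = g2 p"
    using assms(1-4) by (auto simp: polyfun2_def)
  then show ?thesis unfolding regular_map_on_def using assms(5)
    by (intro exI[of _ h1] exI[of _ k1] exI[of _ h2] exI[of _ k2]) simp
qed

context shift_params
begin

abbreviation "formula \<equiv> phi_formula q \<kappa>1 \<kappa>2 \<theta>1 \<theta>2 c1 c2 c3 c4"

lemma formula_eq_shift_map: "p \<in> src_points \<Longrightarrow> formula p = shift_map p"
  using phi_formula_eq(1) by (cases p) simp

lemma bij_betw_formula: "bij_betw formula src_points tgt_points"
  by (rule bij_betw_byWitness[where f' = shift_inv])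
    (auto simp: formula_eq_shift_map shift_inv_map shift_map_inv shift_map_points shift_inv_points)

lemma the_inv_into_formula: "p \<in> tgt_points \<Longrightarrow> the_inv_into src_points formula p = shift_inv p"
  by (rule the_inv_into_f_eq)
    (use bij_betw_formula in \<open>auto simp: bij_betw_def formula_eq_shift_map shift_map_inv shift_inv_points\<close>)

definition prod_c :: "complex \<Rightarrow> complex" where
  "prod_c y = (y - c1) * (y - c2) * (y - c3) * (y - c4)"

text \<open>The condition K nonzero at the other root, with the denominator y \<open>L1\<close>
  cleared separately for each zero of K.\<close>

lemma inv_dom_iff:
  "(y, n) \<in> inv_dom \<longleftrightarrow> y \<noteq> 0 \<and> n \<noteq> 0 \<and> prod_c y \<noteq> 0 \<and> L1 (lin1 y n) (lin2 y n) \<noteq> 0 \<and>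
     L0 (lin1 y n) (lin2 y n) \<noteq> 0 \<and>
     (\<forall>c\<in>{c1, c2, c3, c4}. L0 (lin1 y n) (lin2 y n) - c * y * L1 (lin1 y n) (lin2 y n) \<noteq> 0)"
proof (cases "y \<noteq> 0 \<and> L1 (lin1 y n) (lin2 y n) \<noteq> 0")
  case True
  have "other y n \<noteq> c \<longleftrightarrow> L0 (lin1 y n) (lin2 y n) - c * y * L1 (lin1 y n) (lin2 y n) \<noteq> 0" for c
    using True unfolding other_def by (simp add: divide_eq_eq mult.assoc)
  then show ?thesis using True by (simp add: inv_dom_def K_nonzero_iff prod_c_def)
qed (auto simp: inv_dom_def)

text \<open>Since S and T differ from \<open>L0\<close> and \<open>L1\<close> by the nonzero factor
  y \<xi>, all conditions together say that one polynomial does not vanish: the domain is a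
  principal open set.\<close>

lemma src_points_eq: "src_points = {p. fst p * snd p * prod_c (fst p) * S (fst p) (snd p) * T (fst p) (snd p) *
    (\<Prod>c\<leftarrow>[c1, c2, c3, c4]. S (fst p) (snd p) - c * fst p * T (fst p) (snd p)) \<noteq> 0}"
  (is "_ = {p. ?f p \<noteq> 0}")
proof -
  have "(y, \<xi>) \<in> src_points \<longleftrightarrow> ?f (y, \<xi>) \<noteq> 0" for y \<xi>
  proof (cases "y \<noteq> 0 \<and> \<xi> \<noteq> 0 \<and> y \<noteq> c1 \<and> y \<noteq> c2")
    case True
    define n where "n = q * (y - c1) * (y - c2) / \<xi>"
    have ass: "y \<noteq> 0" "\<xi> \<noteq> 0" "y \<noteq> c1" "y \<noteq> c2" using True by auto
    note ST = ST_eq[OF ass n_def]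
    have "S y \<xi> - c * y * T y \<xi> = y * \<xi> * (L0 (lin1 y n) (lin2 y n) - c * y * L1 (lin1 y n) (lin2 y n))" for c
      unfolding ST by algebra
    moreover have "n \<noteq> 0" using ass q by (simp add: n_def)
    ultimately show ?thesis
      using ass by (simp add: src_points_def to_inv_def n_def[symmetric] inv_dom_iff ST) blast
  next
    case False
    then show ?thesis using inv_dom_nz[of "to_inv (y, \<xi>)"] by (auto simp: src_points_def to_inv_def prod_c_def)
  qed
  then show ?thesis by auto
qed

text \<open>\<open>Sn\<close> and \<open>Tn\<close> are \<open>L0\<close> and \<open>L1\<close>
  times y n, polynomials in (y, n). They do for the inverse map what S and T do for the map.\<close>

definition Sn :: "complex \<Rightarrow> complex \<Rightarrow> complex" where
  "Sn y n = - (q * \<kappa>1 * \<kappa>2 * (c1*c2*c3 + c1*c2*c4 + c1*c3*c4 + c2*c3*c4) * y * n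
    + \<theta>2 * (n^2 - (\<kappa>2 * y^2 + q * \<theta>1) * n) + q * \<theta>1 * (q * \<kappa>1 * \<kappa>2 * prod_c y - (q * \<kappa>1 * y^2 + \<theta>2) * n))"

definition Tn :: "complex \<Rightarrow> complex \<Rightarrow> complex" where
  "Tn y n = - (q * \<kappa>1 * \<kappa>2 * (c1 + c2 + c3 + c4) * y * n
    + \<kappa>2 * (q * \<kappa>1 * \<kappa>2 * prod_c y - (q * \<kappa>1 * y^2 + \<theta>2) * n)
    + q * \<kappa>1 * (n^2 - (\<kappa>2 * y^2 + q * \<theta>1) * n))"

lemma STn_eq:
  assumes "y \<noteq> 0" "n \<noteq> 0"
  shows "Sn y n = y * n * L0 (lin1 y n) (lin2 y n)" "Tn y n = y * n * L1 (lin1 y n) (lin2 y n)"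
proof -
  have 1: "y * n * lin1 y n = n^2 - (\<kappa>2 * y^2 + q * \<theta>1) * n"
  proof -
    have "y * lin1 y n = n - \<kappa>2 * y^2 - q * \<theta>1" using assms by (simp add: lin1_def)
    then show ?thesis by algebra
  qed
  have 2: "y * n * lin2 y n = q * \<kappa>1 * \<kappa>2 * prod_c y - (q * \<kappa>1 * y^2 + \<theta>2) * n"
  proof -
    have K: "tgt.K y = q * \<kappa>1 * \<kappa>2 * prod_c y" by (simp add: tgt.K_def prod_c_def mult.assoc)
    have "y * lin2 y n = tgt.K y / n - q * \<kappa>1 * y^2 - \<theta>2" using assms by (simp add: lin2_def)
    then have "n * (y * lin2 y n) = n * (tgt.K y / n) - (q * \<kappa>1 * y^2 + \<theta>2) * n" by algebra
    then show ?thesis using assms by (simp add: K mult.assoc mult.left_commute)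
  qed
  show "Sn y n = y * n * L0 (lin1 y n) (lin2 y n)" "Tn y n = y * n * L1 (lin1 y n) (lin2 y n)"
    unfolding Sn_def Tn_def 1[symmetric] 2[symmetric] L0_def L1_def by algebra+
qed

lemma inv_dom_iff':
  "(y, n) \<in> inv_dom \<longleftrightarrow> y * n * prod_c y * Sn y n * Tn y n * (\<Prod>c\<leftarrow>[c1, c2, c3, c4]. Sn y n - c * y * Tn y n) \<noteq> 0"
proof (cases "y \<noteq> 0 \<and> n \<noteq> 0")
  case True
  have "Sn y n - c * y * Tn y n = y * n * (L0 (lin1 y n) (lin2 y n) - c * y * L1 (lin1 y n) (lin2 y n))" for c
    using True by (simp add: STn_eq) algebra
  then show ?thesis using True by (simp add: inv_dom_iff STn_eq) blast
qed (auto simp: inv_dom_def)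

lemma polyfun2_prod_c: "polyfun2 f \<Longrightarrow> polyfun2 (\<lambda>p. prod_c (f p))"
  unfolding prod_c_def by (intro polyfun2_intros)

lemma polyfun2_STn:
  assumes "polyfun2 f" "polyfun2 g"
  shows "polyfun2 (\<lambda>p. Sn (f p) (g p))" "polyfun2 (\<lambda>p. Tn (f p) (g p))"
  unfolding Sn_def Tn_def by (intro polyfun2_intros polyfun2_prod_c assms)+

lemma polyfun2_ST: "polyfun2 (\<lambda>p. S (fst p) (snd p))" "polyfun2 (\<lambda>p. T (fst p) (snd p))"
  unfolding S_poly_def T_poly_def Let_def by (intro polyfun2_intros)+

lemma polyfun2_src_points: "\<exists>f. polyfun2 f \<and> src_points = {p. f p \<noteq> 0}"
proof -
  have "polyfun2 (\<lambda>p. fst p * snd p * prod_c (fst p) * S (fst p) (snd p) * T (fst p) (snd p) *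
    (\<Prod>c\<leftarrow>[c1, c2, c3, c4]. S (fst p) (snd p) - c * fst p * T (fst p) (snd p)))"
    by (simp, intro polyfun2_intros polyfun2_prod_c polyfun2_ST)
  then show ?thesis using src_points_eq by blast
qed

lemma polyfun2_tgt_points: "\<exists>f. polyfun2 f \<and> tgt_points = {p. f p \<noteq> 0}"
proof -
  let ?n = "\<lambda>p. q * \<kappa>1 * \<kappa>2 * snd p * (fst p - c3) * (fst p - c4)"
  let ?f = "\<lambda>p. fst p * ?n p * prod_c (fst p) * Sn (fst p) (?n p) * Tn (fst p) (?n p) *
    (\<Prod>c\<leftarrow>[c1, c2, c3, c4]. Sn (fst p) (?n p) - c * fst p * Tn (fst p) (?n p))"
  have n: "polyfun2 ?n" by (intro polyfun2_intros)
  have "polyfun2 (\<lambda>p. snd p * ?f p)"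
    by (simp, intro polyfun2_intros polyfun2_prod_c polyfun2_STn n)
  moreover have "tgt_points = {p. snd p * ?f p \<noteq> 0}"
    unfolding tgt_points_def to_inv'_def case_prod_beta inv_dom_iff' by simp
  ultimately show ?thesis by blast
qed

lemma regular_formula: "regular_map_on src_points formula"
proof (rule regular_map_onI)
  show "polyfun2 (\<lambda>p. S (fst p) (snd p))" by (rule polyfun2_ST)
  show "polyfun2 (\<lambda>p. fst p * T (fst p) (snd p))" by (intro polyfun2_intros polyfun2_ST)
  show "polyfun2 (\<lambda>p. c1 * c2 * xi_num q \<kappa>2 \<theta>1 c1 c2 (fst p) (snd p))"
    unfolding xi_num_def by (intro polyfun2_intros)
  show "polyfun2 (\<lambda>p. q * \<kappa>1 * \<theta>1 * snd p * xi_den q \<kappa>1 \<kappa>2 \<theta>2 c3 c4 (fst p) (snd p))"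
    unfolding xi_den_def by (intro polyfun2_intros)
  fix p assume p: "p \<in> src_points"
  obtain y \<xi> where yx: "p = (y, \<xi>)" by (cases p)
  have "y \<noteq> 0" "\<xi> \<noteq> 0" using p src_points_regular by (auto simp: yx src.regular_points_def)
  then show "fst p * T (fst p) (snd p) \<noteq> 0 \<and>
      q * \<kappa>1 * \<theta>1 * snd p * xi_den q \<kappa>1 \<kappa>2 \<theta>2 c3 c4 (fst p) (snd p) \<noteq> 0 \<and>
      formula p = (S (fst p) (snd p) / (fst p * T (fst p) (snd p)),
        c1 * c2 * xi_num q \<kappa>2 \<theta>1 c1 c2 (fst p) (snd p) /
        (q * \<kappa>1 * \<theta>1 * snd p * xi_den q \<kappa>1 \<kappa>2 \<theta>2 c3 c4 (fst p) (snd p)))"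
    using phi_formula_eq(2,3)[OF p[unfolded yx]] q src.nz by (simp add: yx phi_formula_def)
qed

text \<open>With the other root x written as s / t, numerator and denominator of q (x - c1)(x - c2)
  / N(x) are multiplied by t^2 y; the factor y clears the denominator inside
  \<open>lin1\<close>.\<close>

lemma regular_shift_inv: "regular_map_on tgt_points shift_inv"
proof -
  let ?n = "\<lambda>p. q * \<kappa>1 * \<kappa>2 * snd p * (fst p - c3) * (fst p - c4)"
  let ?S = "\<lambda>p. Sn (fst p) (?n p)" and ?T = "\<lambda>p. Tn (fst p) (?n p)"
  have n: "polyfun2 ?n" by (intro polyfun2_intros)
  note ST = polyfun2_STn[OF polyfun2_fst n]
  show ?thesis
  proof (rule regular_map_onI)
    show "polyfun2 ?S" "polyfun2 (\<lambda>p. fst p * ?T p)" by (intro polyfun2_intros ST)+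
    show "polyfun2 (\<lambda>p. q * fst p * (?S p - c1 * (fst p * ?T p)) * (?S p - c2 * (fst p * ?T p)))"
      by (intro polyfun2_intros ST)
    show "polyfun2 (\<lambda>p. \<kappa>2 * fst p * (?S p)^2
        + (?n p - \<kappa>2 * (fst p)^2 - q * \<theta>1) * ?S p * (fst p * ?T p)
        + q * \<theta>1 * fst p * (fst p * ?T p)^2)"
      by (intro polyfun2_intros ST n)
    fix p assume p: "p \<in> tgt_points"
    obtain y \<xi> where yx: "p = (y, \<xi>)" by (cases p)
    define n where "n = q * \<kappa>1 * \<kappa>2 * snd p * (y - c3) * (y - c4)"
    define x where "x = other y n"
    define s where "s = Sn y n"
    define t where "t = y * Tn y n"
    have D: "(y, n) \<in> inv_dom" using p by (simp add: tgt_points_def yx to_inv'_def n_def)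
    have h: "y \<noteq> 0" "n \<noteq> 0" using inv_dom_nz[OF D] by auto
    have i: "invol (y, n) = (x, mid11 (lin1 y n) x)" by (simp add: invol_def x_def)
    have N: "mid11 (lin1 y n) x \<noteq> 0" using inv_dom_nz[OF invol_invol(1)[OF D]] unfolding i by simp
    have t: "t \<noteq> 0" using D h by (simp add: t_def STn_eq inv_dom_def)
    have x: "x = s / t" using h by (simp add: x_def other_def s_def t_def STn_eq)
    have e: "n - \<kappa>2 * y^2 - q * \<theta>1 = y * lin1 y n" using h by (simp add: lin1_def)
    have "\<kappa>2 * y * s^2 + (n - \<kappa>2 * y^2 - q * \<theta>1) * s * t + q * \<theta>1 * y * t^2
        = (\<kappa>2 * s^2 + lin1 y n * s * t + q * \<theta>1 * t^2) * y" unfolding e by algebra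
    also have "\<kappa>2 * s^2 + lin1 y n * s * t + q * \<theta>1 * t^2 = mid11 (lin1 y n) x * t^2"
      using t unfolding x mid11_def by (simp add: field_simps power2_eq_square)
    finally have den: "\<kappa>2 * y * s^2 + (n - \<kappa>2 * y^2 - q * \<theta>1) * s * t + q * \<theta>1 * y * t^2
      = mid11 (lin1 y n) x * t^2 * y" .
    have "q * y * (s - c1 * t) * (s - c2 * t) = q * y * (x * t - c1 * t) * (x * t - c2 * t)"
      using t by (simp add: x)
    also have "\<dots> = q * (x - c1) * (x - c2) * (t^2 * y)" by algebra
    finally have num: "q * y * (s - c1 * t) * (s - c2 * t) = q * (x - c1) * (x - c2) * (t^2 * y)" .
    have "to_inv' p = (y, n)" by (simp add: to_inv'_def yx n_def)
    then have "shift_inv p = (s / t, q * (x - c1) * (x - c2) / mid11 (lin1 y n) x)"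
      unfolding shift_inv_def by (simp add: i to_inv_def x)
    also have "q * (x - c1) * (x - c2) / mid11 (lin1 y n) x
        = q * y * (s - c1 * t) * (s - c2 * t) /
          (\<kappa>2 * y * s^2 + (n - \<kappa>2 * y^2 - q * \<theta>1) * s * t + q * \<theta>1 * y * t^2)"
      unfolding num den using t h by simp
    finally have G: "shift_inv p = (s / t, q * y * (s - c1 * t) * (s - c2 * t) /
          (\<kappa>2 * y * s^2 + (n - \<kappa>2 * y^2 - q * \<theta>1) * s * t + q * \<theta>1 * y * t^2))" .
    have d0: "\<kappa>2 * y * s^2 + (n - \<kappa>2 * y^2 - q * \<theta>1) * s * t + q * \<theta>1 * y * t^2 \<noteq> 0"
      unfolding den using N t h by simp
    have f: "fst p = y" by (simp add: yx)
    show "fst p * ?T p \<noteq> 0 \<and> \<kappa>2 * fst p * (?S p)^2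
        + (?n p - \<kappa>2 * (fst p)^2 - q * \<theta>1) * ?S p * (fst p * ?T p)
        + q * \<theta>1 * fst p * (fst p * ?T p)^2 \<noteq> 0 \<and>
      shift_inv p = (?S p / (fst p * ?T p), q * fst p * (?S p - c1 * (fst p * ?T p)) * (?S p - c2 * (fst p * ?T p)) /
        (\<kappa>2 * fst p * (?S p)^2
        + (?n p - \<kappa>2 * (fst p)^2 - q * \<theta>1) * ?S p * (fst p * ?T p)
        + q * \<theta>1 * fst p * (fst p * ?T p)^2))"
      unfolding f unfolding n_def[symmetric] s_def[symmetric] t_def[symmetric] using t d0 G by blast
  qed
qed

text \<open>The quotients are the y at which the n^2 coefficient of
  \<open>Sn y n - c * y * Tn y n\<close> vanishes. Outside this set every condition excludes only
  the roots of a genuine quadratic in n, or n = 0.\<close>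

definition bad_y :: "complex set" where
  "bad_y = {0, c1, c2, c3, c4} \<union> (\<lambda>c. \<theta>2 / (q * \<kappa>1 * c)) ` {c1, c2, c3, c4}"

lemma finite_bad_y: "finite bad_y"
  by (simp add: bad_y_def)

lemma finite_fiber_inv_dom:
  assumes "y \<notin> bad_y"
  shows "finite {n. (y, n) \<notin> inv_dom}"
proof -
  have y: "y \<noteq> 0" "prod_c y \<noteq> 0" using assms by (auto simp: bad_y_def prod_c_def)
  define B0 where "B0 = - (q * \<kappa>1 * \<kappa>2 * (c1*c2*c3 + c1*c2*c4 + c1*c3*c4 + c2*c3*c4) * y
    - \<theta>2 * (\<kappa>2 * y^2 + q * \<theta>1) - q * \<theta>1 * (q * \<kappa>1 * y^2 + \<theta>2))"
  define B1 where "B1 = - (q * \<kappa>1 * \<kappa>2 * (c1 + c2 + c3 + c4) * y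
    - \<kappa>2 * (q * \<kappa>1 * y^2 + \<theta>2) - q * \<kappa>1 * (\<kappa>2 * y^2 + q * \<theta>1))"
  define C0 where "C0 = - (q * \<theta>1 * (q * \<kappa>1 * \<kappa>2 * prod_c y))"
  define C1 where "C1 = - (\<kappa>2 * (q * \<kappa>1 * \<kappa>2 * prod_c y))"
  have S: "Sn y n = - \<theta>2 * n^2 + B0 * n + C0" for n unfolding Sn_def B0_def C0_def by algebra
  have T: "Tn y n = - (q * \<kappa>1) * n^2 + B1 * n + C1" for n unfolding Tn_def B1_def C1_def by algebra
  have ST: "Sn y n - c * y * Tn y n = (c * y * q * \<kappa>1 - \<theta>2) * n^2 + (B0 - c * y * B1) * n + (C0 - c * y * C1)"
    for n c unfolding S T by algebra
  have "finite {n. Sn y n = 0}" unfolding S by (rule finite_quadratic_roots) (simp add: src.nz)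
  moreover have "finite {n. Tn y n = 0}" unfolding T by (rule finite_quadratic_roots) (simp add: src.nz q)
  moreover have "finite {n. Sn y n - c * y * Tn y n = 0}" if "c \<in> {c1, c2, c3, c4}" for c
    unfolding ST
  proof (rule finite_quadratic_roots)
    have "y \<noteq> \<theta>2 / (q * \<kappa>1 * c)" using assms that by (auto simp: bad_y_def)
    moreover have "q * \<kappa>1 * c \<noteq> 0" using that c_nonzero q src.nz by auto
    ultimately show "c * y * q * \<kappa>1 - \<theta>2 \<noteq> 0" by (simp add: eq_divide_eq mult.commute mult.left_commute)
  qed
  ultimately have "finite ({0} \<union> {n. Sn y n = 0} \<union> {n. Tn y n = 0} \<union>
      (\<Union>c\<in>{c1, c2, c3, c4}. {n. Sn y n - c * y * Tn y n = 0}))" by blast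
  then show ?thesis by (rule finite_subset[rotated]) (use y in \<open>auto simp: inv_dom_iff'\<close>)
qed

lemma finite_fiber_src:
  assumes "y \<notin> bad_y"
  shows "finite {\<xi>. (y, \<xi>) \<notin> src_points}"
proof -
  have y: "y \<noteq> c1" "y \<noteq> c2" using assms by (auto simp: bad_y_def)
  have "{\<xi>. (y, \<xi>) \<notin> src_points} \<subseteq> {0} \<union> (\<lambda>n. q * (y - c1) * (y - c2) / n) ` {n. (y, n) \<notin> inv_dom}"
  proof
    fix \<xi> assume \<xi>: "\<xi> \<in> {\<xi>. (y, \<xi>) \<notin> src_points}"
    have e: "\<xi> = q * (y - c1) * (y - c2) / (q * (y - c1) * (y - c2) / \<xi>)" using y q by simp
    have "\<xi> = 0 \<or> (y, q * (y - c1) * (y - c2) / \<xi>) \<notin> inv_dom"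
      using \<xi> by (auto simp: src_points_def to_inv_def)
    then show "\<xi> \<in> {0} \<union> (\<lambda>n. q * (y - c1) * (y - c2) / n) ` {n. (y, n) \<notin> inv_dom}"
    proof
      assume "(y, q * (y - c1) * (y - c2) / \<xi>) \<notin> inv_dom"
      then show ?thesis
        by (intro UnI2 image_eqI[where x = "q * (y - c1) * (y - c2) / \<xi>"]) (rule e, simp)
    qed simp
  qed
  then show ?thesis using finite_fiber_inv_dom[OF assms] by (simp add: finite_subset)
qed

lemma finite_fiber_tgt:
  assumes "y \<notin> bad_y"
  shows "finite {\<xi>. (y, \<xi>) \<notin> tgt_points}"
proof -
  have y: "y \<noteq> c3" "y \<noteq> c4" using assms by (auto simp: bad_y_def)
  have "{\<xi>. (y, \<xi>) \<notin> tgt_points} \<subseteq> {0} \<union> (\<lambda>n. n / (q * \<kappa>1 * \<kappa>2 * (y - c3) * (y - c4))) ` {n. (y, n) \<notin> inv_dom}"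
  proof
    fix \<xi> assume \<xi>: "\<xi> \<in> {\<xi>. (y, \<xi>) \<notin> tgt_points}"
    have e: "\<xi> = q * \<kappa>1 * \<kappa>2 * \<xi> * (y - c3) * (y - c4) / (q * \<kappa>1 * \<kappa>2 * (y - c3) * (y - c4))"
      using y q src.nz by simp
    have "\<xi> = 0 \<or> (y, q * \<kappa>1 * \<kappa>2 * \<xi> * (y - c3) * (y - c4)) \<notin> inv_dom"
      using \<xi> by (auto simp: tgt_points_def to_inv'_def)
    then show "\<xi> \<in> {0} \<union> (\<lambda>n. n / (q * \<kappa>1 * \<kappa>2 * (y - c3) * (y - c4))) ` {n. (y, n) \<notin> inv_dom}"
    proof
      assume "(y, q * \<kappa>1 * \<kappa>2 * \<xi> * (y - c3) * (y - c4)) \<notin> inv_dom"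
      then show ?thesis
        by (intro UnI2 image_eqI[where x = "q * \<kappa>1 * \<kappa>2 * \<xi> * (y - c3) * (y - c4)"]) (rule e, simp)
    qed simp
  qed
  then show ?thesis using finite_fiber_inv_dom[OF assms] by (simp add: finite_subset)
qed

lemma src_points_nonempty: "src_points \<noteq> {}"
proof -
  obtain y where y: "y \<notin> bad_y"
    using ex_new_if_finite[OF infinite_UNIV_char_0 finite_bad_y] by blast
  obtain \<xi> where "\<xi> \<notin> {\<xi>. (y, \<xi>) \<notin> src_points}"
    using ex_new_if_finite[OF infinite_UNIV_char_0 finite_fiber_src[OF y]] by blast
  then show ?thesis by blast
qed

lemma birational_formula: "birational_between src_points tgt_points formula"
  unfolding birational_between_def
proof (intro conjI)
  show "zariski_open src_points" "zariski_open tgt_points"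
    using polyfun2_src_points polyfun2_tgt_points zariski_open_polyfun2 by force+
  show "src_points \<noteq> {}" by (rule src_points_nonempty)
  then show "tgt_points \<noteq> {}" using shift_map_points by blast
  show "bij_betw formula src_points tgt_points" by (rule bij_betw_formula)
  show "regular_map_on src_points formula" by (rule regular_formula)
  show "regular_map_on tgt_points (the_inv_into src_points formula)"
    using regular_shift_inv unfolding regular_map_on_def by (simp add: the_inv_into_formula cong: ball_cong)
qed

lemma dense_open_points:
  "dense_open_in_X \<kappa>1 \<kappa>2 \<theta>1 \<theta>2 c1 c2 c3 c4 (src.cls ` src_points)"
  "dense_open_in_X (q * \<kappa>1) \<kappa>2 (q * \<theta>1) \<theta>2 c1 c2 c3 c4 (tgt.cls ` tgt_points)"
proof -
  have o: "open src_points" "open tgt_points" using polyfun2_src_points polyfun2_tgt_points open_polyfun2 by force+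
  show "dense_open_in_X \<kappa>1 \<kappa>2 \<theta>1 \<theta>2 c1 c2 c3 c4 (src.cls ` src_points)"
    by (intro src.dense_open_cls src_points_regular o src.dense_cls[OF _ finite_bad_y] finite_fiber_src)
  show "dense_open_in_X (q * \<kappa>1) \<kappa>2 (q * \<theta>1) \<theta>2 c1 c2 c3 c4 (tgt.cls ` tgt_points)"
    by (intro tgt.dense_open_cls tgt_points_regular o tgt.dense_cls[OF _ finite_bad_y] finite_fiber_tgt)
qed

end


section \<open>The shift of A on normal forms and on classes\<close>

section \<open>The map\<close>

context shift_params
begin

definition hat :: "complex \<Rightarrow> complex \<Rightarrow> complex \<Rightarrow> complex \<Rightarrow> complex \<Rightarrow> complex \<Rightarrow> quad" where
  "hat a b \<alpha> \<delta> \<gamma> \<beta> = (mk_mat2 (q * \<theta>1) 0 \<beta> \<theta>2, mk_mat2 (q * a) (- q * \<delta>) \<gamma> b,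
     mk_mat2 (q * \<kappa>1) (q * \<alpha>) 0 \<kappa>2)"

lemma is_hat_iff: "is_hat q (src.nf a b \<alpha> \<delta> \<gamma> \<beta>) B \<longleftrightarrow> B = hat a b \<alpha> \<delta> \<gamma> \<beta>"
proof -
  have e: "mk_mat2 (q * z) 0 0 1 ** ev (src.nf a b \<alpha> \<delta> \<gamma> \<beta>) z ** mk_mat2 (inverse z) 0 0 1
      = ev (hat a b \<alpha> \<delta> \<gamma> \<beta>) z" if "z \<noteq> 0" for z
    using that unfolding src.ev_nf hat_def
    by (simp add: mat2_eq_iff mat2_mult_nth field_simps power2_eq_square)
  show ?thesis
  proof
    assume "is_hat q (src.nf a b \<alpha> \<delta> \<gamma> \<beta>) B"
    then show "B = hat a b \<alpha> \<delta> \<gamma> \<beta>"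
      by (intro ev_inject) (simp add: is_hat_def e)
  qed (simp add: is_hat_def e)
qed

lemma hat_mem:
  assumes "src.nf_eqs a b \<alpha> \<delta> \<gamma> \<beta>"
  shows "hat a b \<alpha> \<delta> \<gamma> \<beta> \<in> tgt.XB"
proof -
  have "det (ev (src.nf a b \<alpha> \<delta> \<gamma> \<beta>) z) = src.K z" for z
    using assms src.nf_mem_iff[of a b \<alpha> \<delta> \<gamma> \<beta>] unfolding src.nf_def src.mem_XB_iff by blast
  then have *: "(\<kappa>1 * z^2 + a * z + \<theta>1) * (\<kappa>2 * z^2 + b * z + \<theta>2)
      - (\<alpha> * z - \<delta>) * (z * (\<gamma> * z + \<beta>)) = src.K z" for z
    unfolding src.ev_nf det_2 by simp
  have K: "tgt.K z = q * src.K z" for z by (simp add: src.K_def tgt.K_def)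
  have "det (ev (hat a b \<alpha> \<delta> \<gamma> \<beta>) z) = tgt.K z" for z
    unfolding K *[symmetric] hat_def by (simp add: det_2) algebra
  then show ?thesis unfolding hat_def tgt.mem_XB_iff by (simp add: det_2)
qed

text \<open>The shifted matrix is put into target normal form in an explicit eigenbasis. Cramer's
  rule then gives \<delta>' / \<alpha>' = x, and the new 22 entry at x turns out to be N(x); this is
  the content of the involution.\<close>

lemma hat_in_cls:
  assumes p: "(y, \<xi>) \<in> src_points" and eqs: "src.nf_eqs a b \<alpha> \<delta> \<gamma> \<beta>"
    and \<alpha>: "\<alpha> \<noteq> 0" and \<delta>: "\<delta> = \<alpha> * y" and w: "(\<kappa>1 * y^2 + a * y + \<theta>1) * \<xi> = (y - c1) * (y - c2)"
  shows "hat a b \<alpha> \<delta> \<gamma> \<beta> \<in> tgt.cls (formula (y, \<xi>))"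
proof -
  define m where "m = q * \<kappa>1 - \<kappa>2"
  define k where "k = q * \<theta>1 - \<theta>2"
  define n where "n = q * (y - c1) * (y - c2) / \<xi>"
  define x where "x = other y n"
  define d where "d = lin1 y n"
  define e where "e = lin2 y n"
  have D: "(y, n) \<in> inv_dom" "\<xi> \<noteq> 0" using p by (auto simp: src_points_def to_inv_def n_def)
  have h: "y \<noteq> 0" "y \<noteq> c1" "y \<noteq> c2" "n \<noteq> 0" using inv_dom_nz[OF D(1)] by auto
  have l: "L1 d e \<noteq> 0" "L0 d e \<noteq> 0" "x \<noteq> c1" "x \<noteq> c2" "x \<noteq> c3" "x \<noteq> c4"
    using D(1) by (auto simp: inv_dom_def d_def e_def x_def K_nonzero_iff)
  have n: "n = q * (\<kappa>1 * y^2 + a * y + \<theta>1)"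
    unfolding n_def mult.assoc[of q] w[symmetric] using D(2) by simp
  have "\<alpha>^2 * ((\<kappa>1 * y^2 + a * y + \<theta>1) * (\<kappa>2 * y^2 + b * y + \<theta>2) - src.K y) = 0"
    using src.Phi_root[of y a b \<alpha>] src.nf_eqs_Phi[OF eqs] unfolding \<delta> by simp
  then have "tgt.K y = n * (\<kappa>2 * y^2 + b * y + \<theta>2)"
    using \<alpha> unfolding n by (simp add: src.K_def tgt.K_def)
  then have Kn: "tgt.K y / n = \<kappa>2 * y^2 + b * y + \<theta>2" using h by simp
  have "n - \<kappa>2 * y^2 - q * \<theta>1 = y * (q * a + m * y)" unfolding n m_def by algebra
  then have d: "d = q * a + m * y" using h by (simp add: d_def lin1_def)
  have "tgt.K y / n - q * \<kappa>1 * y^2 - \<theta>2 = y * (b - m * y)" unfolding Kn m_def by algebra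
  then have e: "e = b - m * y" using h by (simp add: e_def lin2_def)
  \<comment> \<open>This is the determinant of the basis (u, v) below. The identity
    \<open>L0 d e = y * \<Delta>\<close> turns the condition on \<open>L0\<close> into its
    invertibility.\<close>
  define \<Delta> where "\<Delta> = k * m + q * \<alpha> * \<beta>"
  have "src.g0 a b = - (\<delta> * \<beta>)" "src.g2 a b = \<alpha> * \<gamma>" using eqs by (simp_all add: src.nf_eqs_def)
  then have g: "src.g0 a b = - (\<alpha> * y * \<beta>)" "src.g2 a b = \<alpha> * \<gamma>" by (simp_all add: \<delta>)
  have "L0 d e = - (q * src.g0 a b - k * m * y)"
    unfolding L0_def d e src.g0_def k_def by algebra
  then have L0: "L0 d e = y * \<Delta>" unfolding g \<Delta>_def by algebra
  have "L1 d e = b * m - q * src.g2 a b - q * a * m - m^2 * y"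
    unfolding L1_def d e src.g2_def m_def by algebra
  then have L1: "L1 d e = b * m - q * (\<alpha> * \<gamma>) - q * a * m - m^2 * y" unfolding g .
  have x: "x = \<Delta> / L1 d e" unfolding x_def other_def d_def[symmetric] e_def[symmetric] L0 using h by simp
  have \<Delta>: "\<Delta> \<noteq> 0" using l(2) unfolding L0 by simp
  have x0: "x \<noteq> 0" using \<Delta> l by (simp add: x)
  let ?B = "hat a b \<alpha> \<delta> \<gamma> \<beta>"
  \<comment> \<open>\<open>u\<close> is the \<open>q * \<theta>1\<close>-eigenvector of the constant
    term of the shifted matrix, and \<open>v\<close> the \<kappa>2-eigenvector of its leading
    term.\<close>
  define u where "u = vec2 k \<beta>"
  define v where "v = vec2 (- q * \<alpha>) m"
  have duv: "det2 u v = \<Delta>" by (simp add: det2_def u_def v_def \<Delta>_def)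
  then have P: "invertible (cols u v)" using \<Delta> by (simp add: invertible_cols_iff)
  have BX: "?B \<in> tgt.XB" by (rule hat_mem[OF eqs])
  have "adapted_basis \<kappa>2 (q * \<theta>1) ?B u v"
    unfolding hat_def using P
    by (simp add: eigenspace_def vec_eq_iff forall_2 mat2_vec_nth u_def v_def k_def m_def algebra_simps)
  then obtain a' b' \<alpha>' \<delta>' \<gamma>' \<beta>' where nf: "conj_by (cols u v) ?B = tgt.nf a' b' \<alpha>' \<delta>' \<gamma>' \<beta>'"
      and eqs': "tgt.nf_eqs a' b' \<alpha>' \<delta>' \<gamma>' \<beta>'"
    by (rule tgt.conj_by_adapted[OF BX])
  note dets = det2_nth_cols[OF P nf[unfolded hat_def tgt.nf_def], unfolded duv mk_mat2_nth]
  have "\<delta>' * \<Delta> = q * \<alpha> * \<Delta>"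
    using dets(1) unfolding det2_def mat2_vec_nth mk_mat2_nth u_def v_def vec2_nth \<Delta>_def k_def
    by algebra
  then have \<delta>': "\<delta>' = q * \<alpha>" using \<Delta> by simp
  have \<alpha>': "\<alpha>' * \<Delta> = q * \<alpha> * L1 d e"
    using dets(2) unfolding det2_def mat2_vec_nth mk_mat2_nth u_def v_def vec2_nth L1 \<delta>
    by algebra
  have \<alpha>0: "\<alpha>' \<noteq> 0" using \<alpha>' \<alpha> q l by auto
  have "\<delta>' * L1 d e = \<alpha>' * x * L1 d e" using \<alpha>' l(1) by (simp add: \<delta>' x)
  then have \<delta>x: "\<delta>' = \<alpha>' * x" using l(1) by simp
  have b': "b' * \<Delta> = k * (b * m - q * \<alpha> * \<gamma>) + q * \<alpha> * \<beta> * d"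
    using dets(4) unfolding det2_def mat2_vec_nth mk_mat2_nth u_def v_def vec2_nth d \<delta>
    by algebra
  \<comment> \<open>The new 22 entry and N share the leading coefficient \<kappa>2, and their
    constant terms differ by \<open>k\<close>; their equality at x amounts to
    \<open>(b' - d) * x = k\<close>.\<close>
  have "(b' - d) * \<Delta> = k * L1 d e"
  proof -
    have "(b' - d) * \<Delta> = k * (b * m - q * \<alpha> * \<gamma>) + q * \<alpha> * \<beta> * d - d * \<Delta>"
      unfolding left_diff_distrib b' ..
    also have "\<dots> = k * L1 d e" unfolding L1 unfolding \<Delta>_def d by algebra
    finally show ?thesis .
  qed
  then have "(b' - d) * x = k" using l(1) by (simp add: x)
  then have N: "\<kappa>2 * x^2 + b' * x + \<theta>2 = mid11 d x" unfolding mid11_def k_def by algebra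
  have "\<alpha>'^2 * ((q * \<kappa>1 * x^2 + a' * x + q * \<theta>1) * (\<kappa>2 * x^2 + b' * x + \<theta>2) - tgt.K x) = 0"
    using tgt.Phi_root[of x a' b' \<alpha>'] tgt.nf_eqs_Phi[OF eqs'] unfolding \<delta>x by simp
  then have M: "(q * \<kappa>1 * x^2 + a' * x + q * \<theta>1) * mid11 d x = tgt.K x"
    using \<alpha>0 unfolding N by simp
  define \<eta> where "\<eta> = mid11 d x / (q * \<kappa>1 * \<kappa>2 * (x - c3) * (x - c4))"
  have F: "formula (y, \<xi>) = (x, \<eta>)"
    unfolding formula_eq_shift_map[OF p] shift_map_def to_inv_def prod.case n_def[symmetric] invol_def of_inv'_def
      d_def[symmetric] x_def[symmetric] \<eta>_def ..
  have "(x, \<eta>) \<in> tgt.regular_points" using shift_map_points[OF p] tgt_points_regular formula_eq_shift_map[OF p] F by auto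
  moreover have "(q * \<kappa>1 * x^2 + a' * x + q * \<theta>1) * \<eta> = (x - c1) * (x - c2)"
  proof -
    have "(q * \<kappa>1 * x^2 + a' * x + q * \<theta>1) * \<eta> = tgt.K x / (q * \<kappa>1 * \<kappa>2 * (x - c3) * (x - c4))"
      unfolding \<eta>_def times_divide_eq_right M ..
    also have "\<dots> = (x - c1) * (x - c2)"
      using q src.nz l unfolding tgt.K_def by simp
    finally show ?thesis .
  qed
  ultimately show ?thesis
    unfolding F using tgt.mem_cls_iff[OF _ BX P nf] \<alpha>0 \<delta>x by blast
qed

text \<open>\<open>phi\<close> is a relational image, so its value is a single class once all
  shifted representatives lie in one class and at least one exists. The standard representative
  \<open>nfp p\<close> provides it.\<close>

lemma phi_cls:
  assumes p: "p \<in> src_points"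
  shows "phi q \<kappa>1 \<kappa>2 \<theta>1 \<theta>2 c1 c2 c3 c4 (src.cls p) = tgt.cls (formula p)"
proof -
  obtain y \<xi> where yx: "p = (y, \<xi>)" by (cases p)
  have reg: "(y, \<xi>) \<in> src.regular_points" using p src_points_regular yx by blast
  have n: "y \<noteq> 0" "\<xi> \<noteq> 0" "y \<noteq> c1" "y \<noteq> c2" using reg by (auto simp: src.regular_points_def)
  define H where "H = {B. \<exists>A\<in>src.cls p. \<exists>u v. adapted_basis \<kappa>2 \<theta>1 A u v \<and> is_hat q (conj_by (cols u v) A) B}"
  have sub: "B \<in> tgt.cls (formula p)" if "B \<in> H" for B
  proof -
    obtain A u v where A: "A \<in> src.cls p" and ad: "adapted_basis \<kappa>2 \<theta>1 A u v"
        and hat: "is_hat q (conj_by (cols u v) A) B"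
      using \<open>B \<in> H\<close> unfolding H_def by blast
    have AX: "A \<in> src.XB" using A src.cls_subset by blast
    have P: "invertible (cols u v)" using ad by (cases A) simp
    obtain a b \<alpha> \<delta> \<gamma> \<beta> where nf: "conj_by (cols u v) A = src.nf a b \<alpha> \<delta> \<gamma> \<beta>"
        and eqs: "src.nf_eqs a b \<alpha> \<delta> \<gamma> \<beta>"
      by (rule src.conj_by_adapted[OF AX ad])
    have B: "B = hat a b \<alpha> \<delta> \<gamma> \<beta>" using hat unfolding nf is_hat_iff .
    have "\<alpha> \<noteq> 0 \<and> \<delta> = \<alpha> * y \<and> (\<kappa>1 * y^2 + a * y + \<theta>1) * \<xi> = (y - c1) * (y - c2)"
      using src.mem_cls_iff[OF reg AX P nf] A yx by blast
    then show ?thesis unfolding B yx by (intro hat_in_cls p[unfolded yx] eqs) auto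
  qed
  have "H \<noteq> {}"
  proof -
    have c: "cols (vec2 1 0) (vec2 0 1) = mat 1" by (simp add: mat2_eq_iff mat_def)
    let ?a = "src.a_of y \<xi>" and ?b = "src.b_of y \<xi>"
    have nf: "conj_by (cols (vec2 1 0) (vec2 0 1)) (src.nfp p)
        = src.nf ?a ?b 1 y (src.g2 ?a ?b) (src.g1 ?a ?b + y * src.g2 ?a ?b)"
      by (simp add: c yx src.nfp_def Let_def)
    have "adapted_basis \<kappa>2 \<theta>1 (src.nfp p) (vec2 1 0) (vec2 0 1)"
      by (rule src.adapted_of_conj_by[OF _ nf]) (simp only: c invertible_mat_1)
    moreover have "src.nfp p \<in> src.cls p"
      using src.nfp_mem[OF reg] equiv_class_self[OF equiv_conj_rel] yx by (auto simp: src.cls_def)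
    moreover have "is_hat q (conj_by (cols (vec2 1 0) (vec2 0 1)) (src.nfp p))
        (hat ?a ?b 1 y (src.g2 ?a ?b) (src.g1 ?a ?b + y * src.g2 ?a ?b))"
      unfolding nf is_hat_iff ..
    ultimately show ?thesis unfolding H_def by blast
  qed
  have "phi q \<kappa>1 \<kappa>2 \<theta>1 \<theta>2 c1 c2 c3 c4 (src.cls p) = (\<Union>B\<in>H. conj_rel tgt.XB `` {B})"
    unfolding phi_def H_def[symmetric] by blast
  also have "\<dots> = tgt.cls (formula p)" using tgt.cls_eq[OF sub] \<open>H \<noteq> {}\<close> by auto
  finally show ?thesis .
qed

lemma bij_betw_phi:
  "bij_betw (phi q \<kappa>1 \<kappa>2 \<theta>1 \<theta>2 c1 c2 c3 c4) (src.cls ` src_points) (tgt.cls ` tgt_points)"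
  by (rule bij_betw_byWitness[where
      f' = "\<lambda>x. src.cls (shift_inv (coords (q * \<kappa>1) \<kappa>2 (q * \<theta>1) \<theta>2 c1 c2 x))"])
    (auto simp: phi_cls formula_eq_shift_map shift_map_points shift_inv_map shift_inv_points shift_map_inv
      tgt.coords_cls[OF subsetD[OF tgt_points_regular]])

end

theorem proposition4p3:
  fixes q \<kappa>1 \<kappa>2 \<theta>1 \<theta>2 c1 c2 c3 c4 :: complex
  assumes "q \<noteq> 0"
    and "\<kappa>1 \<noteq> 0" "\<kappa>2 \<noteq> 0" "\<theta>1 \<noteq> 0" "\<theta>2 \<noteq> 0" "c1 \<noteq> 0" "c2 \<noteq> 0" "c3 \<noteq> 0" "c4 \<noteq> 0"
    and "\<kappa>1 * \<kappa>2 * c1 * c2 * c3 * c4 = \<theta>1 * \<theta>2"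
    and "generic_params q \<kappa>1 \<kappa>2 \<theta>1 \<theta>2 c1 c2 c3 c4"
  shows "\<exists>U V W W'.
    birational_between U V (phi_formula q \<kappa>1 \<kappa>2 \<theta>1 \<theta>2 c1 c2 c3 c4) \<and>
    (\<forall>(y, \<xi>) \<in> U. y \<noteq> 0 \<and> \<xi> \<noteq> 0 \<and> T_poly q \<kappa>1 \<kappa>2 \<theta>1 \<theta>2 c1 c2 c3 c4 y \<xi> \<noteq> 0 \<and>
                   xi_den q \<kappa>1 \<kappa>2 \<theta>2 c3 c4 y \<xi> \<noteq> 0) \<and>
    dense_open_in_X \<kappa>1 \<kappa>2 \<theta>1 \<theta>2 c1 c2 c3 c4 W \<and>
    W \<subseteq> coord_dom \<kappa>1 \<kappa>2 \<theta>1 \<theta>2 c1 c2 c3 c4 \<and>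
    bij_betw (coords \<kappa>1 \<kappa>2 \<theta>1 \<theta>2 c1 c2) W U \<and>
    dense_open_in_X (q * \<kappa>1) \<kappa>2 (q * \<theta>1) \<theta>2 c1 c2 c3 c4 W' \<and>
    W' \<subseteq> coord_dom (q * \<kappa>1) \<kappa>2 (q * \<theta>1) \<theta>2 c1 c2 c3 c4 \<and>
    bij_betw (coords (q * \<kappa>1) \<kappa>2 (q * \<theta>1) \<theta>2 c1 c2) W' V \<and>
    bij_betw (phi q \<kappa>1 \<kappa>2 \<theta>1 \<theta>2 c1 c2 c3 c4) W W' \<and>
    (\<forall>x\<in>W. coords (q * \<kappa>1) \<kappa>2 (q * \<theta>1) \<theta>2 c1 c2 (phi q \<kappa>1 \<kappa>2 \<theta>1 \<theta>2 c1 c2 c3 c4 x) =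
            phi_formula q \<kappa>1 \<kappa>2 \<theta>1 \<theta>2 c1 c2 c3 c4 (coords \<kappa>1 \<kappa>2 \<theta>1 \<theta>2 c1 c2 x))"
proof -
  let ?M = "{c1*c2, c1*c3, c1*c4, c2*c3, c2*c4, c3*c4}"
  have g: "\<kappa>1 \<noteq> \<kappa>2" "\<theta>1 \<noteq> \<theta>2" "q * \<kappa>1 \<noteq> \<kappa>2" "q * \<theta>1 \<noteq> \<theta>2"
    and gm: "\<And>m. m \<in> ?M \<Longrightarrow> \<theta>1 \<noteq> \<kappa>1 * m \<and> \<theta>1 \<noteq> \<kappa>2 * m \<and> q * \<theta>1 \<noteq> \<kappa>2 * m"
    using assms(11) unfolding generic_params_def by blast+
  \<comment> \<open>Each pair product m has a complementary m' with m m' = c1 c2 c3 c4. The relation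
    between the parameters thus turns a forbidden value of \<theta>2 into a forbidden value of
    \<theta>1, or of q \<theta>1 for the target.\<close>
  have compl: "\<exists>m'\<in>?M. \<theta>1 * \<theta>2 = \<kappa>1 * \<kappa>2 * (m * m') \<and> m \<noteq> 0" if "m \<in> ?M" for m
    using that unfolding assms(10)[symmetric]
    by (elim insertE emptyE) (use assms(6-9) in \<open>simp_all add: ac_simps\<close>)
  have th2: "\<theta>2 \<noteq> \<kappa>1 * m \<and> \<theta>2 \<noteq> q * \<kappa>1 * m" if m: "m \<in> ?M" for m
  proof -
    obtain m' where m': "m' \<in> ?M" "\<theta>1 * \<theta>2 = \<kappa>1 * \<kappa>2 * (m * m')" "m \<noteq> 0"
      using compl[OF m] by blast
    have "\<theta>1 = \<kappa>2 * m'" if "\<theta>2 = \<kappa>1 * m"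
      using m'(2,3) that assms(2) by (simp add: ac_simps)
    moreover have "q * \<theta>1 = \<kappa>2 * m'" if "\<theta>2 = q * \<kappa>1 * m"
      using m'(2,3) that assms(2) by (simp add: ac_simps)
    ultimately show ?thesis using gm[OF m'(1)] by blast
  qed
  interpret shift_params q \<kappa>1 \<kappa>2 \<theta>1 \<theta>2 c1 c2 c3 c4
  proof
    show "q * \<kappa>1 * \<kappa>2 * c1 * c2 * c3 * c4 = q * \<theta>1 * \<theta>2"
      using assms(10) by (simp add: mult.assoc)
    show "\<theta>1 \<noteq> \<kappa>1 * m \<and> \<theta>2 \<noteq> \<kappa>1 * m" if "m \<in> ?M" for m
      using gm[OF that] th2[OF that] by blast
    show "q * \<theta>1 \<noteq> q * \<kappa>1 * m \<and> \<theta>2 \<noteq> q * \<kappa>1 * m" if "m \<in> ?M" for m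
      using gm[OF that] th2[OF that] assms(1) by simp
  qed (use assms g in simp_all)
  have U: "\<forall>(y, \<xi>) \<in> src_points. y \<noteq> 0 \<and> \<xi> \<noteq> 0 \<and> T_poly q \<kappa>1 \<kappa>2 \<theta>1 \<theta>2 c1 c2 c3 c4 y \<xi> \<noteq> 0 \<and>
      xi_den q \<kappa>1 \<kappa>2 \<theta>2 c3 c4 y \<xi> \<noteq> 0"
    using phi_formula_eq(2,3) src_points_regular by (auto simp: src.regular_points_def)
  have dom: "src.cls ` src_points \<subseteq> coord_dom \<kappa>1 \<kappa>2 \<theta>1 \<theta>2 c1 c2 c3 c4"
    "tgt.cls ` tgt_points \<subseteq> coord_dom (q * \<kappa>1) \<kappa>2 (q * \<theta>1) \<theta>2 c1 c2 c3 c4"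
    using src.cls_coord_dom src_points_regular tgt.cls_coord_dom tgt_points_regular by blast+
  have "coords (q * \<kappa>1) \<kappa>2 (q * \<theta>1) \<theta>2 c1 c2 (phi q \<kappa>1 \<kappa>2 \<theta>1 \<theta>2 c1 c2 c3 c4 (src.cls p)) =
      formula (coords \<kappa>1 \<kappa>2 \<theta>1 \<theta>2 c1 c2 (src.cls p))" if p: "p \<in> src_points" for p
    using src.coords_cls[OF subsetD[OF src_points_regular p]]
      tgt.coords_cls[OF subsetD[OF tgt_points_regular shift_map_points[OF p]]]
    by (simp add: phi_cls[OF p] formula_eq_shift_map[OF p])
  then have "\<forall>x\<in>src.cls ` src_points. coords (q * \<kappa>1) \<kappa>2 (q * \<theta>1) \<theta>2 c1 c2 (phi q \<kappa>1 \<kappa>2 \<theta>1 \<theta>2 c1 c2 c3 c4 x) =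
      formula (coords \<kappa>1 \<kappa>2 \<theta>1 \<theta>2 c1 c2 x)" by blast
  then show ?thesis
    using birational_formula U dense_open_points dom src.bij_betw_coords[OF src_points_regular]
      tgt.bij_betw_coords[OF tgt_points_regular] bij_betw_phi by blast
qed

end
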